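(* Let $(M,g)=(M_1\times M_2,g_1\times g_2)$ be a special Einstein product. Then the conformal structure $(M,[g])$ admits an almost Einstein structure if and only if one of the factors $(M_1,[g_1])$ or $(M_2,[g_2])$ admits at least two linearly independent almost Einstein structures. Likewise, $(M,[g])$ admits a directed almost Einstein structure if and only if one of the factors $(M_1,[g_1])$ or $(M_2,[g_2])$ admits at least two linearly independent directed almost Einstein structures.
   Context: All manifolds are smooth and connected, all metrics Riemannian. Standard tractors of a conformal manifold $(M^d,c)$, $d\ge3$: $\mathcal{E}[w]$ denotes the line bundle whose sections are families $(f_g)_{g\in c}$ with $f_{e^{2\omega}g}=e^{w\omega}f_g$; $\mathbf{g}$ is the conformal metric (represented by $g$ in the scale $g$), used to raise and lower indices; the Schouten tensor $P$ is given by $\mathrm{Ric}=(d-2)P+Jg$, $J=\mathrm{tr}_gP$. Each $g\in c$ identifies the standard tractor bundle with $\mathcal{E}[1]\oplus T^*M[1]\oplus\mathcal{E}[-1]\ni(\sigma,\mu_a,\rho)$, with transformation under $\hat g=e^{2\omega}g$, $\Upsilon=d\omega$: $(\hat\sigma,\hat\mu_b,\hat\rho)=(\sigma,\mu_b+\sigma\Upsilon_b,\rho-\Upsilon^b\mu_b-\tfrac12\sigma\Upsilon^b\Upsilon_b)$. The tractor metric is $h(U,U)=2\sigma\rho+\mu^a\mu_a$, and the normal tractor connection is $\nabla_a(\sigma,\mu^b,\rho)=(\nabla_a\sigma-\mu_a,\nabla_a\mu^b+\delta_a{}^b\rho+P_a{}^b\sigma,\nabla_a\rho-P_{ac}\mu^c)$.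 Tractors of an Einstein manifold $(N^m,g)$, $m\geq1$ (for $m=2$, Einstein means constant scalar curvature; for $m=1$ every metric is Einstein): trivialising densities by $g$, sections are triples $(s,t^a,r)$ of functions $s,r$ and a vector field $t$, with connection $$\nabla_a(s,t^b,r)=(\nabla_as-t_a,\ \nabla_at^b+\delta_a{}^b(r+\mu s),\ \nabla_ar-\mu t_a),$$ where $\mu=\mathrm{Sc}^g/(2m(m-1))$ if $m\ge2$, while for $m=1$ the number $\mu\in\mathbb{R}$ is part of the chosen data. For $m\geq3$ this agrees with the normal tractor connection above; for $m=1,2$ it is the definition. The metric is $2sr+g(t,t)$. The Einstein tractor is the parallel tractor $I=(1,0,-\mu)$, with $|I|^2=-2\mu$. A special Einstein product is a product $(M_1^{m_1}\times M_2^{m_2},g_1\times g_2)$ with $m_1,m_2\geq1$, $m_1+m_2\geq3$, where each $(M_i,g_i)$ is Einstein with Einstein tractor $I_i$ and $|I_1|^2=-|I_2|^2\neq0$. A directed almost Einstein structure is a non-zero parallel standard tractor $I$. An almost Einstein structure $[I]$ is given by an open cover with a non-zero parallel tractor $I_U$ on each set $U$ of the cover, such that $I_U=\pm I_V$ on overlaps $U\cap V$. Linear independence of (directed) almost Einstein structures means linear independence of the corresponding (local) parallel tractors. *)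

theory Defs
  imports "HOL-Analysis.Analysis"
begin

section \<open>Smooth maps between normed spaces\<close>

primrec Ck_on ::
  "nat \<Rightarrow> 'a::real_normed_vector set \<Rightarrow> ('a \<Rightarrow> 'b::real_normed_vector) \<Rightarrow> bool" where
  "Ck_on 0 S f \<longleftrightarrow> continuous_on S f"
| "Ck_on (Suc k) S f \<longleftrightarrow>
     (\<forall>x\<in>S. f differentiable (at x)) \<and>
     (\<forall>v. Ck_on k S (\<lambda>x. frechet_derivative f (at x) v))"

text \<open>Only meant for open \<open>S\<close>.\<close>

definition smooth_on ::
  "'a::real_normed_vector set \<Rightarrow> ('a \<Rightarrow> 'b::real_normed_vector) \<Rightarrow> bool" where
  "smooth_on S f \<longleftrightarrow> (\<forall>k. Ck_on k S f)"


section \<open>Smooth manifolds\<close>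

text \<open>
  A chart is a pair of its domain and its coordinate map; the values of the coordinate map
  outside the domain are irrelevant. The manifold is the whole type \<open>'a\<close>, the
  dimension is \<open>CARD('n)\<close>, and an atlas is a family of charts indexed by a type. It need
  not be maximal.
\<close>

type_synonym ('a, 'n) chart = "'a set \<times> ('a \<Rightarrow> real^'n)"
type_synonym ('i, 'a, 'n) atlas = "'i \<Rightarrow> ('a, 'n) chart"

abbreviation chart_dom :: "('a, 'n) chart \<Rightarrow> 'a set" where
  "chart_dom c \<equiv> fst c"

abbreviation coords :: "('a, 'n) chart \<Rightarrow> 'a \<Rightarrow> real^'n" where
  "coords c \<equiv> snd c"

definition chart_inv :: "('a, 'n) chart \<Rightarrow> real^'n \<Rightarrow> 'a" where
  "chart_inv c = inv_into (chart_dom c) (coords c)"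

definition is_chart :: "('a::topological_space, 'n::finite) chart \<Rightarrow> bool" where
  "is_chart c \<longleftrightarrow>
     open (chart_dom c) \<and> open (coords c ` chart_dom c) \<and>
     homeomorphism (chart_dom c) (coords c ` chart_dom c) (coords c) (chart_inv c)"

definition smooth_manifold ::
  "('i, 'a::{second_countable_topology, t2_space}, 'n::finite) atlas \<Rightarrow> bool" where
  "smooth_manifold A \<longleftrightarrow>
     connected (UNIV :: 'a set) \<and>
     (\<forall>i. is_chart (A i)) \<and>
     (\<Union>i. chart_dom (A i)) = UNIV \<and>
     (\<forall>i j. smooth_on (coords (A i) ` (chart_dom (A i) \<inter> chart_dom (A j)))
              (\<lambda>x. coords (A j) (chart_inv (A i) x)))"

text \<open>
  Smoothness on \<open>U\<close> of a quantity read in the chart \<open>c\<close> (a function, or the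
  components of a tensor field with respect to \<open>c\<close>), as a function of the coordinates.
\<close>

definition smooth_in_chart ::
  "('a, 'n::finite) chart \<Rightarrow> 'a set \<Rightarrow> ('a \<Rightarrow> 'b::real_normed_vector) \<Rightarrow> bool" where
  "smooth_in_chart c U f \<longleftrightarrow>
     smooth_on (coords c ` (U \<inter> chart_dom c)) (\<lambda>x. f (chart_inv c x))"

text \<open>The coordinate derivative \<open>\<partial>f/\<partial>x\<^sup>a\<close> at \<open>p\<close>.\<close>

definition pderiv_chart ::
  "('a, 'n::finite) chart \<Rightarrow> 'n \<Rightarrow> ('a \<Rightarrow> 'b::real_normed_vector) \<Rightarrow> 'a \<Rightarrow> 'b" where
  "pderiv_chart c a f p =
     frechet_derivative (\<lambda>x. f (chart_inv c x)) (at (coords c p)) (axis a 1)"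

text \<open>\<open>chart_jacobian c d p $ b $ a\<close> is \<open>\<partial>y\<^sup>b/\<partial>x\<^sup>a\<close> for the coordinates \<open>x\<close> of \<open>c\<close> and
  \<open>y\<close> of \<open>d\<close>.\<close>

definition chart_jacobian ::
  "('a, 'n::finite) chart \<Rightarrow> ('a, 'n) chart \<Rightarrow> 'a \<Rightarrow> real^'n^'n" where
  "chart_jacobian c d p = jacobian (\<lambda>x. coords d (chart_inv c x)) (at (coords c p))"


section \<open>Riemannian metrics and curvature\<close>

text \<open>
  Tensor fields are families of components: \<open>g i p $ a $ b\<close> is \<open>g\<^sub>a\<^sub>b\<close> at \<open>p\<close>
  with respect to the \<open>i\<close>-th chart. Values at points outside the chart domain are irrelevant.
\<close>

type_synonym ('i, 'a, 'n) metric_comps = "'i \<Rightarrow> 'a \<Rightarrow> real^'n^'n"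

definition riemannian_metric ::
  "('i, 'a, 'n::finite) atlas \<Rightarrow> ('i, 'a, 'n) metric_comps \<Rightarrow> bool" where
  "riemannian_metric A g \<longleftrightarrow>
     (\<forall>i. smooth_in_chart (A i) UNIV (g i)) \<and>
     (\<forall>i. \<forall>p\<in>chart_dom (A i).
        transpose (g i p) = g i p \<and> (\<forall>v. v \<noteq> 0 \<longrightarrow> 0 < v \<bullet> (g i p *v v))) \<and>
     (\<forall>i j. \<forall>p\<in>chart_dom (A i) \<inter> chart_dom (A j).
        g i p = transpose (chart_jacobian (A i) (A j) p) ** g j p ** chart_jacobian (A i) (A j) p)"

text \<open>\<open>christoffel A g i p c a b\<close> is \<open>\<Gamma>\<^sup>c\<^sub>a\<^sub>b\<close> of the Levi-Civita connection.\<close>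

definition christoffel ::
  "('i, 'a, 'n::finite) atlas \<Rightarrow> ('i, 'a, 'n) metric_comps \<Rightarrow> 'i \<Rightarrow> 'a \<Rightarrow> 'n \<Rightarrow> 'n \<Rightarrow> 'n \<Rightarrow> real" where
  "christoffel A g i p c a b =
     (\<Sum>d\<in>UNIV. matrix_inv (g i p) $ c $ d *
        (pderiv_chart (A i) a (\<lambda>q. g i q $ d $ b) p
         + pderiv_chart (A i) b (\<lambda>q. g i q $ d $ a) p
         - pderiv_chart (A i) d (\<lambda>q. g i q $ a $ b) p)) / 2"

text \<open>
  \<open>riemann A g i p a b c d\<close> is \<open>R\<^sub>a\<^sub>b\<^sup>c\<^sub>d\<close>, where
  \<open>(\<nabla>\<^sub>a \<nabla>\<^sub>b - \<nabla>\<^sub>b \<nabla>\<^sub>a) v\<^sup>c = R\<^sub>a\<^sub>b\<^sup>c\<^sub>d v\<^sup>d\<close>. With the contraction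
  \<open>Ric\<^sub>b\<^sub>d = R\<^sub>a\<^sub>b\<^sup>a\<^sub>d\<close> round spheres have positive Ricci curvature.
\<close>

definition riemann ::
  "('i, 'a, 'n::finite) atlas \<Rightarrow> ('i, 'a, 'n) metric_comps \<Rightarrow> 'i \<Rightarrow> 'a \<Rightarrow> 'n \<Rightarrow> 'n \<Rightarrow> 'n \<Rightarrow> 'n \<Rightarrow> real" where
  "riemann A g i p a b c d =
     pderiv_chart (A i) a (\<lambda>q. christoffel A g i q c b d) p
     - pderiv_chart (A i) b (\<lambda>q. christoffel A g i q c a d) p
     + (\<Sum>e\<in>UNIV. christoffel A g i p c a e * christoffel A g i p e b d
                 - christoffel A g i p c b e * christoffel A g i p e a d)"

definition ricci ::
  "('i, 'a, 'n::finite) atlas \<Rightarrow> ('i, 'a, 'n) metric_comps \<Rightarrow> 'i \<Rightarrow> 'a \<Rightarrow> real^'n^'n" where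
  "ricci A g i p = (\<chi> b d. \<Sum>a\<in>UNIV. riemann A g i p a b a d)"

definition metric_trace :: "real^'n^'n \<Rightarrow> real^'n^'n \<Rightarrow> real" where
  "metric_trace G B = (\<Sum>a\<in>UNIV. \<Sum>b\<in>UNIV. matrix_inv G $ a $ b * B $ a $ b)"

definition scalar_curvature ::
  "('i, 'a, 'n::finite) atlas \<Rightarrow> ('i, 'a, 'n) metric_comps \<Rightarrow> 'i \<Rightarrow> 'a \<Rightarrow> real" where
  "scalar_curvature A g i p = metric_trace (g i p) (ricci A g i p)"

text \<open>
  The solution \<open>P\<close> of \<open>Ric = (d - 2) P + (tr P) g\<close>, see \<open>schouten_iff\<close>. It is meaningful for
  dimension \<open>d \<ge> 3\<close> only.
\<close>

definition schouten ::
  "('i, 'a, 'n::finite) atlas \<Rightarrow> ('i, 'a, 'n) metric_comps \<Rightarrow> 'i \<Rightarrow> 'a \<Rightarrow> real^'n^'n" where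
  "schouten A g i p =
     (1 / (real CARD('n) - 2)) *\<^sub>R
       (ricci A g i p - (scalar_curvature A g i p / (2 * (real CARD('n) - 1))) *\<^sub>R g i p)"

lemma metric_trace_self:
  fixes G :: "real^'n^'n"
  assumes "invertible G" "transpose G = G"
  shows "metric_trace G G = real CARD('n)"
proof -
  have "metric_trace G G = trace (matrix_inv G ** transpose G)"
    by (simp add: metric_trace_def trace_def matrix_matrix_mult_def transpose_def)
  also have "\<dots> = trace (mat 1 :: real^'n^'n)"
    using assms(2) someI_ex[OF assms(1)[unfolded invertible_def]]
    by (simp add: matrix_inv_def)
  finally show ?thesis
    by (simp add: trace_I)
qed

lemma metric_trace_add: "metric_trace G (B + C) = metric_trace G B + metric_trace G C"
  by (simp add: metric_trace_def sum.distrib algebra_simps)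

lemma metric_trace_scaleR: "metric_trace G (r *\<^sub>R B) = r * metric_trace G B"
  by (simp add: metric_trace_def sum_distrib_left mult.left_commute)

lemma schouten_iff:
  fixes g :: "('i, 'a, 'n::finite) metric_comps"
  assumes "invertible (g i p)" "transpose (g i p) = g i p" "CARD('n) \<ge> 3"
  shows "ricci A g i p = (real CARD('n) - 2) *\<^sub>R P + metric_trace (g i p) P *\<^sub>R g i p
           \<longleftrightarrow> P = schouten A g i p"
    (is "?R = ?n *\<^sub>R P + ?J *\<^sub>R ?g \<longleftrightarrow> _")
proof -
  let ?d = "real CARD('n)" and ?S = "scalar_curvature A g i p"
  note tr = metric_trace_self[OF assms(1,2)]
  have d: "?d \<ge> 3"
    using assms(3) by simp
  show ?thesis
  proof
    assume eq: "?R = ?n *\<^sub>R P + ?J *\<^sub>R ?g"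
    have "?S = ?n * ?J + ?J * ?d"
      by (simp add: scalar_curvature_def eq metric_trace_add metric_trace_scaleR tr)
    then have "?J = ?S / (2 * (?d - 1))"
      using d by (simp add: field_simps)
    then show "P = schouten A g i p"
      using d eq by (simp add: schouten_def)
  next
    assume P: "P = schouten A g i p"
    have "P = (1 / ?n) *\<^sub>R (?R + (- (?S / (2 * (?d - 1)))) *\<^sub>R ?g)"
      by (simp add: P schouten_def)
    then have "?J = (1 / ?n) * (?S + (- (?S / (2 * (?d - 1)))) * ?d)"
      by (simp only: metric_trace_add metric_trace_scaleR tr scalar_curvature_def)
    also have "\<dots> = ?S / (2 * (?d - 1))"
      using d by (simp add: divide_simps) (simp add: algebra_simps)
    finally show "?R = ?n *\<^sub>R P + ?J *\<^sub>R ?g"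
      using d by (simp add: P schouten_def)
  qed
qed

text \<open>\<open>cov_deriv A g i a v p $ b\<close> is \<open>\<nabla>\<^sub>a v\<^sup>b\<close>, for the components \<open>v\<close> of a vector field
  in the \<open>i\<close>-th chart.\<close>

definition cov_deriv ::
  "('i, 'a, 'n::finite) atlas \<Rightarrow> ('i, 'a, 'n) metric_comps \<Rightarrow> 'i \<Rightarrow> 'n
     \<Rightarrow> ('a \<Rightarrow> real^'n) \<Rightarrow> 'a \<Rightarrow> real^'n" where
  "cov_deriv A g i a v p =
     (\<chi> b. pderiv_chart (A i) a (\<lambda>q. v q $ b) p + (\<Sum>c\<in>UNIV. christoffel A g i p b a c * v p $ c))"


section \<open>Sections given by triples\<close>

text \<open>
  A section of a tractor bundle is given by its triples with respect to all
  trivialisations \<open>k\<close>; \<open>D k\<close> is the set on which the trivialisation \<open>k\<close> is defined.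
  In the Einstein case \<open>k\<close> is a chart index, in the conformal case a pair of a metric in the
  conformal class and a chart index.
\<close>

type_synonym 'n triple = "real \<times> (real^'n) \<times> real"
type_synonym ('k, 'a, 'n) triple_field = "'k \<Rightarrow> 'a \<Rightarrow> 'n triple"

definition vanishes_on ::
  "('k \<Rightarrow> 'a set) \<Rightarrow> 'a set \<Rightarrow> ('k, 'a, 'n::finite) triple_field \<Rightarrow> bool" where
  "vanishes_on D W S \<longleftrightarrow> (\<forall>k. \<forall>p\<in>W \<inter> D k. S k p = 0)"

definition lin_indep_on ::
  "('k \<Rightarrow> 'a set) \<Rightarrow> 'a set \<Rightarrow> ('k, 'a, 'n::finite) triple_field
     \<Rightarrow> ('k, 'a, 'n) triple_field \<Rightarrow> bool" where
  "lin_indep_on D W S T \<longleftrightarrow>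
     (\<forall>\<alpha> \<beta>. vanishes_on D W (\<lambda>k p. \<alpha> *\<^sub>R S k p + \<beta> *\<^sub>R T k p) \<longrightarrow> \<alpha> = 0 \<and> \<beta> = 0)"

text \<open>
  In the following, \<open>par U S\<close> stands for: \<open>S\<close> is a parallel tractor on the open set \<open>U\<close>.
  The sign in \<open>I\<^sub>U = \<plusminus>I\<^sub>V\<close> is allowed to depend on the point of \<open>U \<inter> V\<close>; it is then
  constant on connected subsets, since non-vanishing sections are continuous.
\<close>

definition directed_structure ::
  "('k \<Rightarrow> 'a set) \<Rightarrow> ('a set \<Rightarrow> ('k, 'a, 'n::finite) triple_field \<Rightarrow> bool)
     \<Rightarrow> ('k, 'a, 'n) triple_field \<Rightarrow> bool" where
  "directed_structure D par S \<longleftrightarrow> par UNIV S \<and> \<not> vanishes_on D UNIV S"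

definition almost_structure ::
  "('k \<Rightarrow> 'a::topological_space set) \<Rightarrow> ('a set \<Rightarrow> ('k, 'a, 'n::finite) triple_field \<Rightarrow> bool)
     \<Rightarrow> 'a set set \<Rightarrow> ('a set \<Rightarrow> ('k, 'a, 'n) triple_field) \<Rightarrow> bool" where
  "almost_structure D par \<U> I \<longleftrightarrow>
     (\<forall>U\<in>\<U>. open U) \<and> \<Union>\<U> = UNIV \<and>
     (\<forall>U\<in>\<U>. par U (I U) \<and> \<not> vanishes_on D U (I U)) \<and>
     (\<forall>U\<in>\<U>. \<forall>V\<in>\<U>. \<forall>p\<in>U \<inter> V.
        vanishes_on D {p} (\<lambda>k q. I U k q - I V k q) \<or>
        vanishes_on D {p} (\<lambda>k q. I U k q + I V k q))"

text \<open>
  Linear independence of almost Einstein structures is tested on every non-empty open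
  subset of an overlap: on a disconnected overlap the relative sign of two representatives
  may vary between components, so that independence on the whole overlap would be too weak.
\<close>

definition almost_lin_indep ::
  "('k \<Rightarrow> 'a::topological_space set)
     \<Rightarrow> 'a set set \<Rightarrow> ('a set \<Rightarrow> ('k, 'a, 'n::finite) triple_field)
     \<Rightarrow> 'a set set \<Rightarrow> ('a set \<Rightarrow> ('k, 'a, 'n) triple_field) \<Rightarrow> bool" where
  "almost_lin_indep D \<U> I \<V> J \<longleftrightarrow>
     (\<forall>U\<in>\<U>. \<forall>V\<in>\<V>. \<forall>W. open W \<and> W \<noteq> {} \<and> W \<subseteq> U \<inter> V \<longrightarrow> lin_indep_on D W (I U) (J V))"


section \<open>Standard tractors of a conformal manifold\<close>

definition conformal_rescaling ::
  "('i, 'a, 'n::finite) atlas \<Rightarrow> ('i, 'a, 'n) metric_comps \<Rightarrow> ('a \<Rightarrow> real)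
     \<Rightarrow> ('i, 'a, 'n) metric_comps \<Rightarrow> bool" where
  "conformal_rescaling A g \<omega> h \<longleftrightarrow>
     (\<forall>i. smooth_in_chart (A i) UNIV \<omega>) \<and>
     (\<forall>i. \<forall>p\<in>chart_dom (A i). h i p = exp (2 * \<omega> p) *\<^sub>R g i p)"

definition conformal_class ::
  "('i, 'a, 'n::finite) atlas \<Rightarrow> ('i, 'a, 'n) metric_comps \<Rightarrow> ('i, 'a, 'n) metric_comps set" where
  "conformal_class A g = {h. \<exists>\<omega>. conformal_rescaling A g \<omega> h}"

text \<open>
  The triple in the scale \<open>g\<close> consists of \<open>\<sigma>\<close>, the covector components \<open>\<mu>\<^sub>a\<close> and \<open>\<rho>\<close>,
  with the densities trivialised by \<open>g\<close>. Hence the powers of \<open>e\<^sup>\<omega>\<close> in the passage to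
  \<open>e\<^sup>2\<^sup>\<omega> g\<close>: the weights are \<open>1\<close>, \<open>1\<close> and \<open>-1\<close>.
\<close>

definition scale_change ::
  "('i, 'a, 'n::finite) atlas \<Rightarrow> ('i, 'a, 'n) metric_comps \<Rightarrow> ('a \<Rightarrow> real) \<Rightarrow> 'i \<Rightarrow> 'a
     \<Rightarrow> 'n triple \<Rightarrow> 'n triple" where
  "scale_change A g \<omega> i p = (\<lambda>(\<sigma>, \<mu>, \<rho>).
     let \<Upsilon> = (\<chi> b. pderiv_chart (A i) b \<omega> p);
         \<Upsilon>up = matrix_inv (g i p) *v \<Upsilon>
     in (exp (\<omega> p) * \<sigma>,
         exp (\<omega> p) *\<^sub>R (\<mu> + \<sigma> *\<^sub>R \<Upsilon>),
         exp (- \<omega> p) * (\<rho> - \<Upsilon>up \<bullet> \<mu> - \<sigma> * (\<Upsilon>up \<bullet> \<Upsilon>) / 2)))"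

definition scale_dom ::
  "('i, 'a, 'n::finite) atlas \<Rightarrow> ('i, 'a, 'n) metric_comps set
     \<Rightarrow> ('i, 'a, 'n) metric_comps \<times> 'i \<Rightarrow> 'a set" where
  "scale_dom A c = (\<lambda>(g, i). if g \<in> c then chart_dom (A i) else {})"

definition standard_tractor_on ::
  "('i, 'a, 'n::finite) atlas \<Rightarrow> ('i, 'a, 'n) metric_comps set \<Rightarrow> 'a set
     \<Rightarrow> (('i, 'a, 'n) metric_comps \<times> 'i, 'a, 'n) triple_field \<Rightarrow> bool" where
  "standard_tractor_on A c U T \<longleftrightarrow>
     (\<forall>g\<in>c. \<forall>i. smooth_in_chart (A i) U (T (g, i))) \<and>
     (\<forall>g\<in>c. \<forall>i j. \<forall>p\<in>U \<inter> chart_dom (A i) \<inter> chart_dom (A j).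
        T (g, i) p = (case T (g, j) p of (\<sigma>, \<mu>, \<rho>) \<Rightarrow>
          (\<sigma>, transpose (chart_jacobian (A i) (A j) p) *v \<mu>, \<rho>))) \<and>
     (\<forall>g\<in>c. \<forall>h\<in>c. \<forall>\<omega>. conformal_rescaling A g \<omega> h \<longrightarrow>
        (\<forall>i. \<forall>p\<in>U \<inter> chart_dom (A i). T (h, i) p = scale_change A g \<omega> i p (T (g, i) p)))"

text \<open>The triple \<open>\<nabla>\<^sub>a (\<sigma>, \<mu>\<^sup>b, \<rho>)\<close>, in the scale \<open>g\<close> and the \<open>i\<close>-th chart. The
  argument \<open>X\<close> has a covector in the middle slot, the result a vector.\<close>

definition normal_tractor_deriv ::
  "('i, 'a, 'n::finite) atlas \<Rightarrow> ('i, 'a, 'n) metric_comps \<Rightarrow> 'i \<Rightarrow> 'n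
     \<Rightarrow> ('a \<Rightarrow> 'n triple) \<Rightarrow> 'a \<Rightarrow> 'n triple" where
  "normal_tractor_deriv A g i a X p =
     (let \<sigma> = (\<lambda>q. fst (X q));
          \<mu> = (\<lambda>q. fst (snd (X q)));
          \<rho> = (\<lambda>q. snd (snd (X q)));
          \<mu>up = (\<lambda>q. matrix_inv (g i q) *v \<mu> q);
          P = schouten A g i p
      in (pderiv_chart (A i) a \<sigma> p - \<mu> p $ a,
          cov_deriv A g i a \<mu>up p + \<rho> p *\<^sub>R axis a 1 + \<sigma> p *\<^sub>R (matrix_inv (g i p) *v (P $ a)),
          pderiv_chart (A i) a \<rho> p - P $ a \<bullet> \<mu>up p))"

definition parallel_standard_tractor_on ::
  "('i, 'a, 'n::finite) atlas \<Rightarrow> ('i, 'a, 'n) metric_comps set \<Rightarrow> 'a set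
     \<Rightarrow> (('i, 'a, 'n) metric_comps \<times> 'i, 'a, 'n) triple_field \<Rightarrow> bool" where
  "parallel_standard_tractor_on A c U T \<longleftrightarrow>
     standard_tractor_on A c U T \<and>
     (\<forall>g\<in>c. \<forall>i a. \<forall>p\<in>U \<inter> chart_dom (A i). normal_tractor_deriv A g i a (T (g, i)) p = 0)"

definition admits_directed_almost_einstein ::
  "('i, 'a, 'n::finite) atlas \<Rightarrow> ('i, 'a, 'n) metric_comps set \<Rightarrow> bool" where
  "admits_directed_almost_einstein A c \<longleftrightarrow>
     (\<exists>T. directed_structure (scale_dom A c) (parallel_standard_tractor_on A c) T)"

definition admits_almost_einstein ::
  "('i, 'a::topological_space, 'n::finite) atlas \<Rightarrow> ('i, 'a, 'n) metric_comps set \<Rightarrow> bool" where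
  "admits_almost_einstein A c \<longleftrightarrow>
     (\<exists>\<U> I. almost_structure (scale_dom A c) (parallel_standard_tractor_on A c) \<U> I)"


section \<open>Tractors of an Einstein manifold\<close>

definition einstein_metric ::
  "('i, 'a, 'n::finite) atlas \<Rightarrow> ('i, 'a, 'n) metric_comps \<Rightarrow> bool" where
  "einstein_metric A g \<longleftrightarrow>
     (if CARD('n) = 1 then True
      else if CARD('n) = 2 then
        \<exists>s::real. \<forall>i. \<forall>p\<in>chart_dom (A i). scalar_curvature A g i p = s
      else \<exists>l::real. \<forall>i. \<forall>p\<in>chart_dom (A i). ricci A g i p = l *\<^sub>R g i p)"

text \<open>The number \<open>\<mu>\<close> is determined by \<open>g\<close> in dimension \<open>\<ge> 2\<close> and arbitrary in dimension 1.\<close>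

definition einstein_manifold ::
  "('i, 'a::{second_countable_topology, t2_space}, 'n::finite) atlas
     \<Rightarrow> ('i, 'a, 'n) metric_comps \<Rightarrow> real \<Rightarrow> bool" where
  "einstein_manifold A g \<mu> \<longleftrightarrow>
     smooth_manifold A \<and> riemannian_metric A g \<and> einstein_metric A g \<and>
     (CARD('n) \<ge> 2 \<longrightarrow> (\<forall>i. \<forall>p\<in>chart_dom (A i).
        \<mu> = scalar_curvature A g i p / (2 * real CARD('n) * (real CARD('n) - 1))))"

text \<open>The triples \<open>(s, t\<^sup>a, r)\<close> have a vector in the middle slot.\<close>

definition einstein_triple_on ::
  "('i, 'a, 'n::finite) atlas \<Rightarrow> 'a set \<Rightarrow> ('i, 'a, 'n) triple_field \<Rightarrow> bool" where
  "einstein_triple_on A U S \<longleftrightarrow>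
     (\<forall>i. smooth_in_chart (A i) U (S i)) \<and>
     (\<forall>i j. \<forall>p\<in>U \<inter> chart_dom (A i) \<inter> chart_dom (A j).
        S j p = (case S i p of (s, t, r) \<Rightarrow> (s, chart_jacobian (A i) (A j) p *v t, r)))"

definition einstein_tractor_deriv ::
  "('i, 'a, 'n::finite) atlas \<Rightarrow> ('i, 'a, 'n) metric_comps \<Rightarrow> real \<Rightarrow> 'i \<Rightarrow> 'n
     \<Rightarrow> ('a \<Rightarrow> 'n triple) \<Rightarrow> 'a \<Rightarrow> 'n triple" where
  "einstein_tractor_deriv A g \<mu> i a X p =
     (let s = (\<lambda>q. fst (X q));
          t = (\<lambda>q. fst (snd (X q)));
          r = (\<lambda>q. snd (snd (X q)));
          tlow = g i p *v t p
      in (pderiv_chart (A i) a s p - tlow $ a,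
          cov_deriv A g i a t p + (r p + \<mu> * s p) *\<^sub>R axis a 1,
          pderiv_chart (A i) a r p - \<mu> * tlow $ a))"

definition parallel_einstein_on ::
  "('i, 'a, 'n::finite) atlas \<Rightarrow> ('i, 'a, 'n) metric_comps \<Rightarrow> real \<Rightarrow> 'a set
     \<Rightarrow> ('i, 'a, 'n) triple_field \<Rightarrow> bool" where
  "parallel_einstein_on A g \<mu> U S \<longleftrightarrow>
     einstein_triple_on A U S \<and>
     (\<forall>i a. \<forall>p\<in>U \<inter> chart_dom (A i). einstein_tractor_deriv A g \<mu> i a (S i) p = 0)"

definition einstein_tractor :: "real \<Rightarrow> ('i, 'a, 'n::finite) triple_field" where
  "einstein_tractor \<mu> = (\<lambda>i p. (1, 0, - \<mu>))"

definition einstein_tractor_metric :: "real^'n^'n \<Rightarrow> 'n triple \<Rightarrow> real" where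
  "einstein_tractor_metric G = (\<lambda>(s, t, r). 2 * s * r + t \<bullet> (G *v t))"

definition two_lin_indep_directed ::
  "('i, 'a, 'n::finite) atlas \<Rightarrow> ('i, 'a, 'n) metric_comps \<Rightarrow> real \<Rightarrow> bool" where
  "two_lin_indep_directed A g \<mu> \<longleftrightarrow>
     (let D = (\<lambda>i. chart_dom (A i)); par = parallel_einstein_on A g \<mu> in
      \<exists>S T. directed_structure D par S \<and> directed_structure D par T \<and> lin_indep_on D UNIV S T)"

definition two_lin_indep_almost ::
  "('i, 'a::topological_space, 'n::finite) atlas \<Rightarrow> ('i, 'a, 'n) metric_comps \<Rightarrow> real \<Rightarrow> bool" where
  "two_lin_indep_almost A g \<mu> \<longleftrightarrow>
     (let D = (\<lambda>i. chart_dom (A i)); par = parallel_einstein_on A g \<mu> in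
      \<exists>\<U> I \<V> J. almost_structure D par \<U> I \<and> almost_structure D par \<V> J \<and>
        almost_lin_indep D \<U> I \<V> J)"


section \<open>Products\<close>

definition product_chart ::
  "('a, 'm::finite) chart \<Rightarrow> ('b, 'n::finite) chart \<Rightarrow> ('a \<times> 'b, 'm + 'n) chart" where
  "product_chart c d =
     (chart_dom c \<times> chart_dom d,
      \<lambda>(p, q). \<chi> k. (case k of Inl a \<Rightarrow> coords c p $ a | Inr b \<Rightarrow> coords d q $ b))"

definition product_atlas ::
  "('i, 'a, 'm::finite) atlas \<Rightarrow> ('j, 'b, 'n::finite) atlas
     \<Rightarrow> ('i \<times> 'j, 'a \<times> 'b, 'm + 'n) atlas" where
  "product_atlas A B = (\<lambda>(i, j). product_chart (A i) (B j))"

definition product_metric ::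
  "('i, 'a, 'm::finite) metric_comps \<Rightarrow> ('j, 'b, 'n::finite) metric_comps
     \<Rightarrow> ('i \<times> 'j, 'a \<times> 'b, 'm + 'n) metric_comps" where
  "product_metric g h = (\<lambda>(i, j) (p, q). \<chi> k l.
     (case (k, l) of
        (Inl a, Inl b) \<Rightarrow> g i p $ a $ b
      | (Inr a, Inr b) \<Rightarrow> h j q $ a $ b
      | _ \<Rightarrow> 0))"

definition special_einstein_product ::
  "('i, 'a::{second_countable_topology, t2_space}, 'm::finite) atlas
     \<Rightarrow> ('i, 'a, 'm) metric_comps \<Rightarrow> real
     \<Rightarrow> ('j, 'b::{second_countable_topology, t2_space}, 'n::finite) atlas
     \<Rightarrow> ('j, 'b, 'n) metric_comps \<Rightarrow> real \<Rightarrow> bool" where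
  "special_einstein_product A g \<mu> B h \<nu> \<longleftrightarrow>
     CARD('m) + CARD('n) \<ge> 3 \<and>
     einstein_manifold A g \<mu> \<and> einstein_manifold B h \<nu> \<and>
     (\<forall>i j. \<forall>p\<in>chart_dom (A i). \<forall>q\<in>chart_dom (B j).
        einstein_tractor_metric (g i p) (einstein_tractor \<mu> i p)
          = - einstein_tractor_metric (h j q) (einstein_tractor \<nu> j q) \<and>
        einstein_tractor_metric (h j q) (einstein_tractor \<nu> j q) \<noteq> 0)"

end

theory Submission
  imports Defs
begin

text \<open>
  Let \<open>\<mu>1\<close> and \<open>\<mu>2 = - \<mu>1\<close> be the Einstein constants of the factors. The Schouten tensor of a special
  Einstein product is \<open>P = \<mu>1 g1 + \<mu>2 g2\<close> (\<open>product_schouten\<close>). In the scale of the product metric a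
  parallel standard tractor \<open>(\<sigma>, \<mu>\<^sub>a, \<rho>)\<close> therefore satisfies \<open>d\<sigma> = \<mu>\<^sub>a\<close>, while \<open>d\<rho>\<close> is \<open>\<mu>1 d\<sigma>\<close> along the first
  factor and \<open>\<mu>2 d\<sigma>\<close> along the second. Hence \<open>\<rho> - \<mu>1 \<sigma>\<close> is constant along the first factor and
  \<open>\<rho> - \<mu>2 \<sigma>\<close> along the second, which means that locally \<open>\<sigma> = f1 + f2\<close> and \<open>\<rho> = \<mu>1 f1 + \<mu>2 f2\<close> with functions
  \<open>f1\<close>, \<open>f2\<close> on the factors. The remaining equations say that the triples \<open>(f, grad f, \<mu> f)\<close> are parallel
  Einstein tractors of the factors. These are precisely the parallel tractors orthogonal to the
  Einstein tractor \<open>(1, 0, - \<mu>)\<close>. So parallel tractors of the product are sums of parallel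
  tractors of the factors orthogonal to the Einstein tractors (\<open>combine_parallel\<close>, \<open>part_system\<close>).

  On a factor, \<open>|I|\<^sup>2 = - 2 \<mu>\<close> is not zero, and every parallel tractor is the sum of a multiple of the
  Einstein tractor \<open>I\<close> and of a parallel tractor orthogonal to it. A non-zero orthogonal one
  therefore exists if and only if there are two linearly independent parallel tractors
  (\<open>two_lin_indep_almost_iff\<close>, \<open>two_lin_indep_directed_iff\<close>). This gives the theorem.

  Three points need work. First, a standard tractor consists of components in all scales of
  the conformal class. That the components in the scale of the product metric suffice is the
  conformal invariance of the normal tractor connection (\<open>parallel_rescaled\<close>), which is derived
  from the transformation of the Christoffel symbols and of the Schouten tensor. Second, on a
  surface only the scalar curvature is assumed to be constant; the symmetries of the curvature
  tensor then give the Einstein equation (\<open>ricci_surface\<close>). Third, an almost Einstein structure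
  consists of tractors on an open cover that agree up to sign. Zero sets, of the tractors and of
  their parts, do not depend on the sign, and by unique continuation (\<open>open_zero_set\<close>) each of them is
  empty or the whole manifold (\<open>zero_dichotomy\<close>). A directed structure is an almost Einstein
  structure for the trivial cover; since the constructions respect covers, both statements are
  proved together.
\<close>

section \<open>Calculus of smooth maps\<close>

text \<open>At a point of an open set the derivative depends on the values on that set only. This is what
  makes the recursion over \<open>frechet_derivative\<close> insensitive to the values outside.\<close>

lemma Ck_on_cong:
  assumes "open S" "\<And>x. x \<in> S \<Longrightarrow> f x = g x" "Ck_on k S f"
  shows "Ck_on k S g"
  using assms(2,3)
proof (induction k arbitrary: f g)
  case 0
  then show ?case by (simp cong: continuous_on_cong)
next
  case (Suc k)
  have der: "g differentiable (at x)"
      "frechet_derivative g (at x) = frechet_derivative f (at x)" if "x \<in> S" for x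
  proof -
    have "(f has_derivative frechet_derivative f (at x)) (at x)"
      using Suc.prems(2) that by (simp add: frechet_derivative_works)
    then have "(g has_derivative frechet_derivative f (at x)) (at x)"
      by (rule has_derivative_transform_within_open[OF _ \<open>open S\<close> that]) (simp add: Suc.prems(1))
    then show "g differentiable (at x)"
      "frechet_derivative g (at x) = frechet_derivative f (at x)"
      by (auto simp: differentiable_def dest: frechet_derivative_at)
  qed
  have "Ck_on k S (\<lambda>x. frechet_derivative g (at x) v)" for v
    by (rule Suc.IH[of "\<lambda>x. frechet_derivative f (at x) v"]) (use der Suc.prems(2) in auto)
  with der show ?case by simp
qed

text \<open>Derivatives at a point are unique, and so the recursion may be carried out with derivatives that
  are given by explicit formulas.\<close>

lemma Ck_on_SucI:
  assumes "open S" "\<And>x. x \<in> S \<Longrightarrow> (f has_derivative f' x) (at x)"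
    "\<And>v. Ck_on k S (\<lambda>x. f' x v)"
  shows "Ck_on (Suc k) S f"
proof -
  have "frechet_derivative f (at x) = f' x" if "x \<in> S" for x
    using frechet_derivative_at[OF assms(2)[OF that]] by simp
  then have "Ck_on k S (\<lambda>x. frechet_derivative f (at x) v)" for v
    by (intro Ck_on_cong[OF assms(1) _ assms(3)[of v]]) simp
  then show ?thesis
    using assms(2) by (auto simp: differentiable_def)
qed

lemma Ck_on_SucD:
  "Ck_on (Suc k) S f \<Longrightarrow> x \<in> S \<Longrightarrow> (f has_derivative frechet_derivative f (at x)) (at x)"
  "Ck_on (Suc k) S f \<Longrightarrow> Ck_on k S (\<lambda>x. frechet_derivative f (at x) v)"
  by (auto simp: frechet_derivative_works)

lemma Ck_on_Suc_imp: "Ck_on (Suc k) S f \<Longrightarrow> Ck_on k S f"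
proof (induction k arbitrary: f)
  case 0
  then show ?case
    by (simp add: differentiable_imp_continuous_on differentiable_on_def differentiable_at_withinI)
next
  case (Suc k)
  show ?case
    unfolding Ck_on.simps(2)
  proof (intro conjI allI)
    show "\<forall>x\<in>S. f differentiable (at x)"
      using Suc.prems by simp
    show "Ck_on k S (\<lambda>x. frechet_derivative f (at x) v)" for v
      by (rule Suc.IH[OF Ck_on_SucD(2)[OF Suc.prems]])
  qed
qed

lemma Ck_on_const: "Ck_on k S (\<lambda>x. c)"
proof (induction k arbitrary: c)
qed (auto simp: frechet_derivative_const)

lemma Ck_on_subset: "Ck_on k S f \<Longrightarrow> T \<subseteq> S \<Longrightarrow> Ck_on k T f"
  by (induction k arbitrary: f) (auto intro: continuous_on_subset)

lemma Ck_on_add: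
  assumes "open S" "Ck_on k S f" "Ck_on k S g"
  shows "Ck_on k S (\<lambda>x. f x + g x)"
  using assms(2,3)
proof (induction k arbitrary: f g)
  case 0
  then show ?case by (simp add: continuous_on_add)
next
  case (Suc k)
  show ?case
    by (rule Ck_on_SucI[OF \<open>open S\<close> has_derivative_add[OF Ck_on_SucD(1) Ck_on_SucD(1)]])
      (use Suc in \<open>auto intro!: Suc.IH simp del: Ck_on.simps intro: Ck_on_SucD\<close>)
qed

lemma Ck_on_bilinear:
  assumes "bounded_bilinear B" "open S" "Ck_on k S f" "Ck_on k S g"
  shows "Ck_on k S (\<lambda>x. B (f x) (g x))"
  using assms(3,4)
proof (induction k arbitrary: f g)
  case 0
  then show ?case
    using bounded_bilinear.continuous_on[OF assms(1)] by simp
next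
  case (Suc k)
  show ?case
    by (rule Ck_on_SucI[OF \<open>open S\<close> bounded_bilinear.FDERIV[OF assms(1) Ck_on_SucD(1) Ck_on_SucD(1)]])
      (use Suc in \<open>auto intro!: Suc.IH Ck_on_add assms(2) simp del: Ck_on.simps
         intro: Ck_on_SucD Ck_on_Suc_imp\<close>)
qed

lemma Ck_on_linear:
  assumes "bounded_linear L" "open S" "Ck_on k S f"
  shows "Ck_on k S (\<lambda>x. L (f x))"
  using assms(3)
proof (induction k arbitrary: f)
  case 0
  then show ?case
    using bounded_linear.continuous_on[OF assms(1)] by simp
next
  case (Suc k)
  show ?case
    by (rule Ck_on_SucI[OF \<open>open S\<close> bounded_linear.has_derivative[OF assms(1) Ck_on_SucD(1)]])
      (use Suc in \<open>auto intro!: Suc.IH simp del: Ck_on.simps intro: Ck_on_SucD\<close>)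
qed

lemma Ck_on_compose_affine:
  assumes "bounded_linear L" "open S" "\<And>x. x \<in> S \<Longrightarrow> L x + c \<in> T" "Ck_on k T f"
  shows "Ck_on k S (\<lambda>x. f (L x + c))"
  using assms(4)
proof (induction k arbitrary: f)
  case 0
  have "continuous_on S (\<lambda>x. L x + c)"
    by (intro continuous_on_add continuous_on_const
        linear_continuous_on[OF assms(1)])
  then show ?case
    using 0 assms(3) by (auto intro: continuous_on_compose2)
next
  case (Suc k)
  have "((\<lambda>x. f (L x + c)) has_derivative (\<lambda>v. frechet_derivative f (at (L x + c)) (L v))) (at x)"
    if "x \<in> S" for x
  proof -
    have "((\<lambda>x. L x + c) has_derivative L) (at x)"
      using has_derivative_add[OF bounded_linear_imp_has_derivative[OF assms(1)]
          has_derivative_const[of c]] by simp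
    moreover have "(f has_derivative frechet_derivative f (at (L x + c))) (at (L x + c))"
      using Ck_on_SucD(1)[OF Suc.prems] assms(3) that by blast
    ultimately show ?thesis
      using has_derivative_compose by blast
  qed
  then show ?case
    by (rule Ck_on_SucI[OF \<open>open S\<close>]) (use Suc in \<open>auto intro: Ck_on_SucD\<close>)
qed

text \<open>For \<open>1/f\<close> and for \<open>exp f\<close> the derivative is a product of \<open>f'\<close> with the function itself, so
  induction on the order of differentiability applies.\<close>

lemma Ck_on_inverse:
  fixes f :: "'a::real_normed_vector \<Rightarrow> real"
  assumes "open S" "\<And>x. x \<in> S \<Longrightarrow> f x \<noteq> 0" "Ck_on k S f"
  shows "Ck_on k S (\<lambda>x. inverse (f x))"
  using assms(3)
proof (induction k)
  case 0
  then show ?case using assms(2) by (auto intro: continuous_on_inverse)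
next
  case (Suc k)
  have inv: "Ck_on k S (\<lambda>x. inverse (f x))"
    by (rule Suc.IH[OF Ck_on_Suc_imp[OF Suc.prems]])
  have der: "((\<lambda>x. inverse (f x)) has_derivative
      (\<lambda>v. - (inverse (f x) * frechet_derivative f (at x) v * inverse (f x)))) (at x)" if "x \<in> S" for x
    by (rule Deriv.has_derivative_inverse[OF assms(2)[OF that] Ck_on_SucD(1)[OF Suc.prems that]])
  show ?case
    by (rule Ck_on_SucI[OF \<open>open S\<close> der], assumption)
      (intro Ck_on_linear[OF bounded_linear_minus[OF bounded_linear_ident]]
        Ck_on_bilinear[OF bounded_bilinear_mult] inv Ck_on_SucD(2)[OF Suc.prems] assms(1))
qed

lemma Ck_on_exp:
  fixes f :: "'a::real_normed_vector \<Rightarrow> real"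
  assumes "open S" "Ck_on k S f"
  shows "Ck_on k S (\<lambda>x. exp (f x))"
  using assms(2)
proof (induction k)
  case 0
  then show ?case by (auto intro: continuous_on_exp)
next
  case (Suc k)
  have der: "((\<lambda>x. exp (f x)) has_derivative (\<lambda>v. frechet_derivative f (at x) v * exp (f x))) (at x)"
    if "x \<in> S" for x
    using has_derivative_exp[OF Ck_on_SucD(1)[OF Suc.prems that]] by (simp add: mult.commute)
  show ?case
    by (rule Ck_on_SucI[OF \<open>open S\<close> der], assumption)
      (intro Ck_on_bilinear[OF bounded_bilinear_mult] Suc.IH[OF Ck_on_Suc_imp[OF Suc.prems]]
        Ck_on_SucD(2)[OF Suc.prems] assms(1))
qed

lemma smooth_on_cong: "open S \<Longrightarrow> (\<And>x. x \<in> S \<Longrightarrow> f x = g x) \<Longrightarrow> smooth_on S f \<Longrightarrow> smooth_on S g"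
  using Ck_on_cong unfolding smooth_on_def by blast

lemma smooth_on_differentiable: "smooth_on S f \<Longrightarrow> x \<in> S \<Longrightarrow> f differentiable (at x)"
  unfolding smooth_on_def by (meson Ck_on.simps(2))

lemma smooth_on_frechet_derivative:
  "smooth_on S f \<Longrightarrow> smooth_on S (\<lambda>x. frechet_derivative f (at x) v)"
  unfolding smooth_on_def by (metis Ck_on_SucD(2))

lemma smooth_on_continuous: "smooth_on S f \<Longrightarrow> continuous_on S f"
  unfolding smooth_on_def by (metis Ck_on.simps(1))

text \<open>The mean value theorem is applied along \<open>u\<close> to the difference in the direction \<open>v\<close>, and then
  along \<open>v\<close> to the derivative in the direction \<open>u\<close>.\<close>

lemma second_difference_mean_value:
  fixes f :: "'a::real_normed_vector \<Rightarrow> real"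
  assumes box: "\<And>s t. 0 \<le> s \<Longrightarrow> s \<le> h \<Longrightarrow> 0 \<le> t \<Longrightarrow> t \<le> h \<Longrightarrow> x + s *\<^sub>R u + t *\<^sub>R v \<in> S"
    and f: "\<And>y. y \<in> S \<Longrightarrow> f differentiable (at y)"
    and fu: "\<And>y. y \<in> S \<Longrightarrow> (\<lambda>z. frechet_derivative f (at z) u) differentiable (at y)"
    and "0 < h"
  obtains s t where "0 < s" "s < h" "0 < t" "t < h"
    "f (x + h *\<^sub>R u + h *\<^sub>R v) - f (x + h *\<^sub>R u) - f (x + h *\<^sub>R v) + f x =
      h * h * frechet_derivative (\<lambda>z. frechet_derivative f (at z) u) (at (x + s *\<^sub>R u + t *\<^sub>R v)) v"
proof -
  let ?f' = "\<lambda>y. frechet_derivative f (at y)"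
  let ?\<phi> = "\<lambda>s. f (x + s *\<^sub>R u + h *\<^sub>R v) - f (x + s *\<^sub>R u)"
  have line: "((\<lambda>s. f (y + s *\<^sub>R u)) has_real_derivative ?f' (y + s *\<^sub>R u) u) (at s)"
    if "y + s *\<^sub>R u \<in> S" for y s
  proof -
    have "((\<lambda>s. y + s *\<^sub>R u) has_derivative (\<lambda>r. r *\<^sub>R u)) (at s)"
      by (auto intro!: derivative_eq_intros)
    moreover have "(f has_derivative ?f' (y + s *\<^sub>R u)) (at (y + s *\<^sub>R u))"
      using f[OF that] frechet_derivative_works by blast
    ultimately have "((\<lambda>s. f (y + s *\<^sub>R u)) has_derivative (\<lambda>r. ?f' (y + s *\<^sub>R u) (r *\<^sub>R u))) (at s)"
      using has_derivative_compose by blast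
    then show ?thesis
      using linear_frechet_derivative[OF f[OF that]]
      by (simp add: has_field_derivative_def linear_cmul mult.commute[of _ "?f' _ u"])
  qed
  have d1: "(?\<phi> has_real_derivative ?f' (x + s *\<^sub>R u + h *\<^sub>R v) u - ?f' (x + s *\<^sub>R u) u) (at s)"
    if "0 \<le> s" "s \<le> h" for s
  proof -
    have "x + h *\<^sub>R v + s *\<^sub>R u \<in> S" "x + s *\<^sub>R u \<in> S"
      using box[of s h] box[of s 0] that \<open>0 < h\<close> by (auto simp: algebra_simps)
    from DERIV_diff[OF line[OF this(1)] line[OF this(2)]] show ?thesis
      by (simp add: algebra_simps)
  qed
  have "\<exists>s>0. s < h \<and>
    ?\<phi> h - ?\<phi> 0 = (h - 0) * (?f' (x + s *\<^sub>R u + h *\<^sub>R v) u - ?f' (x + s *\<^sub>R u) u)"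
    by (rule MVT2[OF \<open>0 < h\<close> d1])
  then obtain s where s: "0 < s" "s < h"
    "?\<phi> h - ?\<phi> 0 = (h - 0) * (?f' (x + s *\<^sub>R u + h *\<^sub>R v) u - ?f' (x + s *\<^sub>R u) u)"
    by blast
  let ?\<psi> = "\<lambda>t. ?f' (x + s *\<^sub>R u + t *\<^sub>R v) u"
  let ?g = "\<lambda>y. frechet_derivative (\<lambda>z. ?f' z u) (at y) v"
  have d2: "(?\<psi> has_real_derivative ?g (x + s *\<^sub>R u + t *\<^sub>R v)) (at t)" if "0 \<le> t" "t \<le> h" for t
  proof -
    let ?y = "x + s *\<^sub>R u + t *\<^sub>R v"
    have y: "?y \<in> S"
      using box that s by auto
    have "((\<lambda>t. x + s *\<^sub>R u + t *\<^sub>R v) has_derivative (\<lambda>r. r *\<^sub>R v)) (at t)"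
      by (auto intro!: derivative_eq_intros)
    moreover have "((\<lambda>z. ?f' z u) has_derivative frechet_derivative (\<lambda>z. ?f' z u) (at ?y)) (at ?y)"
      using fu[OF y] frechet_derivative_works by blast
    ultimately have "(?\<psi> has_derivative (\<lambda>r. frechet_derivative (\<lambda>z. ?f' z u) (at ?y) (r *\<^sub>R v))) (at t)"
      using has_derivative_compose by blast
    then show ?thesis
      using linear_frechet_derivative[OF fu[OF y]]
      by (simp add: has_field_derivative_def linear_cmul mult.commute[of _ "?g _"])
  qed
  have "\<exists>t>0. t < h \<and> ?\<psi> h - ?\<psi> 0 = (h - 0) * ?g (x + s *\<^sub>R u + t *\<^sub>R v)"
    by (rule MVT2[OF \<open>0 < h\<close> d2])
  then obtain t where t: "0 < t" "t < h" "?\<psi> h - ?\<psi> 0 = (h - 0) * ?g (x + s *\<^sub>R u + t *\<^sub>R v)"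
    by blast
  have "f (x + h *\<^sub>R u + h *\<^sub>R v) - f (x + h *\<^sub>R u) - f (x + h *\<^sub>R v) + f x = ?\<phi> h - ?\<phi> 0"
    by simp
  also have "\<dots> = h * h * ?g (x + s *\<^sub>R u + t *\<^sub>R v)"
    using s(3) t(3) by simp
  finally show ?thesis
    using that s(1,2) t(1,2) by blast
qed

text \<open>The symmetry of second derivatives. The second difference over a small parallelogram is symmetric
  in \<open>u\<close> and \<open>v\<close>; by the preceding lemma the two mixed derivatives agree at two points arbitrarily
  close to \<open>x\<close>, and both are continuous.\<close>

lemma frechet_derivative_commute:
  fixes f :: "'a::real_normed_vector \<Rightarrow> real"
  assumes "open S" "smooth_on S f" "x \<in> S"
  shows "frechet_derivative (\<lambda>y. frechet_derivative f (at y) u) (at x) v =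
    frechet_derivative (\<lambda>y. frechet_derivative f (at y) v) (at x) u" (is "?A u v x = ?A v u x")
proof -
  have sm: "smooth_on S (?A u v)" for u v
    by (intro smooth_on_frechet_derivative assms)
  obtain e where e: "e > 0" "ball x e \<subseteq> S"
    using assms open_contains_ball by blast
  \<comment> \<open>With this side length the parallelogram lies in the ball of radius \<open>e / (n + 1)\<close>.\<close>
  define h where "h n = e / ((norm u + norm v + 1) * (real n + 2))" for n :: nat
  have h: "0 < h n" for n
    using e(1) by (simp add: h_def add_nonneg_pos)
  have small: "norm (s *\<^sub>R u + t *\<^sub>R v) < e / (real n + 1)"
    if "0 \<le> s" "s \<le> h n" "0 \<le> t" "t \<le> h n" for s t n
  proof -
    have "norm (s *\<^sub>R u + t *\<^sub>R v) \<le> s * norm u + t * norm v"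
      using that norm_triangle_ineq[of "s *\<^sub>R u" "t *\<^sub>R v"] by simp
    also have "\<dots> \<le> h n * norm u + h n * norm v"
      using that by (intro add_mono mult_right_mono) auto
    also have "\<dots> \<le> h n * (norm u + norm v + 1)"
      using h[of n] by (simp add: algebra_simps)
    also have "\<dots> = e / (real n + 2)"
    proof -
      have "norm u + norm v + 1 > 0" by (simp add: add_nonneg_pos)
      then show ?thesis by (simp add: h_def)
    qed
    also have "\<dots> < e / (real n + 1)"
      using e(1) by (simp add: frac_less2)
    finally show ?thesis .
  qed
  have box: "x + s *\<^sub>R u + t *\<^sub>R v \<in> S" if "0 \<le> s" "s \<le> h n" "0 \<le> t" "t \<le> h n" for s t n
  proof -
    have "norm (s *\<^sub>R u + t *\<^sub>R v) < e"
    proof (rule less_le_trans[OF small[OF that]])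
      show "e / (real n + 1) \<le> e"
        using e(1) by (simp add: field_simps)
    qed
    then show ?thesis
      using e(2) by (auto simp: dist_norm subset_iff norm_minus_commute add.assoc)
  qed
  have diff: "f differentiable (at y)" "(\<lambda>z. frechet_derivative f (at z) w) differentiable (at y)"
    if "y \<in> S" for y w
    using that smooth_on_differentiable[OF assms(2)]
      smooth_on_differentiable[OF smooth_on_frechet_derivative[OF assms(2)]] by auto
  have "\<exists>y z. ?A u v y = ?A v u z \<and> norm (y - x) < e / (real n + 1) \<and> norm (z - x) < e / (real n + 1)"
    for n
  proof -
    obtain s t where st: "0 < s" "s < h n" "0 < t" "t < h n"
      "f (x + h n *\<^sub>R u + h n *\<^sub>R v) - f (x + h n *\<^sub>R u) - f (x + h n *\<^sub>R v) + f x =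
        h n * h n * ?A u v (x + s *\<^sub>R u + t *\<^sub>R v)"
      by (rule second_difference_mean_value[where h = "h n" and x = x and u = u and v = v
            and S = S and f = f]) (assumption | rule box[where n = n] diff h that)+
    have box': "x + s *\<^sub>R v + t *\<^sub>R u \<in> S" if "0 \<le> s" "s \<le> h n" "0 \<le> t" "t \<le> h n" for s t
      using box[of t n s] that by (simp add: algebra_simps)
    obtain s' t' where st': "0 < s'" "s' < h n" "0 < t'" "t' < h n"
      "f (x + h n *\<^sub>R v + h n *\<^sub>R u) - f (x + h n *\<^sub>R v) - f (x + h n *\<^sub>R u) + f x =
        h n * h n * ?A v u (x + s' *\<^sub>R v + t' *\<^sub>R u)"
      by (rule second_difference_mean_value[where h = "h n" and x = x and u = v and v = u
            and S = S and f = f]) (assumption | rule box' diff h that)+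
    have "h n * h n * ?A u v (x + s *\<^sub>R u + t *\<^sub>R v) = h n * h n * ?A v u (x + s' *\<^sub>R v + t' *\<^sub>R u)"
      using st(5) st'(5) by (simp add: algebra_simps)
    then have "?A u v (x + s *\<^sub>R u + t *\<^sub>R v) = ?A v u (x + s' *\<^sub>R v + t' *\<^sub>R u)"
      using h[of n] by simp
    moreover have "norm ((x + s *\<^sub>R u + t *\<^sub>R v) - x) < e / (real n + 1)"
      using small[of s n t] st by (simp add: add.assoc)
    moreover have "norm ((x + s' *\<^sub>R v + t' *\<^sub>R u) - x) < e / (real n + 1)"
      using small[of t' n s'] st' by (simp add: algebra_simps)
    ultimately show ?thesis by blast
  qed
  then obtain y z where yz: "\<And>n. ?A u v (y n) = ?A v u (z n)"
    "\<And>n. norm (y n - x) < e / (real n + 1)" "\<And>n. norm (z n - x) < e / (real n + 1)"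
    by metis
  have lim0: "(\<lambda>n. e / (real n + 1)) \<longlonglongrightarrow> 0"
  proof -
    have "(\<lambda>n. e * inverse (real (Suc n))) \<longlonglongrightarrow> e * 0"
      by (intro tendsto_mult tendsto_const LIMSEQ_inverse_real_of_nat)
    then show ?thesis by (simp add: divide_inverse add.commute)
  qed
  have lim: "w \<longlonglongrightarrow> x" if "\<And>n. norm (w n - x) < e / (real n + 1)" for w
  proof (rule LIM_zero_cancel, rule Lim_null_comparison[OF _ lim0])
    show "\<forall>\<^sub>F n in sequentially. norm (w n - x) \<le> e / (real n + 1)"
      using that by (auto intro!: always_eventually less_imp_le)
  qed
  have cont: "isCont (?A u v) x" for u v
    using smooth_on_continuous[OF sm] assms by (simp add: continuous_on_eq_continuous_at)
  have "(\<lambda>n. ?A u v (y n)) \<longlonglongrightarrow> ?A u v x" "(\<lambda>n. ?A v u (z n)) \<longlonglongrightarrow> ?A v u x"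
    by (intro isCont_tendsto_compose[OF cont] lim yz(2,3))+
  then show ?thesis
    unfolding yz(1) by (rule LIMSEQ_unique)
qed

section \<open>Calculus in a coordinate chart\<close>

lemma is_chartD:
  assumes "is_chart c"
  shows "open (chart_dom c)" "p \<in> chart_dom c \<Longrightarrow> chart_inv c (coords c p) = p"
    "open U \<Longrightarrow> open (coords c ` (U \<inter> chart_dom c))"
    "continuous_on (chart_dom c) (coords c)"
    "continuous_on (coords c ` chart_dom c) (chart_inv c)"
proof -
  have hom: "homeomorphism (chart_dom c) (coords c ` chart_dom c) (coords c) (chart_inv c)"
    and dom: "open (chart_dom c)" and img: "open (coords c ` chart_dom c)"
    using assms by (auto simp: is_chart_def)
  show "open (chart_dom c)" by (rule dom)
  show "p \<in> chart_dom c \<Longrightarrow> chart_inv c (coords c p) = p"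
    using hom by (simp add: homeomorphism_def)
  show "open (coords c ` (U \<inter> chart_dom c))" if "open U"
  proof -
    have "openin (top_of_set (chart_dom c)) (U \<inter> chart_dom c)"
      using that by (auto simp: openin_open)
    then have "openin (top_of_set (coords c ` chart_dom c)) (coords c ` (U \<inter> chart_dom c))"
      by (rule homeomorphism_imp_open_map[OF hom])
    then show ?thesis
      using img openin_open_trans by blast
  qed
  show "continuous_on (chart_dom c) (coords c)"
    "continuous_on (coords c ` chart_dom c) (chart_inv c)"
    using hom by (auto simp: homeomorphism_def)
qed

lemma pderiv_chart_eqI:
  assumes "((\<lambda>x. f (chart_inv c x)) has_derivative f') (at (coords c p))"
  shows "pderiv_chart c a f p = f' (axis a 1)"
  using frechet_derivative_at[OF assms] by (simp add: pderiv_chart_def)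

lemma matrix_inv_inverse:
  fixes A :: "real^'n^'n"
  assumes "invertible A"
  shows "A ** matrix_inv A = mat 1" "matrix_inv A ** A = mat 1"
  using someI_ex[OF assms[unfolded invertible_def]] by (auto simp: matrix_inv_def)

lemma matrix_inv_unique:
  fixes A :: "real^'n^'n"
  assumes "A ** B = mat 1"
  shows "matrix_inv A = B"
proof -
  have "invertible A"
    using assms invertible_right_inverse by blast
  then have "matrix_inv A ** (A ** B) = B"
    by (simp add: matrix_mul_assoc matrix_inv_inverse)
  with assms show ?thesis by simp
qed

text \<open>Cramer's rule exhibits the entries of the inverse as rational functions of the entries, which
  is how the inverse metric is seen to be smooth.\<close>

lemma matrix_inv_cramer:
  fixes A :: "real^'n^'n"
  assumes "invertible A"
  shows "matrix_inv A $ k $ d =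
    det (\<chi> i j. if j = k then if i = d then 1 else 0 else A $ i $ j) / det A"
proof -
  have det: "det A \<noteq> 0"
    using assms invertible_det_nz by blast
  have "A *v (matrix_inv A *v axis d 1) = axis d 1"
    by (simp add: matrix_vector_mul_assoc matrix_inv_inverse[OF assms])
  then have "matrix_inv A *v axis d 1 =
      (\<chi> k. det (\<chi> i j. if j = k then axis d 1 $ i else A $ i $ j) / det A)"
    by (simp only: cramer[OF det])
  then have "(matrix_inv A *v axis d 1) $ k = det (\<chi> i j. if j = k then axis d 1 $ i else A $ i $ j) / det A"
    by (simp only: vec_lambda_beta)
  then show ?thesis
    by (simp only: matrix_vector_mult_basis) (simp add: column_def axis_def cong: if_cong)
qed

text \<open>Tractors are smooth on the members of an open cover only. The rules of differentiation are
  therefore stated for an open set \<open>U\<close>, which need not lie in the chart domain.\<close>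

locale chart_region =
  fixes c :: "('a::topological_space, 'n::finite) chart" and U :: "'a set"
  assumes chart: "is_chart c" and open_U: "open U"
begin

abbreviation smooth :: "('a \<Rightarrow> 'b::real_normed_vector) \<Rightarrow> bool" where
  "smooth \<equiv> smooth_in_chart c U"

lemma open_image: "open (coords c ` (U \<inter> chart_dom c))"
  by (rule is_chartD(3)[OF chart open_U])

lemma image_chart_inv:
  assumes "x \<in> coords c ` (U \<inter> chart_dom c)"
  shows "chart_inv c x \<in> U" "chart_inv c x \<in> chart_dom c" "coords c (chart_inv c x) = x"
  using assms is_chartD(2)[OF chart] by auto

lemma smooth_cong:
  assumes "\<And>p. p \<in> U \<Longrightarrow> p \<in> chart_dom c \<Longrightarrow> f p = g p" "smooth f"
  shows "smooth g"
  using smooth_on_cong[OF open_image _ assms(2)[unfolded smooth_in_chart_def]] assms(1)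
    image_chart_inv
  by (simp add: smooth_in_chart_def)

lemma smooth_const: "smooth (\<lambda>p. k)"
  by (simp add: smooth_in_chart_def smooth_on_def Ck_on_const)

lemma smooth_add: "smooth f \<Longrightarrow> smooth g \<Longrightarrow> smooth (\<lambda>p. f p + g p)"
  unfolding smooth_in_chart_def smooth_on_def by (intro allI impI Ck_on_add[OF open_image]) auto

lemma smooth_linear: "bounded_linear L \<Longrightarrow> smooth f \<Longrightarrow> smooth (\<lambda>p. L (f p))"
  unfolding smooth_in_chart_def smooth_on_def by (intro allI impI Ck_on_linear[OF _ open_image, of L]) auto

lemma smooth_bilinear:
  "bounded_bilinear B \<Longrightarrow> smooth f \<Longrightarrow> smooth g \<Longrightarrow> smooth (\<lambda>p. B (f p) (g p))"
  unfolding smooth_in_chart_def smooth_on_def by (intro allI impI Ck_on_bilinear[OF _ open_image, of B]) auto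

lemma smooth_minus: "smooth f \<Longrightarrow> smooth (\<lambda>p. - f p)"
  by (rule smooth_linear[OF bounded_linear_minus[OF bounded_linear_ident]])

lemma smooth_diff: "smooth f \<Longrightarrow> smooth g \<Longrightarrow> smooth (\<lambda>p. f p - g p)"
  using smooth_add[OF _ smooth_minus, of f g] by simp

lemma smooth_mult: "smooth f \<Longrightarrow> smooth g \<Longrightarrow> smooth (\<lambda>p. f p * g p :: real)"
  by (rule smooth_bilinear[OF bounded_bilinear_mult])

lemma smooth_scaleR: "smooth f \<Longrightarrow> smooth g \<Longrightarrow> smooth (\<lambda>p. f p *\<^sub>R g p)"
  by (rule smooth_bilinear[OF bounded_bilinear_scaleR])

lemma smooth_sum: "(\<And>k. k \<in> K \<Longrightarrow> smooth (f k)) \<Longrightarrow> smooth (\<lambda>p. \<Sum>k\<in>K. f k p)"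
  by (induction K rule: infinite_finite_induct) (auto intro: smooth_const smooth_add)

lemma smooth_prod:
  fixes f :: "'k \<Rightarrow> 'a \<Rightarrow> real"
  shows "(\<And>k. k \<in> K \<Longrightarrow> smooth (f k)) \<Longrightarrow> smooth (\<lambda>p. \<Prod>k\<in>K. f k p)"
  by (induction K rule: infinite_finite_induct) (auto intro: smooth_const smooth_mult)

lemma smooth_exp: "smooth f \<Longrightarrow> smooth (\<lambda>p. exp (f p) :: real)"
  using Ck_on_exp[OF open_image] by (simp add: smooth_in_chart_def smooth_on_def)

lemma smooth_divide:
  fixes f g :: "'a \<Rightarrow> real"
  assumes "smooth f" "smooth g" "\<And>p. p \<in> U \<Longrightarrow> p \<in> chart_dom c \<Longrightarrow> g p \<noteq> 0"
  shows "smooth (\<lambda>p. f p / g p)"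
proof -
  have "smooth (\<lambda>p. inverse (g p))"
    using Ck_on_inverse[OF open_image, of "\<lambda>x. g (chart_inv c x)"] assms(2,3) image_chart_inv
    by (simp add: smooth_in_chart_def smooth_on_def)
  from smooth_mult[OF assms(1) this] show ?thesis
    by (simp add: divide_inverse)
qed

lemma smooth_nth: "smooth f \<Longrightarrow> smooth (\<lambda>p. f p $ k)"
  by (rule smooth_linear[OF bounded_linear_vec_nth])

lemma smooth_vec:
  fixes f :: "'a \<Rightarrow> 'k::finite \<Rightarrow> 'b::real_normed_vector"
  assumes "\<And>k. smooth (\<lambda>p. f p k)"
  shows "smooth (\<lambda>p. \<chi> k. f p k)"
proof -
  have lin: "bounded_linear (axis k :: 'b \<Rightarrow> 'b^'k)" for k
  proof (rule bounded_linear_intro[where K = 1])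
    fix x :: 'b
    have "norm (axis k x) \<le> (\<Sum>i\<in>UNIV. norm (axis k x $ i))"
      unfolding norm_vec_def by (rule L2_set_le_sum) simp
    also have "\<dots> = norm x"
      by (simp add: axis_def if_distrib[of norm] cong: if_cong)
    finally show "norm (axis k x) \<le> norm x * 1" by simp
  qed (auto simp: axis_def vec_eq_iff)
  have "smooth (\<lambda>p. \<Sum>k\<in>UNIV. axis k (f p k))"
    by (intro smooth_sum smooth_linear[OF lin] assms)
  moreover have "(\<Sum>k\<in>UNIV. axis k (f p k)) = (\<chi> k. f p k)" for p
    by (simp add: vec_eq_iff axis_def if_distrib[of "\<lambda>x. x $ _"])
  ultimately show ?thesis by simp
qed

lemma smooth_fst: "smooth f \<Longrightarrow> smooth (\<lambda>p. fst (f p))"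
  by (rule smooth_linear[OF bounded_linear_fst])

lemma smooth_snd: "smooth f \<Longrightarrow> smooth (\<lambda>p. snd (f p))"
  by (rule smooth_linear[OF bounded_linear_snd])

lemma smooth_Pair:
  assumes "smooth f" "smooth g"
  shows "smooth (\<lambda>p. (f p, g p))"
proof -
  have "smooth (\<lambda>p. (f p, 0) + (0, g p))"
    by (intro smooth_add smooth_linear[where L = "\<lambda>x. (x, 0)"]
        smooth_linear[where L = "\<lambda>x. (0, x)"] bounded_linear_Pair bounded_linear_ident
        bounded_linear_zero assms)
  then show ?thesis by simp
qed

lemma smooth_matrix_vector_mult:
  fixes G :: "'a \<Rightarrow> real^'k::finite^'l::finite"
  shows "smooth G \<Longrightarrow> smooth v \<Longrightarrow> smooth (\<lambda>p. G p *v v p)"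
  unfolding matrix_vector_mult_def
  by (intro smooth_vec smooth_sum smooth_mult smooth_nth)

lemma smooth_inner:
  fixes v w :: "'a \<Rightarrow> real^'k::finite"
  shows "smooth v \<Longrightarrow> smooth w \<Longrightarrow> smooth (\<lambda>p. v p \<bullet> w p)"
  by (rule smooth_bilinear[OF bounded_bilinear_inner])

lemma smooth_det:
  fixes G :: "'a \<Rightarrow> real^'k::finite^'k"
  assumes "smooth G"
  shows "smooth (\<lambda>p. det (G p))"
  unfolding det_def by (intro smooth_sum smooth_mult smooth_prod smooth_const smooth_nth assms)

lemma smooth_matrix_inv:
  fixes G :: "'a \<Rightarrow> real^'k::finite^'k"
  assumes "smooth G" and inv: "\<And>p. p \<in> U \<Longrightarrow> p \<in> chart_dom c \<Longrightarrow> invertible (G p)"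
  shows "smooth (\<lambda>p. matrix_inv (G p))"
proof -
  have nz: "det (G p) \<noteq> 0" if "p \<in> U" "p \<in> chart_dom c" for p
    using inv[OF that] invertible_det_nz by blast
  have "smooth (\<lambda>p. if j = k then if i = d then 1 else 0 else G p $ i $ j)" for i j k d
    by (cases "j = k"; cases "i = d") (simp_all add: smooth_const smooth_nth assms)
  then have "smooth (\<lambda>p. \<chi> k d.
      det (\<chi> i j. if j = k then if i = d then 1 else 0 else G p $ i $ j) / det (G p))"
    by (intro smooth_vec smooth_divide smooth_det assms nz)
  then show ?thesis
    by (rule smooth_cong[rotated]) (simp add: vec_eq_iff matrix_inv_cramer inv)
qed

lemma has_derivative_in_chart:
  assumes "smooth f" "p \<in> U" "p \<in> chart_dom c"
  shows "((\<lambda>x. f (chart_inv c x)) has_derivative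
    frechet_derivative (\<lambda>x. f (chart_inv c x)) (at (coords c p))) (at (coords c p))"
  using smooth_on_differentiable[OF assms(1)[unfolded smooth_in_chart_def]] assms(2,3)
  by (auto simp: frechet_derivative_works)

lemma pderiv_cong:
  assumes "\<And>q. q \<in> U \<Longrightarrow> q \<in> chart_dom c \<Longrightarrow> f q = g q" "smooth f" "p \<in> U" "p \<in> chart_dom c"
  shows "pderiv_chart c a f p = pderiv_chart c a g p"
proof -
  have "((\<lambda>x. g (chart_inv c x)) has_derivative
    frechet_derivative (\<lambda>x. f (chart_inv c x)) (at (coords c p))) (at (coords c p))"
    by (rule has_derivative_transform_within_open[OF has_derivative_in_chart[OF assms(2-4)]
          open_image]) (use assms image_chart_inv in auto)
  from pderiv_chart_eqI[OF this] show ?thesis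
    by (simp add: pderiv_chart_def)
qed

lemma smooth_pderiv:
  assumes "smooth f"
  shows "smooth (pderiv_chart c a f)"
proof -
  have "smooth_on (coords c ` (U \<inter> chart_dom c))
      (\<lambda>x. frechet_derivative (\<lambda>x. f (chart_inv c x)) (at x) (axis a 1))"
    by (rule smooth_on_frechet_derivative) (use assms in \<open>simp add: smooth_in_chart_def\<close>)
  then show ?thesis
    unfolding smooth_in_chart_def
    by (rule smooth_on_cong[OF open_image, rotated]) (simp add: pderiv_chart_def image_chart_inv)
qed

lemma pderiv_const: "pderiv_chart c a (\<lambda>p. k) p = 0"
  by (simp add: pderiv_chart_def)

context
  fixes p assumes p: "p \<in> U" "p \<in> chart_dom c"
begin

lemma pderiv_linear:
  assumes "bounded_linear L" "smooth f"
  shows "pderiv_chart c a (\<lambda>p. L (f p)) p = L (pderiv_chart c a f p)"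
  using pderiv_chart_eqI[OF bounded_linear.has_derivative[OF assms(1)
        has_derivative_in_chart[OF assms(2) p]]]
  by (simp add: pderiv_chart_def)

lemma pderiv_bilinear:
  assumes "bounded_bilinear B" "smooth f" "smooth g"
  shows "pderiv_chart c a (\<lambda>p. B (f p) (g p)) p =
    B (f p) (pderiv_chart c a g p) + B (pderiv_chart c a f p) (g p)"
  using pderiv_chart_eqI[OF bounded_bilinear.FDERIV[OF assms(1)
        has_derivative_in_chart[OF assms(2) p] has_derivative_in_chart[OF assms(3) p]]]
  by (simp add: pderiv_chart_def is_chartD(2)[OF chart p(2)])

lemma pderiv_add:
  assumes "smooth f" "smooth g"
  shows "pderiv_chart c a (\<lambda>p. f p + g p) p = pderiv_chart c a f p + pderiv_chart c a g p"
  using pderiv_chart_eqI[OF has_derivative_add[OF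
        has_derivative_in_chart[OF assms(1) p] has_derivative_in_chart[OF assms(2) p]]]
  by (simp add: pderiv_chart_def)

lemma pderiv_minus:
  "smooth f \<Longrightarrow> pderiv_chart c a (\<lambda>p. - f p) p = - pderiv_chart c a f p"
  by (rule pderiv_linear[OF bounded_linear_minus[OF bounded_linear_ident]])

lemma pderiv_diff:
  assumes "smooth f" "smooth g"
  shows "pderiv_chart c a (\<lambda>p. f p - g p) p = pderiv_chart c a f p - pderiv_chart c a g p"
  using pderiv_add[OF assms(1) smooth_minus[OF assms(2)]] pderiv_minus[OF assms(2)] by simp

lemma pderiv_mult:
  assumes "smooth f" "smooth g"
  shows "pderiv_chart c a (\<lambda>p. f p * g p :: real) p =
    f p * pderiv_chart c a g p + pderiv_chart c a f p * g p"
  by (rule pderiv_bilinear[OF bounded_bilinear_mult assms])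

lemma pderiv_cmult:
  "smooth f \<Longrightarrow> pderiv_chart c a (\<lambda>p. k * f p :: real) p = k * pderiv_chart c a f p"
  by (rule pderiv_linear[OF bounded_linear_mult_right])

lemma pderiv_sum:
  "(\<And>k. k \<in> K \<Longrightarrow> smooth (f k)) \<Longrightarrow>
    pderiv_chart c a (\<lambda>p. \<Sum>k\<in>K. f k p) p = (\<Sum>k\<in>K. pderiv_chart c a (f k) p)"
  by (induction K rule: infinite_finite_induct)
    (auto simp: pderiv_const intro!: trans[OF pderiv_add] smooth_sum)

lemma pderiv_exp:
  fixes f :: "'a \<Rightarrow> real"
  assumes "smooth f"
  shows "pderiv_chart c a (\<lambda>p. exp (f p)) p = exp (f p) * pderiv_chart c a f p"
  using pderiv_chart_eqI[OF has_derivative_exp[OF has_derivative_in_chart[OF assms p]]]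
  by (simp add: pderiv_chart_def is_chartD(2)[OF chart p(2)])

lemma pderiv_commute:
  fixes f :: "'a \<Rightarrow> real"
  assumes "smooth f"
  shows "pderiv_chart c a (pderiv_chart c b f) p = pderiv_chart c b (pderiv_chart c a f) p"
proof -
  let ?F = "\<lambda>x. f (chart_inv c x)" and ?S = "coords c ` (U \<inter> chart_dom c)"
  have sm: "smooth_on ?S ?F"
    using assms by (simp add: smooth_in_chart_def)
  have "pderiv_chart c a (pderiv_chart c b f) p =
      frechet_derivative (\<lambda>x. frechet_derivative ?F (at x) (axis b 1)) (at (coords c p)) (axis a 1)"
    for a b
  proof (rule pderiv_chart_eqI, rule has_derivative_transform_within_open[OF _ open_image])
    show "((\<lambda>x. frechet_derivative ?F (at x) (axis b 1)) has_derivative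
      frechet_derivative (\<lambda>x. frechet_derivative ?F (at x) (axis b 1)) (at (coords c p)))
      (at (coords c p))"
      using smooth_on_differentiable[OF smooth_on_frechet_derivative[OF sm]] p
      by (auto simp: frechet_derivative_works)
  qed (use p image_chart_inv in \<open>auto simp: pderiv_chart_def\<close>)
  then show ?thesis
    using frechet_derivative_commute[OF open_image sm, of "coords c p"] p by simp
qed

lemma frechet_derivative_in_chart:
  assumes "smooth f"
  shows "frechet_derivative (\<lambda>x. f (chart_inv c x)) (at (coords c p)) v =
    (\<Sum>a\<in>UNIV. v $ a *\<^sub>R pderiv_chart c a f p)"
proof -
  let ?L = "frechet_derivative (\<lambda>x. f (chart_inv c x)) (at (coords c p))"
  have lin: "linear ?L"
    using has_derivative_in_chart[OF assms p] has_derivative_linear by blast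
  have "?L v = ?L (\<Sum>a\<in>UNIV. v $ a *\<^sub>R axis a 1)"
    by (simp add: basis_expansion scalar_mult_eq_scaleR[symmetric])
  also have "\<dots> = (\<Sum>a\<in>UNIV. v $ a *\<^sub>R ?L (axis a 1))"
    by (simp add: linear_sum[OF lin] linear_cmul[OF lin])
  finally show ?thesis
    by (simp add: pderiv_chart_def)
qed

end

lemma smooth_imp_continuous_on:
  assumes "smooth f"
  shows "continuous_on (U \<inter> chart_dom c) f"
proof -
  have "continuous_on (coords c ` (U \<inter> chart_dom c)) (\<lambda>x. f (chart_inv c x))"
    using assms smooth_on_continuous by (simp add: smooth_in_chart_def)
  then have "continuous_on (U \<inter> chart_dom c) (\<lambda>p. f (chart_inv c (coords c p)))"
    by (rule continuous_on_compose2) (auto intro: continuous_on_subset[OF is_chartD(4)[OF chart]])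
  then show ?thesis
    by (rule continuous_on_eq) (auto simp: is_chartD(2)[OF chart])
qed

end

lemma smooth_in_chart_subset:
  "smooth_in_chart c U f \<Longrightarrow> V \<subseteq> U \<Longrightarrow> smooth_in_chart c V f"
  unfolding smooth_in_chart_def smooth_on_def by (auto intro: Ck_on_subset)

section \<open>The Levi-Civita connection and its curvature\<close>

lemma positive_definite_invertible:
  fixes G :: "real^'n^'n"
  assumes "\<And>v. v \<noteq> 0 \<Longrightarrow> 0 < v \<bullet> (G *v v)"
  shows "invertible G"
proof -
  have "x = 0" if "G *v x = 0" for x
    using assms[of x] that by force
  then show ?thesis
    using matrix_left_invertible_ker invertible_left_inverse by blast
qed

locale metric_region = chart_region "A i" U
  for A :: "('i, 'a::topological_space, 'n::finite) atlas" and i U +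
  fixes g :: "('i, 'a, 'n) metric_comps"
  assumes smooth_metric: "smooth (g i)"
    and metric_transpose: "p \<in> U \<Longrightarrow> p \<in> chart_dom (A i) \<Longrightarrow> transpose (g i p) = g i p"
    and metric_positive: "p \<in> U \<Longrightarrow> p \<in> chart_dom (A i) \<Longrightarrow> v \<noteq> 0 \<Longrightarrow> 0 < v \<bullet> (g i p *v v)"
begin

abbreviation D :: "'n \<Rightarrow> ('a \<Rightarrow> 'b::real_normed_vector) \<Rightarrow> 'a \<Rightarrow> 'b" where
  "D \<equiv> pderiv_chart (A i)"

abbreviation \<Gamma> :: "'a \<Rightarrow> 'n \<Rightarrow> 'n \<Rightarrow> 'n \<Rightarrow> real" where
  "\<Gamma> \<equiv> christoffel A g i"

lemma smooth_metric_comp: "smooth (\<lambda>p. g i p $ a $ b)"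
  by (intro smooth_nth smooth_metric)

lemma christoffel_smooth: "smooth (\<lambda>p. \<Gamma> p c a b)"
proof -
  have "smooth (\<lambda>p. matrix_inv (g i p))"
    by (rule smooth_matrix_inv[OF smooth_metric]) (simp add: positive_definite_invertible metric_positive)
  then show ?thesis
    unfolding christoffel_def
    by (intro smooth_divide smooth_sum smooth_mult smooth_add smooth_diff smooth_nth smooth_pderiv
        smooth_metric_comp smooth_const) auto
qed

context
  fixes p assumes p: "p \<in> U" "p \<in> chart_dom (A i)"
begin

lemma metric_invertible: "invertible (g i p)"
  by (rule positive_definite_invertible) (rule metric_positive[OF p])

lemma metric_sym: "g i p $ a $ b = g i p $ b $ a"
  using arg_cong[OF metric_transpose[OF p], of "\<lambda>M. M $ b $ a"] by (simp add: transpose_def)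

lemma inverse_metric_transpose: "transpose (matrix_inv (g i p)) = matrix_inv (g i p)"
proof (rule matrix_inv_unique[symmetric])
  have "g i p ** transpose (matrix_inv (g i p)) = transpose (matrix_inv (g i p) ** g i p)"
    by (simp add: matrix_transpose_mul metric_transpose[OF p])
  then show "g i p ** transpose (matrix_inv (g i p)) = mat 1"
    by (simp add: matrix_inv_inverse metric_invertible)
qed

lemma inverse_metric_sym: "matrix_inv (g i p) $ a $ b = matrix_inv (g i p) $ b $ a"
  using arg_cong[OF inverse_metric_transpose, of "\<lambda>M. M $ b $ a"] by (simp add: transpose_def)

lemma metric_inverse_metric:
  "(\<Sum>e\<in>UNIV. g i p $ a $ e * matrix_inv (g i p) $ e $ b) = (if a = b then 1 else 0)"
  "(\<Sum>e\<in>UNIV. matrix_inv (g i p) $ a $ e * g i p $ e $ b) = (if a = b then 1 else 0)"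
  using matrix_inv_inverse[OF metric_invertible]
  by (simp_all add: matrix_matrix_mult_def mat_def vec_eq_iff)

end

lemma christoffel_sym:
  assumes "p \<in> U" "p \<in> chart_dom (A i)"
  shows "\<Gamma> p c a b = \<Gamma> p c b a"
proof -
  have "D d (\<lambda>q. g i q $ a $ b) p = D d (\<lambda>q. g i q $ b $ a) p" for d
    by (rule pderiv_cong[OF _ smooth_metric_comp assms]) (rule metric_sym)
  then show ?thesis
    by (simp add: christoffel_def algebra_simps)
qed

lemma christoffel_lower:
  assumes "p \<in> U" "p \<in> chart_dom (A i)"
  shows "(\<Sum>c\<in>UNIV. g i p $ e $ c * \<Gamma> p c a b) =
    (D a (\<lambda>q. g i q $ e $ b) p + D b (\<lambda>q. g i q $ e $ a) p - D e (\<lambda>q. g i q $ a $ b) p) / 2"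
proof -
  define K where "K d = (D a (\<lambda>q. g i q $ d $ b) p + D b (\<lambda>q. g i q $ d $ a) p
    - D d (\<lambda>q. g i q $ a $ b) p) / 2" for d
  have "(\<Sum>c\<in>UNIV. g i p $ e $ c * \<Gamma> p c a b) =
      (\<Sum>c\<in>UNIV. \<Sum>d\<in>UNIV. g i p $ e $ c * matrix_inv (g i p) $ c $ d * K d)"
    by (simp add: christoffel_def K_def sum_distrib_left sum_divide_distrib mult.assoc)
  also have "\<dots> = (\<Sum>d\<in>UNIV. (\<Sum>c\<in>UNIV. g i p $ e $ c * matrix_inv (g i p) $ c $ d) * K d)"
    by (subst sum.swap) (simp add: sum_distrib_right)
  also have "\<dots> = K e"
    by (simp add: metric_inverse_metric[OF assms] if_distrib[of "\<lambda>x. x * _"] cong: if_cong)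
  finally show ?thesis by (simp add: K_def)
qed

text \<open>This is \<open>\<nabla>g = 0\<close> in coordinates: in the sum of two lowered Christoffel symbols all but one of
  the derivatives of the metric cancel.\<close>

lemma metric_compatible:
  assumes "p \<in> U" "p \<in> chart_dom (A i)"
  shows "D a (\<lambda>q. g i q $ c $ d) p =
    (\<Sum>e\<in>UNIV. g i p $ d $ e * \<Gamma> p e a c) + (\<Sum>e\<in>UNIV. g i p $ c $ e * \<Gamma> p e a d)"
proof -
  have "D k (\<lambda>q. g i q $ a $ b) p = D k (\<lambda>q. g i q $ b $ a) p" for a b k
    by (rule pderiv_cong[OF _ smooth_metric_comp assms]) (rule metric_sym)
  note sym = this[of _ d c] this[of _ d a] this[of _ c a]
  show ?thesis
    unfolding christoffel_lower[OF assms] sym by (simp add: field_simps)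
qed

text \<open>The second derivatives of the metric commute. Computed from \<open>\<nabla>g = 0\<close>, their antisymmetric
  part is the symmetrisation of the lowered curvature: the products of two Christoffel symbols
  that are contracted with each other through the metric are symmetric and cancel.\<close>

lemma riemann_skew:
  assumes p: "p \<in> U" "p \<in> chart_dom (A i)"
  shows "(\<Sum>e\<in>UNIV. g i p $ c $ e * riemann A g i p a b e d)
    + (\<Sum>e\<in>UNIV. g i p $ d $ e * riemann A g i p a b e c) = 0"
proof -
  note sm = smooth_metric_comp christoffel_smooth
  define G where "G c e = g i p $ c $ e" for c e
  define C where "C = \<Gamma> p"
  \<comment> \<open>\<open>N\<close> holds the derivatives of \<open>\<Gamma>\<close>, \<open>Q\<close> the quadratic terms of the curvature, \<open>X\<close> the cross terms.\<close>
  define N where "N a b c d = (\<Sum>e\<in>UNIV. G d e * D a (\<lambda>q. \<Gamma> q e b c) p)" for a b c d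
  define Q where "Q a b c d = (\<Sum>e\<in>UNIV. \<Sum>f\<in>UNIV. G d f * C f a e * C e b c)" for a b c d
  define X where "X a b c d = (\<Sum>e\<in>UNIV. \<Sum>f\<in>UNIV. G e f * C f a d * C e b c)" for a b c d
  have Gsym: "G c e = G e c" for c e
    unfolding G_def by (rule metric_sym[OF p])
  have Xsym: "X a b c d = X b a d c" for a b c d
    unfolding X_def by (subst sum.swap, rule sum.cong[OF refl], rule sum.cong[OF refl])
      (simp add: Gsym mult.commute mult.left_commute)
  have half: "D a (\<lambda>q. \<Sum>e\<in>UNIV. g i q $ d $ e * \<Gamma> q e b c) p = N a b c d + Q a b c d + X a b c d"
    for a b c d
  proof -
    have "D a (\<lambda>q. \<Sum>e\<in>UNIV. g i q $ d $ e * \<Gamma> q e b c) p =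
        N a b c d + (\<Sum>e\<in>UNIV. D a (\<lambda>q. g i q $ d $ e) p * C e b c)"
      by (simp add: pderiv_sum[OF p] pderiv_mult[OF p] smooth_mult sm sum.distrib N_def G_def C_def)
    also have "(\<Sum>e\<in>UNIV. D a (\<lambda>q. g i q $ d $ e) p * C e b c) = Q a b c d + X a b c d"
      by (simp add: metric_compatible[OF p] Q_def X_def sum.distrib distrib_right sum_distrib_right
          flip: G_def C_def)
    finally show ?thesis by simp
  qed
  have second: "D a (D b (\<lambda>q. g i q $ c $ d)) p =
      N a b c d + Q a b c d + X a b c d + (N a b d c + Q a b d c + X a b d c)" for a b
  proof -
    have "D a (D b (\<lambda>q. g i q $ c $ d)) p =
        D a (\<lambda>q. (\<Sum>e\<in>UNIV. g i q $ d $ e * \<Gamma> q e b c) + (\<Sum>e\<in>UNIV. g i q $ c $ e * \<Gamma> q e b d)) p"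
      by (rule pderiv_cong[OF _ smooth_pderiv[OF smooth_metric_comp] p]) (rule metric_compatible)
    also have "\<dots> = D a (\<lambda>q. \<Sum>e\<in>UNIV. g i q $ d $ e * \<Gamma> q e b c) p
        + D a (\<lambda>q. \<Sum>e\<in>UNIV. g i q $ c $ e * \<Gamma> q e b d) p"
      by (rule pderiv_add[OF p]) (intro smooth_sum smooth_mult sm)+
    finally show ?thesis by (simp only: half)
  qed
  have R: "(\<Sum>e\<in>UNIV. g i p $ d $ e * riemann A g i p a b e c) =
      N a b c d + Q a b c d - N b a c d - Q b a c d" for c d
  proof -
    have "Q a b c d - Q b a c d = (\<Sum>f\<in>UNIV. G d f * (\<Sum>e\<in>UNIV. C f a e * C e b c - C f b e * C e a c))"
      unfolding Q_def by (subst (1 2) sum.swap)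
        (simp add: sum_distrib_left sum_subtractf right_diff_distrib mult.assoc)
    then show ?thesis
      by (simp add: riemann_def N_def distrib_left right_diff_distrib sum.distrib sum_subtractf
          flip: G_def C_def)
  qed
  have "D a (D b (\<lambda>q. g i q $ c $ d)) p = D b (D a (\<lambda>q. g i q $ c $ d)) p"
    by (rule pderiv_commute[OF p smooth_metric_comp])
  then show ?thesis
    unfolding second R using Xsym[of a b c d] Xsym[of a b d c] by simp
qed

lemma riemann_swap: "riemann A g i p b a c d = - riemann A g i p a b c d"
  by (simp add: riemann_def sum_subtractf)

text \<open>In dimension two a tensor that is skew in its first and in its last two indices, such as
  \<open>R\<^sub>a\<^sub>b\<^sub>c\<^sub>d\<close>, has a single free component, and hence its contraction is a multiple of \<open>g\<close>.\<close>

lemma ricci_surface: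
  assumes p: "p \<in> U" "p \<in> chart_dom (A i)" and dim: "CARD('n) = 2"
  shows "ricci A g i p = (scalar_curvature A g i p / 2) *\<^sub>R g i p"
proof -
  obtain x y :: 'n where xy: "UNIV = {x, y}" "x \<noteq> y"
    using dim by (meson card_2_iff)
  have sum: "(\<Sum>e\<in>UNIV. f e) = f x + f y" for f :: "'n \<Rightarrow> real"
    by (subst xy(1)) (simp add: xy(2))
  have all: "(\<forall>e. P e) \<longleftrightarrow> P x \<and> P y" for P
  proof -
    have "(\<forall>e. P e) \<longleftrightarrow> (\<forall>e\<in>UNIV. P e)" by simp
    also have "\<dots> \<longleftrightarrow> P x \<and> P y" by (subst xy(1)) simp
    finally show ?thesis .
  qed
  \<comment> \<open>The curvature with its upper index lowered, and its one free component \<open>l\<close>.\<close>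
  define L where "L a b c d = (\<Sum>e\<in>UNIV. g i p $ c $ e * riemann A g i p a b e d)" for a b c d
  define h where "h a b = matrix_inv (g i p) $ a $ b" for a b
  define G where "G a b = g i p $ a $ b" for a b
  have skew: "L a b c d = - L a b d c" "L a b c d = - L b a c d" for a b c d
    using riemann_skew[OF p, of c a b d]
    by (simp_all add: L_def sum_negf riemann_swap[where a = b and b = a])
  have Rup: "riemann A g i p a b e d = (\<Sum>c\<in>UNIV. h e c * L a b c d)" for a b e d
  proof -
    have "(\<Sum>c\<in>UNIV. h e c * L a b c d) =
        (\<Sum>f\<in>UNIV. (\<Sum>c\<in>UNIV. h e c * G c f) * riemann A g i p a b f d)"
      unfolding L_def by (simp add: sum_distrib_left sum_distrib_right G_def mult.assoc) (rule sum.swap)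
    then show ?thesis
      by (simp add: h_def G_def metric_inverse_metric[OF p] if_distrib[of "\<lambda>x. x * _"] cong: if_cong)
  qed
  have hG: "(\<Sum>e\<in>UNIV. h a e * G e b) = (if a = b then 1 else 0)" for a b
    unfolding h_def G_def by (rule metric_inverse_metric[OF p])
  have sym: "h y x = h x y" "G y x = G x y"
    unfolding h_def G_def by (simp_all add: metric_sym[OF p, of y] inverse_metric_sym[OF p, of y])
  have eqs: "h x x * G x x + h x y * G x y = 1" "h x x * G x y + h x y * G y y = 0"
    "h x y * G x x + h y y * G x y = 0" "h x y * G x y + h y y * G y y = 1"
    using hG[of x x] hG[of x y] hG[of y x] hG[of y y] xy(2) by (simp_all add: sum sym)
  define l where "l = L x y x y"
  have L: "L a a c d = 0" "L a b c c = 0" "L x y x y = l" "L x y y x = - l" "L y x x y = - l"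
    for a b c d
    using skew(2)[of a a c d] skew(1)[of a b c c] skew(1)[of x y y x] skew(2)[of y x x y]
    by (simp_all add: l_def)
  have "L y x y x = l"
    using skew(1)[of y x y x] L(5) by simp
  note L = L this
  define K where "K = l * (h x x * h y y - h x y * h x y)"
  \<comment> \<open>The inverse of a symmetric matrix of size two is its adjugate divided by the determinant.\<close>
  have adj: "h y y = (h x x * h y y - h x y * h x y) * G x x"
    "- h x y = (h x x * h y y - h x y * h x y) * G x y"
    "h x x = (h x x * h y y - h x y * h x y) * G y y"
    using eqs by algebra+
  have ric: "ricci A g i p $ b $ d = (\<Sum>a\<in>UNIV. \<Sum>c\<in>UNIV. h a c * L a b c d)" for b d
    by (simp add: ricci_def Rup)
  have "ricci A g i p = K *\<^sub>R g i p"
    unfolding vec_eq_iff all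
    by (simp add: ric sum L sym K_def flip: G_def) (use adj in algebra)
  moreover have "metric_trace (g i p) (g i p) = 2"
    using metric_trace_self[OF metric_invertible[OF p] metric_transpose[OF p]] dim by simp
  ultimately show ?thesis
    by (simp add: scalar_curvature_def metric_trace_scaleR)
qed

end

lemma riemannian_metric_region:
  assumes "smooth_manifold A" "riemannian_metric A g" "open U"
  shows "metric_region A i U g"
proof
  show "is_chart (A i)" "open U"
    using assms by (auto simp: smooth_manifold_def)
  show "smooth_in_chart (A i) U (g i)"
    using assms(2) smooth_in_chart_subset[of "A i" UNIV "g i" U]
    unfolding riemannian_metric_def by blast
  show "transpose (g i p) = g i p" "v \<noteq> 0 \<Longrightarrow> 0 < v \<bullet> (g i p *v v)"
    if "p \<in> chart_dom (A i)" for p v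
    using assms(2) that unfolding riemannian_metric_def by blast+
qed

text \<open>The normalisation of \<open>\<mu>\<close> gives the same formula in all dimensions. In dimension one both sides
  vanish; in dimension two it rests on \<open>ricci_surface\<close>, since only the scalar curvature is
  assumed to be constant; from dimension three on it is the Einstein equation.\<close>

lemma einstein_ricci:
  fixes A :: "('i, 'a::{second_countable_topology, t2_space}, 'n::finite) atlas"
  assumes E: "einstein_manifold A g \<mu>" and p: "p \<in> chart_dom (A i)"
  shows "ricci A g i p = (2 * (real CARD('n) - 1) * \<mu>) *\<^sub>R g i p"
proof -
  interpret metric_region A i UNIV g
    by (rule riemannian_metric_region) (use E in \<open>auto simp: einstein_manifold_def\<close>)
  note p = UNIV_I p
  let ?n = "real CARD('n)"
  have \<mu>: "\<mu> = scalar_curvature A g i p / (2 * ?n * (?n - 1))" if "CARD('n) \<ge> 2"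
    using E that p by (auto simp: einstein_manifold_def)
  have "CARD('n) > 0" by simp
  then consider "CARD('n) = 1" | "CARD('n) = 2" | "CARD('n) \<ge> 3" by linarith
  then show ?thesis
  proof cases
    case 1
    then obtain x :: 'n where "UNIV = {x}"
      by (meson card_1_singletonE)
    then have "a = b" for a b :: 'n
      by (metis UNIV_I singletonD)
    then have "riemann A g i p a b c d = riemann A g i p a a c d" for a b c d
      by metis
    then have "riemann A g i p a b c d = 0" for a b c d
      by (simp add: riemann_def)
    then show ?thesis
      using 1 by (simp add: ricci_def vec_eq_iff)
  next
    case 2
    then show ?thesis
      using ricci_surface[OF p 2] \<mu> by simp
  next
    case 3
    then have "\<exists>l. \<forall>i. \<forall>p\<in>chart_dom (A i). ricci A g i p = l *\<^sub>R g i p"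
      using E by (simp add: einstein_manifold_def einstein_metric_def)
    then obtain l where l: "ricci A g i p = l *\<^sub>R g i p"
      using p by blast
    have "scalar_curvature A g i p = l * ?n"
      by (simp add: scalar_curvature_def l metric_trace_scaleR
          metric_trace_self[OF metric_invertible[OF p] metric_transpose[OF p]])
    then have "\<mu> = l / (2 * (?n - 1))"
      using \<mu> 3 by simp
    then have "l = 2 * (?n - 1) * \<mu>"
      using 3 by (simp add: field_simps)
    then show ?thesis using l by simp
  qed
qed

section \<open>Conformal change of the metric\<close>

text \<open>Throughout, \<open>y\<close> are the components of \<open>\<Upsilon> = d\<omega>\<close>, \<open>u\<close> those of the vector field with an
  index raised by \<open>g\<close>, and \<open>C\<close> is the difference of the two Levi-Civita connections.\<close>

locale conformal_region = metric_region A i U g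
  for A :: "('i, 'a::topological_space, 'n::finite) atlas" and i U g +
  fixes \<omega> :: "'a \<Rightarrow> real" and h :: "('i, 'a, 'n) metric_comps"
  assumes smooth_factor: "smooth \<omega>"
    and rescaled: "p \<in> U \<Longrightarrow> p \<in> chart_dom (A i) \<Longrightarrow> h i p = exp (2 * \<omega> p) *\<^sub>R g i p"
begin

definition y :: "'a \<Rightarrow> 'n \<Rightarrow> real" where
  "y p a = D a \<omega> p"

definition u :: "'a \<Rightarrow> 'n \<Rightarrow> real" where
  "u p c = (\<Sum>d\<in>UNIV. matrix_inv (g i p) $ c $ d * y p d)"

definition C :: "'a \<Rightarrow> 'n \<Rightarrow> 'n \<Rightarrow> 'n \<Rightarrow> real" where
  "C p c a b = (if c = a then y p b else 0) + (if c = b then y p a else 0) - g i p $ a $ b * u p c"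

definition nabla_y :: "'a \<Rightarrow> 'n \<Rightarrow> 'n \<Rightarrow> real" where
  "nabla_y p a b = D a (\<lambda>q. y q b) p - (\<Sum>e\<in>UNIV. \<Gamma> p e a b * y p e)"

definition nabla_u :: "'a \<Rightarrow> 'n \<Rightarrow> 'n \<Rightarrow> real" where
  "nabla_u p a c = D a (\<lambda>q. u q c) p + (\<Sum>e\<in>UNIV. \<Gamma> p c a e * u p e)"

definition yy :: "'a \<Rightarrow> real" where
  "yy p = (\<Sum>c\<in>UNIV. y p c * u p c)"

lemma smooth_inverse_metric: "smooth (\<lambda>p. matrix_inv (g i p))"
  by (rule smooth_matrix_inv[OF smooth_metric]) (rule metric_invertible)

lemma smooth_y: "smooth (\<lambda>p. y p a)"
  unfolding y_def by (rule smooth_pderiv[OF smooth_factor])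

lemma smooth_u: "smooth (\<lambda>p. u p a)"
  unfolding u_def by (intro smooth_sum smooth_mult smooth_nth smooth_inverse_metric smooth_y)

lemma smooth_if: "smooth f \<Longrightarrow> smooth (\<lambda>p. if b then f p else (0::real))"
  by (cases b) (auto intro: smooth_const)

lemma smooth_C: "smooth (\<lambda>p. C p c a b)"
  unfolding C_def
  by (intro smooth_diff smooth_add smooth_mult smooth_if smooth_y smooth_u smooth_metric_comp)

lemma pderiv_if: "pderiv_chart (A i) a (\<lambda>p. if b then f p else (0::real)) p =
    (if b then pderiv_chart (A i) a f p else 0)"
  by (cases b) (auto simp: pderiv_const)

lemma rescaled_metric_region: "metric_region A i U h"
proof
  have "smooth (\<lambda>p. exp (2 * \<omega> p) *\<^sub>R g i p)"
    by (intro smooth_scaleR smooth_exp smooth_mult smooth_const smooth_factor smooth_metric)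
  then show "smooth (h i)"
    by (rule smooth_cong[rotated]) (simp add: rescaled)
  fix p assume p: "p \<in> U" "p \<in> chart_dom (A i)"
  show "transpose (h i p) = h i p"
    using metric_transpose[OF p] by (simp add: rescaled[OF p] transpose_def vec_eq_iff)
  show "0 < v \<bullet> (h i p *v v)" if "v \<noteq> 0" for v
    using metric_positive[OF p that]
    by (simp add: rescaled[OF p] scaleR_matrix_vector_assoc[symmetric])
qed

sublocale hat: metric_region A i U h
  by (rule rescaled_metric_region)

context
  fixes p assumes p: "p \<in> U" "p \<in> chart_dom (A i)"
begin

lemma rescaled_inverse: "matrix_inv (h i p) = exp (- 2 * \<omega> p) *\<^sub>R matrix_inv (g i p)"
proof (rule matrix_inv_unique)
  have "h i p ** (exp (- 2 * \<omega> p) *\<^sub>R matrix_inv (g i p)) =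
      (exp (2 * \<omega> p) * exp (- 2 * \<omega> p)) *\<^sub>R (g i p ** matrix_inv (g i p))"
    by (simp add: rescaled[OF p] matrix_matrix_mult_def vec_eq_iff sum_distrib_left algebra_simps)
  then show "h i p ** (exp (- 2 * \<omega> p) *\<^sub>R matrix_inv (g i p)) = mat 1"
    by (simp add: matrix_inv_inverse[OF metric_invertible[OF p]] exp_minus_inverse)
qed

lemma lower_u: "(\<Sum>c\<in>UNIV. g i p $ a $ c * u p c) = y p a"
proof -
  have "(\<Sum>c\<in>UNIV. g i p $ a $ c * u p c) =
      (\<Sum>d\<in>UNIV. (\<Sum>c\<in>UNIV. g i p $ a $ c * matrix_inv (g i p) $ c $ d) * y p d)"
    unfolding u_def by (simp add: sum_distrib_left sum_distrib_right mult.assoc) (rule sum.swap)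
  then show ?thesis
    by (simp add: metric_inverse_metric[OF p] if_distrib[of "\<lambda>x. x * _"] cong: if_cong)
qed

lemma christoffel_rescaled: "christoffel A h i p c a b = \<Gamma> p c a b + C p c a b"
proof -
  let ?H = "matrix_inv (g i p)"
  define K where "K d = D a (\<lambda>q. g i q $ d $ b) p + D b (\<lambda>q. g i q $ d $ a) p
    - D d (\<lambda>q. g i q $ a $ b) p" for d
  have deriv: "D e (\<lambda>q. h i q $ k $ l) p =
      exp (2 * \<omega> p) * (2 * y p e * g i p $ k $ l + D e (\<lambda>q. g i q $ k $ l) p)" for e k l
  proof -
    have sm: "smooth (\<lambda>q. 2 * \<omega> q)"
      by (intro smooth_mult smooth_const smooth_factor)
    have "D e (\<lambda>q. h i q $ k $ l) p = D e (\<lambda>q. exp (2 * \<omega> q) * g i q $ k $ l) p"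
      by (rule pderiv_cong[OF _ hat.smooth_metric_comp p]) (simp add: rescaled)
    also have "\<dots> = exp (2 * \<omega> p) * D e (\<lambda>q. g i q $ k $ l) p
        + D e (\<lambda>q. exp (2 * \<omega> q)) p * g i p $ k $ l"
      by (rule pderiv_mult[OF p smooth_exp[OF sm] smooth_metric_comp])
    also have "D e (\<lambda>q. exp (2 * \<omega> q)) p = exp (2 * \<omega> p) * (2 * y p e)"
      by (simp add: pderiv_exp[OF p sm] pderiv_cmult[OF p smooth_factor] y_def)
    finally show ?thesis
      by (simp add: algebra_simps)
  qed
  have e: "exp (- 2 * \<omega> p) * exp (2 * \<omega> p) = 1"
    by (simp add: exp_add[symmetric])
  have "christoffel A h i p c a b = (\<Sum>d\<in>UNIV. ?H $ c $ d * K d / 2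
      + ?H $ c $ d * g i p $ d $ b * y p a + ?H $ c $ d * g i p $ d $ a * y p b
      - g i p $ a $ b * (?H $ c $ d * y p d))"
    unfolding christoffel_def sum_divide_distrib
  proof (rule sum.cong[OF refl])
    fix d
    define E where "E = exp (2 * \<omega> p)" define E' where "E' = exp (- 2 * \<omega> p)"
    have EE: "E' * E = 1" using e by (simp add: E_def E'_def)
    have "matrix_inv (h i p) $ c $ d *
        (D a (\<lambda>q. h i q $ d $ b) p + D b (\<lambda>q. h i q $ d $ a) p - D d (\<lambda>q. h i q $ a $ b) p) / 2 =
        (E' * E) * (?H $ c $ d * (K d + 2 * y p a * g i p $ d $ b + 2 * y p b * g i p $ d $ a
          - 2 * y p d * g i p $ a $ b) / 2)"
      unfolding deriv rescaled_inverse K_def E_def[symmetric] E'_def[symmetric]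
      by (simp add: algebra_simps)
    then show "matrix_inv (h i p) $ c $ d *
        (D a (\<lambda>q. h i q $ d $ b) p + D b (\<lambda>q. h i q $ d $ a) p - D d (\<lambda>q. h i q $ a $ b) p) / 2 =
        ?H $ c $ d * K d / 2
        + ?H $ c $ d * g i p $ d $ b * y p a + ?H $ c $ d * g i p $ d $ a * y p b
        - g i p $ a $ b * (?H $ c $ d * y p d)"
      unfolding EE by (simp add: algebra_simps add_divide_distrib diff_divide_distrib)
  qed
  also have "\<dots> = \<Gamma> p c a b + C p c a b"
    by (simp add: sum.distrib sum_subtractf christoffel_def K_def C_def u_def sum_divide_distrib
        flip: sum_distrib_left sum_distrib_right)
      (simp add: metric_inverse_metric[OF p])
  finally show ?thesis .
qed

text \<open>\<open>C\<close> is built from Kronecker symbols and \<open>g\<close>, so every contraction with it is explicit. The next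
  three lemmas evaluate all terms of the Ricci tensor in which \<open>C\<close> occurs undifferentiated.\<close>

lemma C_contract_upper:
  "(\<Sum>e\<in>UNIV. X e * C p e b d) = X b * y p d + X d * y p b - g i p $ b $ d * (\<Sum>e\<in>UNIV. X e * u p e)"
proof -
  have "(\<Sum>e\<in>UNIV. X e * C p e b d) = (\<Sum>e\<in>UNIV. (if e = b then X e * y p d else 0)
      + (if e = d then X e * y p b else 0) - g i p $ b $ d * (X e * u p e))"
    by (rule sum.cong) (auto simp: C_def algebra_simps)
  then show ?thesis
    by (simp add: sum.distrib sum_subtractf sum_distrib_left)
qed

lemma C_contract_lower:
  "(\<Sum>e\<in>UNIV. C p a b e * X e) = (if a = b then \<Sum>e\<in>UNIV. y p e * X e else 0) + y p b * X a
    - u p a * (\<Sum>e\<in>UNIV. g i p $ b $ e * X e)"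
proof -
  have "(\<Sum>e\<in>UNIV. C p a b e * X e) = (\<Sum>e\<in>UNIV. (if a = b then y p e * X e else 0)
      + (if a = e then y p b * X e else 0) - u p a * (g i p $ b $ e * X e))"
    by (rule sum.cong) (auto simp: C_def algebra_simps)
  then show ?thesis
    by (simp add: sum.distrib sum_subtractf sum_distrib_left)
qed

lemma C_trace: "(\<Sum>a\<in>UNIV. C p a a e) = real CARD('n) * y p e"
proof -
  have "(\<Sum>a\<in>UNIV. C p a a e) = (\<Sum>a\<in>UNIV. y p e + (if a = e then y p a else 0) - g i p $ e $ a * u p a)"
    by (rule sum.cong) (auto simp: C_def metric_sym[OF p, of _ e])
  then show ?thesis
    by (simp add: sum.distrib sum_subtractf lower_u)
qed

end

context
  fixes p assumes p: "p \<in> U" "p \<in> chart_dom (A i)"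
begin

text \<open>Covariant differentiation commutes with lowering an index, because \<open>\<nabla>g = 0\<close>.\<close>

lemma nabla_y_lower: "nabla_y p a b = (\<Sum>c\<in>UNIV. g i p $ b $ c * nabla_u p a c)"
proof -
  have "D a (\<lambda>q. y q b) p = D a (\<lambda>q. \<Sum>c\<in>UNIV. g i q $ b $ c * u q c) p"
    by (rule pderiv_cong[OF _ smooth_y p]) (simp add: lower_u)
  also have "\<dots> = (\<Sum>c\<in>UNIV. g i p $ b $ c * D a (\<lambda>q. u q c) p)
      + (\<Sum>c\<in>UNIV. D a (\<lambda>q. g i q $ b $ c) p * u p c)"
    by (simp add: pderiv_sum[OF p] pderiv_mult[OF p] smooth_mult smooth_u smooth_metric_comp
        sum.distrib)
  also have "(\<Sum>c\<in>UNIV. D a (\<lambda>q. g i q $ b $ c) p * u p c) =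
      (\<Sum>c\<in>UNIV. \<Sum>e\<in>UNIV. g i p $ c $ e * \<Gamma> p e a b * u p c)
      + (\<Sum>c\<in>UNIV. \<Sum>e\<in>UNIV. g i p $ b $ e * \<Gamma> p e a c * u p c)"
    by (simp add: metric_compatible[OF p] distrib_right sum_distrib_right sum.distrib)
  also have "(\<Sum>c\<in>UNIV. \<Sum>e\<in>UNIV. g i p $ c $ e * \<Gamma> p e a b * u p c) =
      (\<Sum>e\<in>UNIV. \<Gamma> p e a b * (\<Sum>c\<in>UNIV. g i p $ e $ c * u p c))"
    by (subst sum.swap) (simp add: sum_distrib_left metric_sym[OF p] mult_ac)
  also have "\<dots> = (\<Sum>e\<in>UNIV. \<Gamma> p e a b * y p e)"
    by (simp add: lower_u[OF p])
  also have "(\<Sum>c\<in>UNIV. \<Sum>e\<in>UNIV. g i p $ b $ e * \<Gamma> p e a c * u p c) =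
      (\<Sum>e\<in>UNIV. g i p $ b $ e * (\<Sum>c\<in>UNIV. \<Gamma> p e a c * u p c))"
    by (subst sum.swap) (simp add: sum_distrib_left mult.assoc)
  finally show ?thesis
    by (simp add: nabla_y_def nabla_u_def distrib_left sum.distrib)
qed

lemma nabla_y_raise: "(\<Sum>c\<in>UNIV. matrix_inv (g i p) $ b $ c * nabla_y p a c) = nabla_u p a b"
proof -
  have "(\<Sum>c\<in>UNIV. matrix_inv (g i p) $ b $ c * nabla_y p a c) =
      (\<Sum>d\<in>UNIV. (\<Sum>c\<in>UNIV. matrix_inv (g i p) $ b $ c * g i p $ c $ d) * nabla_u p a d)"
    by (simp add: nabla_y_lower sum_distrib_left sum_distrib_right mult.assoc) (rule sum.swap)
  then show ?thesis
    by (simp add: metric_inverse_metric[OF p] if_distrib[of "\<lambda>x. x * _"] cong: if_cong)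
qed

lemma nabla_y_sym: "D a (\<lambda>q. y q b) p = D b (\<lambda>q. y q a) p"
  using pderiv_commute[OF p smooth_factor, of a b] by (simp add: y_def)

text \<open>The curvature of \<open>\<Gamma> + C\<close> differs from that of \<open>\<Gamma>\<close> by derivatives of \<open>C\<close>, by products of \<open>\<Gamma>\<close>
  with \<open>C\<close> and by products of two factors \<open>C\<close>. The products \<open>\<Gamma> C\<close> complete the partial derivatives
  of \<open>y\<close> and \<open>u\<close> to covariant ones; the rest of them (\<open>Q1\<close>, \<open>Q2\<close>, \<open>Q5\<close>, \<open>Q6\<close>) cancels, the last two
  against the derivatives of \<open>g\<close> that arise from differentiating \<open>C\<close>.\<close>

lemma ricci_rescaled:
  "ricci A h i p $ b $ d = ricci A g i p $ b $ d
    - (real CARD('n) - 2) * (nabla_y p b d - y p b * y p d)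
    - ((\<Sum>a\<in>UNIV. nabla_u p a a) + (real CARD('n) - 2) * yy p) * g i p $ b $ d"
proof -
  define n where "n = real CARD('n)"
  define G where "G a b = g i p $ a $ b" for a b
  define Y where "Y = y p"
  define W where "W = u p"
  define V where "V = \<Gamma> p"
  define K where "K = C p"
  have Gsym: "G a b = G b a" for a b
    unfolding G_def by (rule metric_sym[OF p])
  have Vsym: "V c a b = V c b a" for a b c
    unfolding V_def by (rule christoffel_sym[OF p])
  have up: "(\<Sum>e\<in>UNIV. X e * K e b d) = X b * Y d + X d * Y b - G b d * (\<Sum>e\<in>UNIV. X e * W e)"
    for X b d
    unfolding K_def Y_def G_def W_def by (rule C_contract_upper[OF p])
  have low: "(\<Sum>e\<in>UNIV. K a b e * X e) = (if a = b then \<Sum>e\<in>UNIV. Y e * X e else 0) + Y b * X a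
    - W a * (\<Sum>e\<in>UNIV. G b e * X e)" for X a b
    unfolding K_def Y_def G_def W_def by (rule C_contract_lower[OF p])
  have tr: "(\<Sum>a\<in>UNIV. K a a e) = n * Y e" for e
    unfolding K_def Y_def n_def by (rule C_trace[OF p])
  have GW: "(\<Sum>c\<in>UNIV. G a c * W c) = Y a" for a
    unfolding G_def W_def Y_def by (rule lower_u[OF p])
  have yy: "(\<Sum>c\<in>UNIV. Y c * W c) = yy p"
    by (simp add: Y_def W_def yy_def)
  define Q1 where "Q1 = (\<Sum>a\<in>UNIV. V a a b)"
  define Q2 where "Q2 = (\<Sum>a\<in>UNIV. V a a d)"
  define Q3 where "Q3 = (\<Sum>a\<in>UNIV. \<Sum>e\<in>UNIV. V a a e * W e)"
  define Q4 where "Q4 = (\<Sum>e\<in>UNIV. V e b d * Y e)"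
  define Q5 where "Q5 = (\<Sum>a\<in>UNIV. W a * (\<Sum>e\<in>UNIV. G d e * V e a b))"
  define Q6 where "Q6 = (\<Sum>a\<in>UNIV. W a * (\<Sum>e\<in>UNIV. G b e * V e a d))"
  have S1: "(\<Sum>a\<in>UNIV. \<Sum>e\<in>UNIV. V a a e * K e b d) = Q1 * Y d + Q2 * Y b - G b d * Q3"
    by (simp add: up sum.distrib sum_subtractf Q1_def Q2_def Q3_def sum_distrib_left sum_distrib_right)
  have S2: "(\<Sum>a\<in>UNIV. \<Sum>e\<in>UNIV. K a a e * V e b d) = n * Q4"
    by (subst sum.swap) (simp add: sum_distrib_right[symmetric] tr Q4_def sum_distrib_left mult_ac)
  have S3: "(\<Sum>a\<in>UNIV. \<Sum>e\<in>UNIV. K a a e * K e b d) = n * (2 * Y b * Y d - G b d * yy p)"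
  proof -
    have "(\<Sum>a\<in>UNIV. \<Sum>e\<in>UNIV. K a a e * K e b d) = n * (\<Sum>e\<in>UNIV. Y e * K e b d)"
      by (subst sum.swap, simp only: sum_distrib_right[symmetric] tr) (simp add: sum_distrib_left mult_ac)
    then show ?thesis by (simp add: up yy)
  qed
  have S4: "(\<Sum>a\<in>UNIV. \<Sum>e\<in>UNIV. V a b e * K e a d) = Q1 * Y d + Q4 - Q5"
  proof -
    have "(\<Sum>a\<in>UNIV. G a d * (\<Sum>e\<in>UNIV. V a b e * W e)) = Q5"
      unfolding Q5_def sum_distrib_left
      by (subst sum.swap) (simp add: Gsym[of _ d] Vsym[of _ b] mult_ac)
    moreover have "(\<Sum>a\<in>UNIV. V a b a * Y d) = Q1 * Y d"
      by (simp add: Q1_def sum_distrib_right Vsym[of _ b])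
    ultimately show ?thesis
      by (simp add: up sum.distrib sum_subtractf Q4_def)
  qed
  have S5: "(\<Sum>a\<in>UNIV. \<Sum>e\<in>UNIV. K a b e * V e a d) = Q4 + Y b * Q2 - Q6"
    by (simp add: low sum.distrib sum_subtractf Q4_def Q2_def Q6_def sum_distrib_left mult_ac)
  have S6: "(\<Sum>a\<in>UNIV. \<Sum>e\<in>UNIV. K a b e * K e a d) = (n + 2) * Y b * Y d - 2 * G b d * yy p"
  proof -
    have "(\<Sum>a\<in>UNIV. \<Sum>e\<in>UNIV. K a b e * K e a d) = (\<Sum>e\<in>UNIV. Y e * K e b d)
        + Y b * (\<Sum>a\<in>UNIV. K a a d) - (\<Sum>a\<in>UNIV. W a * (\<Sum>e\<in>UNIV. G b e * K e a d))"
      by (simp add: low sum.distrib sum_subtractf sum_distrib_left)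
    moreover have "(\<Sum>e\<in>UNIV. Y e * K e b d) = 2 * Y b * Y d - G b d * yy p"
      by (simp add: up yy)
    moreover have "(\<Sum>a\<in>UNIV. W a * (\<Sum>e\<in>UNIV. G b e * K e a d)) = G b d * yy p"
    proof -
      have "(\<Sum>a\<in>UNIV. W a * (\<Sum>e\<in>UNIV. G b e * K e a d)) =
          (\<Sum>a\<in>UNIV. W a * (G b a * Y d + G b d * Y a - G d a * Y b))"
        by (simp only: up GW Gsym[of _ d])
      also have "\<dots> = (\<Sum>a\<in>UNIV. G b a * W a) * Y d + G b d * (\<Sum>a\<in>UNIV. Y a * W a)
          - (\<Sum>a\<in>UNIV. G d a * W a) * Y b"
        by (simp add: sum_distrib_left sum_distrib_right sum.distrib[symmetric]
            sum_subtractf[symmetric] algebra_simps)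
      finally show ?thesis
        by (simp add: GW yy)
    qed
    ultimately show ?thesis
      by (simp add: tr algebra_simps)
  qed
  have dK: "(\<Sum>a\<in>UNIV. D a (\<lambda>q. C q a b d) p) =
      2 * D b (\<lambda>q. y q d) p - (Q5 + Q6) - G b d * (\<Sum>a\<in>UNIV. D a (\<lambda>q. u q a) p)"
  proof -
    have "D a (\<lambda>q. C q a b d) p = (if a = b then D a (\<lambda>q. y q d) p else 0)
        + (if a = d then D a (\<lambda>q. y q b) p else 0)
        - (G b d * D a (\<lambda>q. u q a) p + D a (\<lambda>q. g i q $ b $ d) p * W a)" for a
      unfolding C_def
      by (simp only: pderiv_diff[OF p] pderiv_add[OF p] pderiv_mult[OF p] pderiv_if
          smooth_add smooth_mult smooth_if smooth_y smooth_u smooth_metric_comp G_def W_def)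
    then have "(\<Sum>a\<in>UNIV. D a (\<lambda>q. C q a b d) p) = D b (\<lambda>q. y q d) p + D d (\<lambda>q. y q b) p
        - G b d * (\<Sum>a\<in>UNIV. D a (\<lambda>q. u q a) p) - (\<Sum>a\<in>UNIV. D a (\<lambda>q. g i q $ b $ d) p * W a)"
      by (simp add: sum.distrib sum_subtractf sum_distrib_left)
    moreover have "(\<Sum>a\<in>UNIV. D a (\<lambda>q. g i q $ b $ d) p * W a) = Q5 + Q6"
      by (simp add: metric_compatible[OF p] Q5_def Q6_def distrib_left sum.distrib mult.commute[of _ "W _"]
          flip: G_def V_def)
    ultimately show ?thesis
      by (simp add: nabla_y_sym[of d b])
  qed
  have dtr: "(\<Sum>a\<in>UNIV. D b (\<lambda>q. C q a a d) p) = n * D b (\<lambda>q. y q d) p"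
  proof -
    have "(\<Sum>a\<in>UNIV. D b (\<lambda>q. C q a a d) p) = D b (\<lambda>q. \<Sum>a\<in>UNIV. C q a a d) p"
      by (simp add: pderiv_sum[OF p] smooth_C)
    also have "\<dots> = D b (\<lambda>q. n * y q d) p"
      by (rule pderiv_cong[OF _ smooth_sum[OF smooth_C] p]) (simp add: C_trace n_def)
    also have "\<dots> = n * D b (\<lambda>q. y q d) p"
      by (rule pderiv_cmult[OF p smooth_y])
    finally show ?thesis .
  qed
  have hatD: "D k (\<lambda>q. christoffel A h i q c a b) p =
      D k (\<lambda>q. \<Gamma> q c a b) p + D k (\<lambda>q. C q c a b) p" for k c a b
  proof -
    have "D k (\<lambda>q. christoffel A h i q c a b) p = D k (\<lambda>q. \<Gamma> q c a b + C q c a b) p"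
      by (rule pderiv_cong[OF _ hat.christoffel_smooth p]) (rule christoffel_rescaled)
    also have "\<dots> = D k (\<lambda>q. \<Gamma> q c a b) p + D k (\<lambda>q. C q c a b) p"
      by (rule pderiv_add[OF p christoffel_smooth smooth_C])
    finally show ?thesis .
  qed
  have ric: "ricci A h i p $ b $ d = ricci A g i p $ b $ d
      + ((\<Sum>a\<in>UNIV. D a (\<lambda>q. C q a b d) p) - (\<Sum>a\<in>UNIV. D b (\<lambda>q. C q a a d) p))
      + (\<Sum>a\<in>UNIV. \<Sum>e\<in>UNIV. V a a e * K e b d) + (\<Sum>a\<in>UNIV. \<Sum>e\<in>UNIV. K a a e * V e b d)
      + (\<Sum>a\<in>UNIV. \<Sum>e\<in>UNIV. K a a e * K e b d) - (\<Sum>a\<in>UNIV. \<Sum>e\<in>UNIV. V a b e * K e a d)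
      - (\<Sum>a\<in>UNIV. \<Sum>e\<in>UNIV. K a b e * V e a d) - (\<Sum>a\<in>UNIV. \<Sum>e\<in>UNIV. K a b e * K e a d)"
    unfolding ricci_def riemann_def hatD christoffel_rescaled[OF p] V_def[symmetric] K_def[symmetric]
    by (simp add: sum.distrib sum_subtractf algebra_simps)
  have ny: "nabla_y p b d = D b (\<lambda>q. y q d) p - Q4"
    by (simp add: nabla_y_def Q4_def V_def Y_def)
  have nu: "(\<Sum>a\<in>UNIV. nabla_u p a a) = (\<Sum>a\<in>UNIV. D a (\<lambda>q. u q a) p) + Q3"
    by (simp add: nabla_u_def Q3_def V_def W_def sum.distrib)
  show ?thesis
    unfolding ric S1 S2 S3 S4 S5 S6 dK dtr ny nu
    by (simp add: algebra_simps flip: n_def Y_def G_def)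
qed

end

end

context conformal_region
begin

text \<open>The right-hand side satisfies the equation \<open>Ric = (d - 2) P + (tr P) g\<close> for the rescaled metric,
  whose only solution is the Schouten tensor.\<close>

lemma schouten_rescaled:
  assumes p: "p \<in> U" "p \<in> chart_dom (A i)" and dim: "CARD('n) \<ge> 3"
  shows "schouten A h i p $ a $ b =
    schouten A g i p $ a $ b - nabla_y p a b + y p a * y p b - yy p / 2 * g i p $ a $ b"
proof -
  define n where "n = real CARD('n)"
  let ?G = "g i p" and ?P = "schouten A g i p"
  define N :: "real^'n^'n" where "N = (\<chi> a b. nabla_y p a b)"
  define Y :: "real^'n^'n" where "Y = (\<chi> a b. y p a * y p b)"
  define P' where "P' = ?P + (- 1) *\<^sub>R N + Y + (- (yy p / 2)) *\<^sub>R ?G"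
  have "metric_trace ?G N = (\<Sum>a\<in>UNIV. nabla_u p a a)"
    by (simp add: metric_trace_def N_def nabla_y_raise[OF p])
  moreover have "metric_trace ?G Y = yy p"
    by (simp add: metric_trace_def Y_def yy_def u_def sum_distrib_left mult_ac)
  moreover have "metric_trace ?G ?G = n"
    unfolding n_def by (rule metric_trace_self[OF metric_invertible[OF p] metric_transpose[OF p]])
  ultimately have tr: "metric_trace ?G P' =
      metric_trace ?G ?P - (\<Sum>a\<in>UNIV. nabla_u p a a) + yy p - yy p / 2 * n"
    unfolding P'_def metric_trace_add metric_trace_scaleR by simp
  have ric: "ricci A g i p = (n - 2) *\<^sub>R ?P + metric_trace ?G ?P *\<^sub>R ?G"
    using schouten_iff[of g i p A ?P, OF metric_invertible[OF p] metric_transpose[OF p] dim]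
    by (simp add: n_def)
  have hat_tr: "metric_trace (h i p) P' *\<^sub>R h i p = metric_trace ?G P' *\<^sub>R ?G"
  proof -
    have "metric_trace (h i p) P' = exp (- 2 * \<omega> p) * metric_trace ?G P'"
      by (simp add: metric_trace_def rescaled_inverse[OF p] sum_distrib_left mult.assoc)
    then have "metric_trace (h i p) P' *\<^sub>R h i p =
        (exp (- 2 * \<omega> p) * exp (2 * \<omega> p) * metric_trace ?G P') *\<^sub>R ?G"
      by (simp add: rescaled[OF p] mult_ac)
    also have "exp (- 2 * \<omega> p) * exp (2 * \<omega> p) = 1"
      by (simp add: exp_add[symmetric])
    finally show ?thesis by simp
  qed
  have "ricci A h i p = (n - 2) *\<^sub>R P' + metric_trace (h i p) P' *\<^sub>R h i p"
    unfolding hat_tr vec_eq_iff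
  proof (intro allI)
    fix b d
    have r: "ricci A g i p $ b $ d = (n - 2) * ?P $ b $ d + metric_trace ?G ?P * ?G $ b $ d"
      by (simp add: ric)
    show "ricci A h i p $ b $ d = ((n - 2) *\<^sub>R P' + metric_trace ?G P' *\<^sub>R ?G) $ b $ d"
      unfolding ricci_rescaled[OF p] r tr
      by (simp add: P'_def N_def Y_def field_simps flip: n_def)
  qed
  then have "schouten A h i p = P'"
    using schouten_iff[of h i p A P', OF hat.metric_invertible[OF p] hat.metric_transpose[OF p] dim]
    by (simp add: n_def)
  then show ?thesis
    by (simp add: P'_def N_def Y_def)
qed

end

context metric_region
begin

lemma normal_tractor_deriv_eq_0_iff:
  "normal_tractor_deriv A g i a X p = 0 \<longleftrightarrow>
    D a (\<lambda>q. fst (X q)) p = fst (snd (X p)) $ a \<and>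
    (\<forall>b. D a (\<lambda>q. (matrix_inv (g i q) *v fst (snd (X q))) $ b) p
      + (\<Sum>c\<in>UNIV. \<Gamma> p b a c * (matrix_inv (g i p) *v fst (snd (X p))) $ c)
      + (if b = a then snd (snd (X p)) else 0)
      + fst (X p) * (\<Sum>c\<in>UNIV. matrix_inv (g i p) $ b $ c * schouten A g i p $ a $ c) = 0) \<and>
    D a (\<lambda>q. snd (snd (X q))) p =
      (\<Sum>c\<in>UNIV. schouten A g i p $ a $ c * (matrix_inv (g i p) *v fst (snd (X p))) $ c)"
  by (simp add: normal_tractor_deriv_def Let_def cov_deriv_def vec_eq_iff inner_vec_def
      axis_def zero_prod_def matrix_vector_mult_def[of _ "schouten A g i p $ a"] eq_commute[of a]
      if_distrib[of "\<lambda>x. _ * x"] cong: if_cong)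

end

context conformal_region
begin

text \<open>The conformal invariance of the normal tractor connection, for parallel sections. The
  derivatives of the rescaled components produce terms with \<open>\<nabla>y\<close>, which cancel against the change
  of the Schouten tensor, and terms with \<open>y\<close>, which cancel against the change of the Christoffel
  symbols and the quadratic terms in the change of the Schouten tensor. In the proof \<open>v\<close> is the
  middle component with its index raised and \<open>ym\<close> its pairing with \<open>\<Upsilon>\<close>.\<close>

lemma parallel_rescaled:
  assumes p: "p \<in> U" "p \<in> chart_dom (A i)" and dim: "CARD('n) \<ge> 3"
    and X: "smooth X" and par: "\<And>a. normal_tractor_deriv A g i a X p = 0"
  shows "normal_tractor_deriv A h i a (\<lambda>q. scale_change A g \<omega> i q (X q)) p = 0"
proof -
  define s where "s q = fst (X q)" for q
  define m where "m q = fst (snd (X q))" for q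
  define r where "r q = snd (snd (X q))" for q
  define v where "v q b = (matrix_inv (g i q) *v m q) $ b" for q b
  define ym where "ym q = (\<Sum>c\<in>UNIV. y q c * v q c)" for q
  define P where "P a b = schouten A g i p $ a $ b" for a b
  let ?H = "matrix_inv (g i p)"
  have sm: "smooth s" "smooth m" "smooth r"
    using X unfolding s_def m_def r_def by (intro smooth_fst smooth_snd; assumption)+
  have sv: "smooth (\<lambda>q. v q b)" for b
    unfolding v_def by (intro smooth_nth smooth_matrix_vector_mult smooth_inverse_metric sm)
  have sym: "smooth ym"
    unfolding ym_def by (intro smooth_sum smooth_mult smooth_y sv)
  have syy: "smooth yy"
    unfolding yy_def by (intro smooth_sum smooth_mult smooth_y smooth_u)
  have se: "smooth (\<lambda>q. exp (- \<omega> q))" "smooth (\<lambda>q. exp (\<omega> q))"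
    by (intro smooth_exp smooth_minus smooth_factor)+
  have pe: "D a (\<lambda>q. exp (- \<omega> q)) p = - (exp (- \<omega> p) * y p a)"
    "D a (\<lambda>q. exp (\<omega> q)) p = exp (\<omega> p) * y p a"
    by (simp_all add: pderiv_exp[OF p] pderiv_minus[OF p] smooth_minus smooth_factor y_def)
  have eqs: "D a s p = m p $ a \<and>
    (\<forall>b. D a (\<lambda>q. v q b) p + (\<Sum>c\<in>UNIV. \<Gamma> p b a c * v p c) + (if b = a then r p else 0)
      + s p * (\<Sum>c\<in>UNIV. ?H $ b $ c * P a c) = 0) \<and>
    D a r p = (\<Sum>c\<in>UNIV. P a c * v p c)"
    unfolding s_def[abs_def] m_def r_def[abs_def] v_def P_def
    by (rule par[of a, unfolded normal_tractor_deriv_eq_0_iff])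
  have e1: "D a s p = m p $ a" and e3: "D a r p = (\<Sum>c\<in>UNIV. P a c * v p c)"
    using eqs by auto
  have e2: "D a (\<lambda>q. v q b) p = - (\<Sum>c\<in>UNIV. \<Gamma> p b a c * v p c) - (if b = a then r p else 0)
      - s p * (\<Sum>c\<in>UNIV. ?H $ b $ c * P a c)" for b
    using eqs[THEN conjunct2, THEN conjunct1, rule_format, of b] by linarith
  have Gv: "(\<Sum>c\<in>UNIV. g i p $ a $ c * v p c) = m p $ a" for a
  proof -
    have "(\<Sum>c\<in>UNIV. g i p $ a $ c * v p c) = (g i p *v (?H *v m p)) $ a"
      by (simp add: v_def matrix_vector_mult_def)
    then show ?thesis
      by (simp add: matrix_vector_mul_assoc matrix_inv_inverse[OF metric_invertible[OF p]])
  qed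
  have up: "(\<chi> c. u q c) = matrix_inv (g i q) *v (\<chi> b. y q b)" for q
    by (simp add: matrix_vector_mult_def u_def)
  have dot1: "(\<chi> c. u q c) \<bullet> (\<chi> b. y q b) = yy q" for q
    by (simp add: inner_vec_def yy_def mult.commute)
  have dot2: "(\<chi> c. u q c) \<bullet> m q = ym q" if q: "q \<in> U" "q \<in> chart_dom (A i)" for q
  proof -
    have "(\<chi> c. u q c) \<bullet> m q = (\<chi> b. y q b) \<bullet> (matrix_inv (g i q) *v m q)"
      unfolding up by (metis inverse_metric_transpose[OF q] dot_lmul_matrix
          transpose_matrix_vector inner_commute)
    then show ?thesis
      by (simp add: inner_vec_def ym_def v_def)
  qed
  let ?Z = "\<lambda>q. scale_change A g \<omega> i q (X q)"
  have Z: "fst (?Z q) = exp (\<omega> q) * s q"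
    "fst (snd (?Z q)) = exp (\<omega> q) *\<^sub>R (m q + s q *\<^sub>R (\<chi> b. y q b))" for q
    by (simp_all add: scale_change_def Let_def case_prod_beta s_def m_def y_def)
  have Zr: "snd (snd (?Z q)) = exp (- \<omega> q) * (r q - ym q - s q * (yy q / 2))"
    if "q \<in> U" "q \<in> chart_dom (A i)" for q
    using dot1[of q] dot2[OF that] unfolding up
    by (simp add: scale_change_def Let_def case_prod_beta s_def m_def r_def y_def[abs_def])
  have Zv: "(matrix_inv (h i q) *v fst (snd (?Z q))) $ b = exp (- \<omega> q) * (v q b + s q * u q b)"
    if q: "q \<in> U" "q \<in> chart_dom (A i)" for q b
  proof -
    have e: "exp (- 2 * \<omega> q) * exp (\<omega> q) = exp (- \<omega> q)"
      by (simp add: exp_add[symmetric])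
    have "matrix_inv (h i q) *v fst (snd (?Z q)) =
        exp (- 2 * \<omega> q) *\<^sub>R exp (\<omega> q) *\<^sub>R (matrix_inv (g i q) *v m q + s q *\<^sub>R (\<chi> c. u q c))"
      unfolding Z up rescaled_inverse[OF q]
      by (simp add: scaleR_matrix_vector_assoc[symmetric] matrix_vector_right_distrib
          matrix_vector_mult_scaleR scaleR_add_right mult_ac)
    then show ?thesis
      by (simp add: v_def e del: scaleR_scaleR flip: e)
  qed
  \<comment> \<open>The equations of the rescaled field for its three slots are \<open>d1\<close>, \<open>d2\<close> and \<open>d3\<close>.\<close>
  have d1: "D a (\<lambda>q. fst (?Z q)) p = fst (snd (?Z p)) $ a"
    unfolding Z
    by (simp add: pderiv_mult[OF p] se sm pe e1 algebra_simps)
  have dq: "D a (\<lambda>q. exp (- \<omega> q) * (v q b + s q * u q b)) p = exp (- \<omega> p) *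
      (D a (\<lambda>q. v q b) p + m p $ a * u p b + s p * D a (\<lambda>q. u q b) p - y p a * (v p b + s p * u p b))"
    for b
    by (simp add: pderiv_mult[OF p] pderiv_add[OF p] smooth_add smooth_mult se sm sv smooth_u pe e1
        algebra_simps)
  have yv: "(\<Sum>c\<in>UNIV. y p c * (v p c + s p * u p c)) = ym p + s p * yy p"
    by (simp add: ym_def yy_def distrib_left sum.distrib sum_distrib_left mult_ac)
  have Gq: "(\<Sum>c\<in>UNIV. g i p $ a $ c * (v p c + s p * u p c)) = m p $ a + s p * y p a"
  proof -
    have "(\<Sum>c\<in>UNIV. g i p $ a $ c * (v p c + s p * u p c)) =
        (\<Sum>c\<in>UNIV. g i p $ a $ c * v p c) + s p * (\<Sum>c\<in>UNIV. g i p $ a $ c * u p c)"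
      by (simp add: distrib_left sum.distrib sum_distrib_left mult_ac)
    then show ?thesis by (simp add: Gv lower_u[OF p])
  qed
  have hatP: "schouten A h i p $ a $ c = P a c - nabla_y p a c + y p a * y p c - yy p / 2 * g i p $ a $ c"
    for c
    unfolding P_def by (rule schouten_rescaled[OF p dim])
  have HP: "(\<Sum>c\<in>UNIV. ?H $ b $ c * schouten A h i p $ a $ c) = (\<Sum>c\<in>UNIV. ?H $ b $ c * P a c)
      - nabla_u p a b + y p a * u p b - (if b = a then yy p / 2 else 0)" for b
  proof -
    have "(\<Sum>c\<in>UNIV. ?H $ b $ c * schouten A h i p $ a $ c) = (\<Sum>c\<in>UNIV. ?H $ b $ c * P a c)
        - (\<Sum>c\<in>UNIV. ?H $ b $ c * nabla_y p a c) + y p a * (\<Sum>c\<in>UNIV. ?H $ b $ c * y p c)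
        - yy p / 2 * (\<Sum>c\<in>UNIV. ?H $ b $ c * g i p $ c $ a)"
      unfolding hatP by (simp add: sum_distrib_left sum.distrib[symmetric] sum_subtractf[symmetric]
          algebra_simps metric_sym[OF p, of a])
    then show ?thesis
      by (simp add: nabla_y_raise[OF p] u_def metric_inverse_metric[OF p])
  qed
  have d2: "D a (\<lambda>q. (matrix_inv (h i q) *v fst (snd (?Z q))) $ b) p
      + (\<Sum>c\<in>UNIV. christoffel A h i p b a c * (matrix_inv (h i p) *v fst (snd (?Z p))) $ c)
      + (if b = a then snd (snd (?Z p)) else 0)
      + fst (?Z p) * (\<Sum>c\<in>UNIV. matrix_inv (h i p) $ b $ c * schouten A h i p $ a $ c) = 0" for b
  proof -
    define E where "E = exp (- \<omega> p)"
    have "D a (\<lambda>q. (matrix_inv (h i q) *v fst (snd (?Z q))) $ b) p =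
        D a (\<lambda>q. exp (- \<omega> q) * (v q b + s q * u q b)) p"
      by (rule pderiv_cong[OF _ _ p, symmetric])
        (auto simp: Zv intro!: smooth_mult smooth_add se sv sm smooth_u)
    then have t1: "D a (\<lambda>q. (matrix_inv (h i q) *v fst (snd (?Z q))) $ b) p = E *
      (D a (\<lambda>q. v q b) p + m p $ a * u p b + s p * D a (\<lambda>q. u q b) p - y p a * (v p b + s p * u p b))"
      by (simp add: dq E_def)
    have "(\<Sum>c\<in>UNIV. christoffel A h i p b a c * (matrix_inv (h i p) *v fst (snd (?Z p))) $ c) =
        E * ((\<Sum>c\<in>UNIV. \<Gamma> p b a c * (v p c + s p * u p c))
          + (\<Sum>c\<in>UNIV. C p b a c * (v p c + s p * u p c)))"
      by (simp add: Zv[OF p] christoffel_rescaled[OF p] E_def sum_distrib_left sum.distrib[symmetric]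
          algebra_simps)
    also have "(\<Sum>c\<in>UNIV. C p b a c * (v p c + s p * u p c)) =
        (if b = a then ym p + s p * yy p else 0) + y p a * (v p b + s p * u p b)
        - u p b * (m p $ a + s p * y p a)"
      unfolding C_contract_lower[OF p] yv Gq ..
    also have "(\<Sum>c\<in>UNIV. \<Gamma> p b a c * (v p c + s p * u p c)) =
        (\<Sum>c\<in>UNIV. \<Gamma> p b a c * v p c) + s p * (\<Sum>c\<in>UNIV. \<Gamma> p b a c * u p c)"
      by (simp add: distrib_left sum.distrib sum_distrib_left mult_ac)
    finally have t2: "(\<Sum>c\<in>UNIV. christoffel A h i p b a c *
          (matrix_inv (h i p) *v fst (snd (?Z p))) $ c) =
        E * ((\<Sum>c\<in>UNIV. \<Gamma> p b a c * v p c) + s p * (\<Sum>c\<in>UNIV. \<Gamma> p b a c * u p c)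
        + ((if b = a then ym p + s p * yy p else 0) + y p a * (v p b + s p * u p b)
        - u p b * (m p $ a + s p * y p a)))" .
    have e: "exp (\<omega> p) * exp (- 2 * \<omega> p) = E"
      by (simp add: E_def exp_add[symmetric])
    have "fst (?Z p) * (\<Sum>c\<in>UNIV. matrix_inv (h i p) $ b $ c * schouten A h i p $ a $ c) =
        (exp (\<omega> p) * exp (- 2 * \<omega> p)) * (s p * (\<Sum>c\<in>UNIV. ?H $ b $ c * schouten A h i p $ a $ c))"
      by (simp add: Z rescaled_inverse[OF p] sum_distrib_left mult_ac)
    then have t4: "fst (?Z p) * (\<Sum>c\<in>UNIV. matrix_inv (h i p) $ b $ c * schouten A h i p $ a $ c) =
        E * (s p * ((\<Sum>c\<in>UNIV. ?H $ b $ c * P a c)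
      - nabla_u p a b + y p a * u p b - (if b = a then yy p / 2 else 0)))"
      by (simp only: e HP)
    show ?thesis
      unfolding t1 t2 t4 Zr[OF p] e2 nabla_u_def E_def[symmetric]
      by (simp add: algebra_simps)
  qed
  have ny: "D a (\<lambda>q. y q c) p = nabla_y p a c + (\<Sum>e\<in>UNIV. \<Gamma> p e a c * y p e)" for c
    by (simp add: nabla_y_def)
  have nu: "D a (\<lambda>q. u q c) p = nabla_u p a c - (\<Sum>e\<in>UNIV. \<Gamma> p c a e * u p e)" for c
    by (simp add: nabla_u_def)
  \<comment> \<open>The Christoffel symbols in \<open>\<nabla>y\<close> and in \<open>\<nabla>u\<close> cancel when a covector is paired with a vector.\<close>
  have swap: "(\<Sum>c\<in>UNIV. (\<Sum>e\<in>UNIV. \<Gamma> p e a c * y p e) * w c) =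
      (\<Sum>c\<in>UNIV. y p c * (\<Sum>e\<in>UNIV. \<Gamma> p c a e * w e))" for w
    by (simp add: sum_distrib_left sum_distrib_right) (subst sum.swap, simp add: mult_ac)
  define yv where "yv = (\<Sum>c\<in>UNIV. nabla_y p a c * v p c)"
  define yu where "yu = (\<Sum>c\<in>UNIV. nabla_y p a c * u p c)"
  define Pu where "Pu = (\<Sum>c\<in>UNIV. P a c * u p c)"
  have dyy: "D a yy p = 2 * yu"
  proof -
    have "D a yy p = (\<Sum>c\<in>UNIV. y p c * D a (\<lambda>q. u q c) p) + (\<Sum>c\<in>UNIV. D a (\<lambda>q. y q c) p * u p c)"
      unfolding yy_def[abs_def]
      by (simp add: pderiv_sum[OF p] pderiv_mult[OF p] smooth_mult smooth_y smooth_u sum.distrib)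
    also have "\<dots> = (\<Sum>c\<in>UNIV. y p c * nabla_u p a c) + yu"
      unfolding ny nu
      by (simp add: right_diff_distrib distrib_right sum.distrib sum_subtractf swap yu_def)
    also have "(\<Sum>c\<in>UNIV. y p c * nabla_u p a c) = yu"
    proof -
      have "yu = (\<Sum>d\<in>UNIV. (\<Sum>c\<in>UNIV. g i p $ d $ c * u p c) * nabla_u p a d)"
        unfolding yu_def nabla_y_lower[OF p] sum_distrib_right
        by (subst sum.swap) (simp add: metric_sym[OF p] mult_ac)
      then show ?thesis by (simp add: lower_u[OF p])
    qed
    finally show ?thesis by simp
  qed
  have dym: "D a ym p = yv - r p * y p a - s p * Pu"
  proof -
    have "D a ym p = (\<Sum>c\<in>UNIV. y p c * D a (\<lambda>q. v q c) p) + (\<Sum>c\<in>UNIV. D a (\<lambda>q. y q c) p * v p c)"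
      unfolding ym_def[abs_def]
      by (simp add: pderiv_sum[OF p] pderiv_mult[OF p] smooth_mult smooth_y sv sum.distrib)
    also have "\<dots> = yv - (\<Sum>c\<in>UNIV. if c = a then y p c * r p else 0)
        - s p * (\<Sum>c\<in>UNIV. y p c * (\<Sum>d\<in>UNIV. ?H $ c $ d * P a d))"
      unfolding ny e2
      by (simp add: right_diff_distrib distrib_right sum.distrib sum_subtractf sum_negf swap yv_def
          if_distrib[of "\<lambda>x. _ * x"] sum_distrib_left mult.left_commute[of "s p"] cong: if_cong)
    also have "(\<Sum>c\<in>UNIV. y p c * (\<Sum>d\<in>UNIV. ?H $ c $ d * P a d)) = Pu"
      unfolding Pu_def u_def sum_distrib_left
      by (subst sum.swap) (simp add: inverse_metric_sym[OF p] mult_ac)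
    finally show ?thesis by (simp add: mult.commute)
  qed
  have d3: "D a (\<lambda>q. snd (snd (?Z q))) p =
      (\<Sum>c\<in>UNIV. schouten A h i p $ a $ c * (matrix_inv (h i p) *v fst (snd (?Z p))) $ c)"
  proof -
    have "D a (\<lambda>q. snd (snd (?Z q))) p = D a (\<lambda>q. exp (- \<omega> q) * (r q - ym q - s q * (yy q / 2))) p"
      by (rule pderiv_cong[OF _ _ p, symmetric])
        (auto simp: Zr intro!: smooth_mult smooth_diff se sm sym smooth_divide syy smooth_const)
    also have "\<dots> = exp (- \<omega> p) * (D a r p - D a ym p - m p $ a * (yy p / 2) - s p * yu
        - y p a * (r p - ym p - s p * (yy p / 2)))"
    proof -
      have "D a (\<lambda>q. s q * (1 / 2 * yy q)) p = s p * yu + m p $ a * (1 / 2 * yy p)"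
        by (subst pderiv_mult[OF p], simp_all only: sm smooth_mult smooth_const syy
            pderiv_cmult[OF p syy] e1 dyy)
      then have "D a (\<lambda>q. s q * (yy q / 2)) p = s p * yu + m p $ a * (yy p / 2)"
        by simp
      moreover have z: "smooth (\<lambda>q. s q * (yy q / 2))"
        by (intro smooth_mult sm smooth_divide syy smooth_const) simp
      moreover have "D a (\<lambda>q. r q - ym q - s q * (yy q / 2)) p =
          D a r p - D a ym p - D a (\<lambda>q. s q * (yy q / 2)) p"
        by (simp only: pderiv_diff[OF p] smooth_diff sm sym z)
      ultimately have "D a (\<lambda>q. r q - ym q - s q * (yy q / 2)) p =
          D a r p - D a ym p - (s p * yu + m p $ a * (yy p / 2))" by simp
      then show ?thesis
        by (subst pderiv_mult[OF p se(1)]) (simp_all only: smooth_diff sm sym z pe, simp add: algebra_simps)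
    qed
    also have "\<dots> = exp (- \<omega> p) * ((\<Sum>c\<in>UNIV. P a c * v p c) - yv + s p * Pu - s p * yu
        + y p a * ym p + y p a * s p * yy p - yy p / 2 * (m p $ a + s p * y p a))"
      unfolding e3 dym by (simp add: algebra_simps)
    also have "(\<Sum>c\<in>UNIV. P a c * v p c) - yv + s p * Pu - s p * yu
        + y p a * ym p + y p a * s p * yy p - yy p / 2 * (m p $ a + s p * y p a) =
        (\<Sum>c\<in>UNIV. schouten A h i p $ a $ c * (v p c + s p * u p c))"
    proof -
      have "(\<Sum>c\<in>UNIV. schouten A h i p $ a $ c * (v p c + s p * u p c)) =
          (\<Sum>c\<in>UNIV. P a c * v p c) + s p * Pu - (yv + s p * yu)
          + y p a * (\<Sum>c\<in>UNIV. y p c * (v p c + s p * u p c))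
          - yy p / 2 * (\<Sum>c\<in>UNIV. g i p $ a $ c * (v p c + s p * u p c))"
        unfolding hatP Pu_def yv_def yu_def
        by (simp add: sum_distrib_left sum.distrib[symmetric] sum_subtractf[symmetric]
            algebra_simps add_divide_distrib)
      then show ?thesis
        unfolding Gq \<open>(\<Sum>c\<in>UNIV. y p c * (v p c + s p * u p c)) = ym p + s p * yy p\<close>
        by (simp add: algebra_simps)
    qed
    finally show ?thesis
      by (simp add: Zv[OF p] sum_distrib_left mult_ac)
  qed
  show ?thesis
    unfolding hat.normal_tractor_deriv_eq_0_iff using d1 d2 d3 by blast
qed

end

section \<open>Parallel standard tractors in one scale\<close>

lemma scale_change_linear:
  "scale_change A g \<omega> i p (x + x') = scale_change A g \<omega> i p x + scale_change A g \<omega> i p x'"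
  "scale_change A g \<omega> i p (x - x') = scale_change A g \<omega> i p x - scale_change A g \<omega> i p x'"
  "scale_change A g \<omega> i p 0 = 0"
  by (simp_all add: scale_change_def Let_def case_prod_beta prod_eq_iff algebra_simps diff_divide_distrib
      add_divide_distrib inner_add_right inner_diff_right)

text \<open>Raising an index commutes with a change of coordinates: \<open>J (J\<^sup>T G J)\<^sup>-\<^sup>1 J\<^sup>T = G\<^sup>-\<^sup>1\<close>.\<close>

lemma raise_index_transform:
  fixes J G :: "real^'n^'n"
  assumes "invertible G" "invertible (transpose J ** G ** J)"
  shows "J *v (matrix_inv (transpose J ** G ** J) *v (transpose J *v \<xi>)) = matrix_inv G *v \<xi>"
proof -
  let ?K = "transpose J ** G ** J"
  define w where "w = matrix_inv ?K *v (transpose J *v \<xi>)"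
  have "invertible J"
    using assms(2) by (metis invertible_det_nz det_mul mult_zero_right)
  then have J: "invertible (transpose J)"
    by (simp add: invertible_det_nz det_transpose)
  have "?K *v w = transpose J *v \<xi>"
    unfolding w_def by (simp add: matrix_vector_mul_assoc matrix_mul_assoc[symmetric]
        matrix_inv_inverse[OF assms(2), simplified matrix_mul_assoc[symmetric]])
  then have "transpose J *v (G *v (J *v w)) = transpose J *v \<xi>"
    by (simp add: matrix_vector_mul_assoc matrix_mul_assoc)
  then have "matrix_inv (transpose J) *v (transpose J *v (G *v (J *v w))) =
      matrix_inv (transpose J) *v (transpose J *v \<xi>)" by simp
  then have "G *v (J *v w) = \<xi>"
    by (simp only: matrix_vector_mul_assoc matrix_mul_assoc matrix_inv_inverse[OF J]
        matrix_vector_mul_lid matrix_mul_lid)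
  then have "matrix_inv G *v (G *v (J *v w)) = matrix_inv G *v \<xi>" by simp
  then show ?thesis
    by (simp only: matrix_vector_mul_assoc[of "matrix_inv G"] matrix_inv_inverse[OF assms(1)]
        matrix_vector_mul_lid w_def)
qed

context conformal_region
begin

lemma smooth_scale_change:
  assumes "smooth X"
  shows "smooth (\<lambda>q. scale_change A g \<omega> i q (X q))"
proof -
  have sY: "smooth (\<lambda>q. \<chi> b. D b \<omega> q)"
    by (intro smooth_vec smooth_pderiv smooth_factor)
  note sm = smooth_fst[OF assms] smooth_fst[OF smooth_snd[OF assms]] smooth_snd[OF smooth_snd[OF assms]]
  have "smooth (\<lambda>q. (exp (\<omega> q) * fst (X q),
      exp (\<omega> q) *\<^sub>R (fst (snd (X q)) + fst (X q) *\<^sub>R (\<chi> b. D b \<omega> q)),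
      exp (- \<omega> q) * (snd (snd (X q)) - (matrix_inv (g i q) *v (\<chi> b. D b \<omega> q)) \<bullet> fst (snd (X q))
        - fst (X q) * ((matrix_inv (g i q) *v (\<chi> b. D b \<omega> q)) \<bullet> (\<chi> b. D b \<omega> q)) / 2)))"
    by (intro smooth_Pair smooth_mult smooth_scaleR smooth_add smooth_diff smooth_divide smooth_inner
        smooth_matrix_vector_mult smooth_exp smooth_minus smooth_const smooth_inverse_metric
        smooth_factor sY sm) simp
  then show ?thesis
    by (simp add: scale_change_def Let_def case_prod_beta)
qed

text \<open>The one-forms \<open>\<Upsilon>\<close> of two successive rescalings add up. The mixed term of \<open>|\<Upsilon> + \<Upsilon>'|\<^sup>2\<close> arises from
  applying the second scale change to the middle component \<open>\<mu> + \<sigma>\<Upsilon>\<close>.\<close>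

lemma scale_change_trans:
  assumes p: "p \<in> U" "p \<in> chart_dom (A i)" and \<eta>: "smooth \<eta>"
  shows "scale_change A h \<eta> i p (scale_change A g \<omega> i p x) =
    scale_change A g (\<lambda>q. \<omega> q + \<eta> q) i p x"
proof -
  obtain s m r where x: "x = (s, m, r)" by (cases x)
  define H where "H = matrix_inv (g i p)"
  define Y where "Y = (\<chi> b. D b \<omega> p)"
  define Y' where "Y' = (\<chi> b. D b \<eta> p)"
  have sum: "(\<chi> b. D b (\<lambda>q. \<omega> q + \<eta> q) p) = Y + Y'"
    by (simp add: Y_def Y'_def vec_eq_iff pderiv_add[OF p smooth_factor \<eta>])
  have sym: "(H *v Y) \<bullet> Y' = (H *v Y') \<bullet> Y"
    unfolding H_def by (metis inverse_metric_transpose[OF p] dot_lmul_matrix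
        transpose_matrix_vector inner_commute)
  define E where "E = exp (\<omega> p)" define F where "F = exp (\<eta> p)"
  define E' where "E' = exp (- \<omega> p)" define F' where "F' = exp (- \<eta> p)"
  have EE: "exp (- 2 * \<omega> p) * E = E'"
    by (simp add: E_def E'_def exp_add[symmetric])
  have hat: "matrix_inv (h i p) *v Y' = exp (- 2 * \<omega> p) *\<^sub>R (H *v Y')"
    by (simp add: rescaled_inverse[OF p] H_def scaleR_matrix_vector_assoc[symmetric])
  have e: "exp (\<omega> p + \<eta> p) = E * F" "exp (- (\<omega> p + \<eta> p)) = E' * F'"
    by (simp_all add: E_def F_def E'_def F'_def exp_add[symmetric])
  have "scale_change A h \<eta> i p (scale_change A g \<omega> i p x) =
      (F * (E * s), F *\<^sub>R (E *\<^sub>R (m + s *\<^sub>R Y) + (E * s) *\<^sub>R Y'),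
       F' * (E' * (r - (H *v Y) \<bullet> m - s * ((H *v Y) \<bullet> Y) / 2)
         - (exp (- 2 * \<omega> p) * E) * ((H *v Y') \<bullet> (m + s *\<^sub>R Y))
         - (exp (- 2 * \<omega> p) * E) * s * ((H *v Y') \<bullet> Y') / 2))"
    by (simp add: scale_change_def Let_def x hat flip: E_def F_def E'_def F'_def H_def Y_def Y'_def)
  also have "\<dots> = (E * F * s, (E * F) *\<^sub>R (m + s *\<^sub>R (Y + Y')),
       (E' * F') * (r - (H *v (Y + Y')) \<bullet> m - s * ((H *v (Y + Y')) \<bullet> (Y + Y')) / 2))"
    unfolding EE matrix_vector_right_distrib inner_add_left inner_add_right sym
    by (simp add: algebra_simps add_divide_distrib inner_commute)
  also have "\<dots> = scale_change A g (\<lambda>q. \<omega> q + \<eta> q) i p x"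
    unfolding scale_change_def Let_def x split_conv sum e H_def[symmetric] ..
  finally show ?thesis .
qed

end

locale riemannian_manifold =
  fixes A :: "('i, 'a::{second_countable_topology, t2_space}, 'n::finite) atlas"
    and g :: "('i, 'a, 'n) metric_comps"
  assumes manifold: "smooth_manifold A" and metric: "riemannian_metric A g"
begin

lemma charts: "is_chart (A i)" "\<exists>i. p \<in> chart_dom (A i)" "connected (UNIV :: 'a set)"
  using manifold by (auto simp: smooth_manifold_def)

lemma region: "open U \<Longrightarrow> metric_region A i U g"
  by (rule riemannian_metric_region[OF manifold metric])

lemma conformal: "open U \<Longrightarrow> conformal_rescaling A g \<omega> h \<Longrightarrow> conformal_region A i U g \<omega> h"
  by (simp add: conformal_region_def conformal_region_axioms_def region conformal_rescaling_def
      smooth_in_chart_subset[of "A i" UNIV \<omega> U])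

lemma metric_transform:
  assumes "p \<in> chart_dom (A i)" "p \<in> chart_dom (A j)"
  shows "g i p = transpose (chart_jacobian (A i) (A j) p) ** g j p ** chart_jacobian (A i) (A j) p"
  using metric assms unfolding riemannian_metric_def by blast

lemma invertible_metric: "p \<in> chart_dom (A i) \<Longrightarrow> invertible (g i p)"
  using metric_region.metric_invertible[OF region[OF open_UNIV]] by blast

lemma raise_transform:
  assumes "p \<in> chart_dom (A i)" "p \<in> chart_dom (A j)"
  shows "chart_jacobian (A i) (A j) p *v
      (matrix_inv (g i p) *v (transpose (chart_jacobian (A i) (A j) p) *v \<xi>)) =
    matrix_inv (g j p) *v \<xi>"
  using raise_index_transform[OF invertible_metric[OF assms(2)],
      of "chart_jacobian (A i) (A j) p"] invertible_metric[OF assms(1)]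
  by (simp flip: metric_transform[OF assms])

lemma transition_derivative:
  assumes "p \<in> chart_dom (A i)" "p \<in> chart_dom (A j)"
  shows "((\<lambda>x. coords (A j) (chart_inv (A i) x)) has_derivative
    (\<lambda>v. chart_jacobian (A i) (A j) p *v v)) (at (coords (A i) p))"
proof -
  have "smooth_on (coords (A i) ` (chart_dom (A i) \<inter> chart_dom (A j)))
      (\<lambda>x. coords (A j) (chart_inv (A i) x))"
    using manifold by (simp add: smooth_manifold_def)
  from smooth_on_differentiable[OF this, of "coords (A i) p"] assms show ?thesis
    by (simp add: chart_jacobian_def jacobian_works[symmetric])
qed

lemma gradient_transform:
  fixes \<omega> :: "'a \<Rightarrow> real"
  assumes p: "p \<in> chart_dom (A i)" "p \<in> chart_dom (A j)"
    and sm: "smooth_in_chart (A j) UNIV \<omega>"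
  shows "(\<chi> b. pderiv_chart (A i) b \<omega> p) =
    transpose (chart_jacobian (A i) (A j) p) *v (\<chi> b. pderiv_chart (A j) b \<omega> p)"
proof -
  let ?J = "chart_jacobian (A i) (A j) p" and ?x = "coords (A i) p"
  let ?F = "\<lambda>x. \<omega> (chart_inv (A j) x)"
  interpret ch: chart_region "A j" UNIV
    by standard (use charts in auto)
  let ?S = "coords (A i) ` (chart_dom (A j) \<inter> chart_dom (A i))"
  have S: "open ?S"
    by (intro is_chartD(3) charts is_chartD(1))
  have x: "?x \<in> ?S" using p by auto
  have "coords (A j) (chart_inv (A i) ?x) = coords (A j) p"
    using p by (simp add: is_chartD(2)[OF charts(1)])
  then have "((\<lambda>x. ?F (coords (A j) (chart_inv (A i) x))) has_derivative
      (\<lambda>v. frechet_derivative ?F (at (coords (A j) p)) (?J *v v))) (at ?x)"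
    using has_derivative_compose[OF transition_derivative[OF p], of ?F
        "frechet_derivative ?F (at (coords (A j) p))"]
      ch.has_derivative_in_chart[OF sm _ p(2)] by simp
  then have "((\<lambda>x. \<omega> (chart_inv (A i) x)) has_derivative
      (\<lambda>v. frechet_derivative ?F (at (coords (A j) p)) (?J *v v))) (at ?x)"
    by (rule has_derivative_transform_within_open[OF _ S x])
      (auto simp: is_chartD(2)[OF charts(1)])
  from pderiv_chart_eqI[OF this] show ?thesis
    unfolding vec_eq_iff ch.frechet_derivative_in_chart[OF UNIV_I p(2) sm] matrix_vector_mult_basis
    by (simp add: column_def vector_matrix_mult_def mult.commute)
qed

text \<open>The formula for the change of scale consists of tensorial operations, and so it is compatible
  with a change of coordinates.\<close>

lemma scale_change_transform:
  assumes p: "p \<in> chart_dom (A i)" "p \<in> chart_dom (A j)"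
    and sm: "smooth_in_chart (A j) UNIV \<omega>"
    and x: "x = (case x' of (\<sigma>, \<mu>, \<rho>) \<Rightarrow> (\<sigma>, transpose (chart_jacobian (A i) (A j) p) *v \<mu>, \<rho>))"
  shows "scale_change A g \<omega> i p x = (case scale_change A g \<omega> j p x' of (\<sigma>, \<mu>, \<rho>) \<Rightarrow>
    (\<sigma>, transpose (chart_jacobian (A i) (A j) p) *v \<mu>, \<rho>))"
proof -
  obtain s m r where x': "x' = (s, m, r)" by (cases x')
  let ?J = "chart_jacobian (A i) (A j) p"
  define Y where "Y = (\<chi> b. pderiv_chart (A j) b \<omega> p)"
  have Y: "(\<chi> b. pderiv_chart (A i) b \<omega> p) = transpose ?J *v Y"
    unfolding Y_def by (rule gradient_transform[OF p sm])
  have "(matrix_inv (g i p) *v (transpose ?J *v Y)) \<bullet> (transpose ?J *v \<xi>) =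
      (matrix_inv (g j p) *v Y) \<bullet> \<xi>" for \<xi>
  proof -
    have "w \<bullet> (transpose ?J *v \<xi>) = (?J *v w) \<bullet> \<xi>" for w
      using dot_lmul_matrix[of \<xi> ?J w] by (simp add: inner_commute)
    then show ?thesis
      by (simp only: raise_transform[OF p])
  qed
  then show ?thesis
    by (simp add: scale_change_def Let_def x x' Y Y_def[symmetric] matrix_vector_right_distrib
        matrix_vector_mult_scaleR del: transpose_matrix_vector)
qed

lemma conformal_class_self: "conformal_rescaling A g (\<lambda>_. 0) g" "g \<in> conformal_class A g"
proof -
  have "smooth_in_chart (A i) UNIV (\<lambda>_. 0::real)" for i
    by (rule chart_region.smooth_const) (simp add: chart_region_def charts)
  then show "conformal_rescaling A g (\<lambda>_. 0) g"
    by (simp add: conformal_rescaling_def)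
  then show "g \<in> conformal_class A g"
    by (auto simp: conformal_class_def)
qed

lemma conformal_factor_unique:
  assumes "conformal_rescaling A g \<omega> h" "conformal_rescaling A g \<eta> h"
  shows "\<omega> = \<eta>"
proof
  fix p
  obtain i where p: "p \<in> chart_dom (A i)" using charts(2) by blast
  have "exp (2 * \<omega> p) *\<^sub>R g i p = exp (2 * \<eta> p) *\<^sub>R g i p"
    using assms p by (auto simp: conformal_rescaling_def)
  moreover have "g i p \<noteq> 0"
  proof
    assume "g i p = 0"
    with matrix_inv_inverse(1)[OF invertible_metric[OF p]]
    have "(mat 1 :: real^'n^'n) = 0" by (simp add: matrix_matrix_mult_def vec_eq_iff)
    then have "(mat 1 :: real^'n^'n) $ k $ k = 0" for k
      by (simp only: zero_index)
    then show False
      by (simp add: mat_def)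
  qed
  ultimately show "\<omega> p = \<eta> p" by simp
qed

text \<open>The data of a parallel standard tractor in the scale \<open>g\<close> alone.\<close>

definition parallel_in_scale :: "'a set \<Rightarrow> ('i, 'a, 'n) triple_field \<Rightarrow> bool" where
  "parallel_in_scale U X \<longleftrightarrow>
    (\<forall>i. smooth_in_chart (A i) U (X i)) \<and>
    (\<forall>i j. \<forall>p\<in>U \<inter> chart_dom (A i) \<inter> chart_dom (A j). X i p = (case X j p of (\<sigma>, \<mu>, \<rho>) \<Rightarrow>
      (\<sigma>, transpose (chart_jacobian (A i) (A j) p) *v \<mu>, \<rho>))) \<and>
    (\<forall>i a. \<forall>p\<in>U \<inter> chart_dom (A i). normal_tractor_deriv A g i a (X i) p = 0)"

text \<open>The conformal factor of a metric in the class is unique (\<open>conformal_factor_unique\<close>), so that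
  nothing depends on the choice made here.\<close>

definition extend_scale ::
  "('i, 'a, 'n) triple_field \<Rightarrow> (('i, 'a, 'n) metric_comps \<times> 'i, 'a, 'n) triple_field" where
  "extend_scale X = (\<lambda>(h, i) p. scale_change A g (SOME \<omega>. conformal_rescaling A g \<omega> h) i p (X i p))"

lemma extend_scale_eq:
  assumes "conformal_rescaling A g \<omega> h"
  shows "extend_scale X (h, i) = (\<lambda>p. scale_change A g \<omega> i p (X i p))"
proof -
  have "(SOME \<omega>. conformal_rescaling A g \<omega> h) = \<omega>"
    using conformal_factor_unique[OF assms] assms by (metis someI)
  then show ?thesis
    by (simp add: extend_scale_def)
qed

lemma extend_scale_self: "extend_scale X (g, i) = X i"
proof
  fix p
  show "extend_scale X (g, i) p = X i p"
    unfolding extend_scale_eq[OF conformal_class_self(1)]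
    by (simp add: scale_change_def Let_def case_prod_beta pderiv_chart_def flip: zero_vec_def)
qed

text \<open>A parallel tractor is determined by its components in a single scale, and any parallel field of
  components in one scale occurs: its rescalings are parallel by \<open>parallel_rescaled\<close> and compatible
  with each other by \<open>scale_change_trans\<close>.\<close>

lemma parallel_extend_scale:
  assumes U: "open U" and dim: "CARD('n) \<ge> 3" and X: "parallel_in_scale U X"
  shows "parallel_standard_tractor_on A (conformal_class A g) U (extend_scale X)"
proof -
  have smX: "smooth_in_chart (A i) U (X i)" for i
    using X by (simp add: parallel_in_scale_def)
  have sm: "smooth_in_chart (A i) UNIV \<omega>" if "conformal_rescaling A g \<omega> h" for i \<omega> h
    using that by (simp add: conformal_rescaling_def)
  show ?thesis
    unfolding parallel_standard_tractor_on_def standard_tractor_on_def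
  proof (intro conjI allI impI ballI)
    fix h i assume "h \<in> conformal_class A g"
    then obtain \<omega> where \<omega>: "conformal_rescaling A g \<omega> h" by (auto simp: conformal_class_def)
    note conf = conformal[OF U \<omega>, of i]
    show "smooth_in_chart (A i) U (extend_scale X (h, i))"
      unfolding extend_scale_eq[OF \<omega>] by (rule conformal_region.smooth_scale_change[OF conf smX])
    show "normal_tractor_deriv A h i a (extend_scale X (h, i)) p = 0"
      if "p \<in> U \<inter> chart_dom (A i)" for a p
      unfolding extend_scale_eq[OF \<omega>]
      by (rule conformal_region.parallel_rescaled[OF conf _ _ dim smX])
        (use that X in \<open>auto simp: parallel_in_scale_def\<close>)
    show "extend_scale X (h, i) p = (case extend_scale X (h, j) p of (\<sigma>, \<mu>, \<rho>) \<Rightarrow>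
          (\<sigma>, transpose (chart_jacobian (A i) (A j) p) *v \<mu>, \<rho>))"
      if "p \<in> U \<inter> chart_dom (A i) \<inter> chart_dom (A j)" for j p
      unfolding extend_scale_eq[OF \<omega>]
    proof (rule scale_change_transform[OF _ _ sm[OF \<omega>]])
      show "X i p = (case X j p of (\<sigma>, \<mu>, \<rho>) \<Rightarrow>
          (\<sigma>, transpose (chart_jacobian (A i) (A j) p) *v \<mu>, \<rho>))"
        using X that unfolding parallel_in_scale_def by blast
    qed (use that in auto)
    fix k \<eta> p
    assume "k \<in> conformal_class A g" and \<eta>: "conformal_rescaling A h \<eta> k"
      and p: "p \<in> U \<inter> chart_dom (A i)"
    have "smooth_in_chart (A i) UNIV (\<lambda>q. \<omega> q + \<eta> q)" for i
      by (rule chart_region.smooth_add)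
        (use \<omega> \<eta> charts in \<open>auto simp: chart_region_def conformal_rescaling_def\<close>)
    then have sum: "conformal_rescaling A g (\<lambda>q. \<omega> q + \<eta> q) k"
      using \<omega> \<eta> by (simp add: conformal_rescaling_def distrib_left exp_add mult.commute)
    have "smooth_in_chart (A i) U \<eta>"
      using \<eta> smooth_in_chart_subset[of "A i" UNIV \<eta> U] by (simp add: conformal_rescaling_def)
    from conformal_region.scale_change_trans[OF conf _ _ this] p
    show "extend_scale X (k, i) p = scale_change A h \<eta> i p (extend_scale X (h, i) p)"
      by (simp add: extend_scale_eq[OF \<omega>] extend_scale_eq[OF sum])
  qed
qed

lemma parallel_standard_tractor_in_scale:
  "parallel_standard_tractor_on A (conformal_class A g) U T \<Longrightarrow> parallel_in_scale U (\<lambda>i. T (g, i))"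
  using conformal_class_self(2)
  unfolding parallel_in_scale_def parallel_standard_tractor_on_def standard_tractor_on_def by blast

lemma standard_tractor_scale_change:
  assumes "parallel_standard_tractor_on A (conformal_class A g) U T"
    and "conformal_rescaling A g \<omega> h" "p \<in> U" "p \<in> chart_dom (A i)"
  shows "T (h, i) p = scale_change A g \<omega> i p (T (g, i) p)"
  using assms conformal_class_self(2)
  unfolding parallel_standard_tractor_on_def standard_tractor_on_def conformal_class_def by blast

end

section \<open>Products of Riemannian manifolds\<close>

text \<open>Projections of a product and inclusions of its slices are affine in product charts, and so
  one chain rule serves for all of them.\<close>

locale affine_in_charts = dom: chart_region c U + cod: chart_region d V
  for c :: "('a::topological_space, 'm::finite) chart" and U
    and d :: "('b::topological_space, 'n::finite) chart" and V +
  fixes \<phi> :: "'a \<Rightarrow> 'b" and L :: "real^'m \<Rightarrow> real^'n" and k :: "real^'n"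
  assumes linear: "bounded_linear L"
    and maps: "p \<in> U \<Longrightarrow> p \<in> chart_dom c \<Longrightarrow> \<phi> p \<in> V" "p \<in> U \<Longrightarrow> p \<in> chart_dom c \<Longrightarrow> \<phi> p \<in> chart_dom d"
    and coords: "p \<in> U \<Longrightarrow> p \<in> chart_dom c \<Longrightarrow> coords d (\<phi> p) = L (coords c p) + k"
begin

lemma pullback_coords:
  assumes "x \<in> coords c ` (U \<inter> chart_dom c)"
  shows "f (chart_inv d (L x + k)) = f (\<phi> (chart_inv c x))"
    "L x + k \<in> coords d ` (V \<inter> chart_dom d)"
proof -
  note x = dom.image_chart_inv[OF assms]
  have "L x + k = coords d (\<phi> (chart_inv c x))"
    using coords[OF x(1,2)] x(3) by simp
  then show "f (chart_inv d (L x + k)) = f (\<phi> (chart_inv c x))"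
    "L x + k \<in> coords d ` (V \<inter> chart_dom d)"
    using maps[OF x(1,2)] is_chartD(2)[OF cod.chart] by auto
qed

lemma smooth_pullback:
  assumes "cod.smooth f"
  shows "dom.smooth (\<lambda>p. f (\<phi> p))"
proof -
  have "smooth_on (coords c ` (U \<inter> chart_dom c)) (\<lambda>x. f (chart_inv d (L x + k)))"
    using assms unfolding smooth_in_chart_def smooth_on_def
    by (intro allI Ck_on_compose_affine[OF linear dom.open_image pullback_coords(2),
          where f = "\<lambda>x. f (chart_inv d x)"]) auto
  then show ?thesis
    unfolding smooth_in_chart_def
    by (rule smooth_on_cong[OF dom.open_image, rotated]) (rule pullback_coords(1))
qed

lemma pderiv_pullback:
  assumes "cod.smooth f" and p: "p \<in> U" "p \<in> chart_dom c"
  shows "L (axis a 1) = axis b 1 \<Longrightarrow> pderiv_chart c a (\<lambda>p. f (\<phi> p)) p = pderiv_chart d b f (\<phi> p)"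
    and "L (axis a 1) = 0 \<Longrightarrow> pderiv_chart c a (\<lambda>p. f (\<phi> p)) p = 0"
proof -
  let ?F' = "frechet_derivative (\<lambda>x. f (chart_inv d x)) (at (coords d (\<phi> p)))"
  have F: "((\<lambda>x. f (chart_inv d x)) has_derivative ?F') (at (L (coords c p) + k))"
    using cod.has_derivative_in_chart[OF assms(1) maps[OF p]] by (simp add: coords[OF p])
  have "((\<lambda>x. L x + k) has_derivative L) (at (coords c p))"
    using has_derivative_add[OF bounded_linear_imp_has_derivative[OF linear] has_derivative_const[of k]]
    by simp
  from has_derivative_compose[OF this F]
  have "((\<lambda>x. f (\<phi> (chart_inv c x))) has_derivative (\<lambda>v. ?F' (L v))) (at (coords c p))"
    by (rule has_derivative_transform_within_open[OF _ dom.open_image]) (use p pullback_coords in auto)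
  from pderiv_chart_eqI[OF this] have eq: "pderiv_chart c a (\<lambda>p. f (\<phi> p)) p = ?F' (L (axis a 1))" .
  then show "L (axis a 1) = axis b 1 \<Longrightarrow>
      pderiv_chart c a (\<lambda>p. f (\<phi> p)) p = pderiv_chart d b f (\<phi> p)"
    by (simp add: pderiv_chart_def)
  show "L (axis a 1) = 0 \<Longrightarrow> pderiv_chart c a (\<lambda>p. f (\<phi> p)) p = 0"
    using eq linear_0[OF has_derivative_linear[OF F]] by simp
qed

end

definition left_part :: "real^('m::finite + 'n::finite) \<Rightarrow> real^'m" where
  "left_part v = (\<chi> a. v $ Inl a)"

definition right_part :: "real^('m::finite + 'n::finite) \<Rightarrow> real^'n" where
  "right_part v = (\<chi> b. v $ Inr b)"

definition join :: "real^'m \<Rightarrow> real^'n \<Rightarrow> real^('m::finite + 'n::finite)" where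
  "join v w = (\<chi> k. case k of Inl a \<Rightarrow> v $ a | Inr b \<Rightarrow> w $ b)"

definition block_diag :: "real^'m^'m \<Rightarrow> real^'n^'n \<Rightarrow> real^('m::finite + 'n::finite)^('m + 'n)" where
  "block_diag G H = (\<chi> k l. case (k, l) of (Inl a, Inl b) \<Rightarrow> G $ a $ b | (Inr a, Inr b) \<Rightarrow> H $ a $ b
     | _ \<Rightarrow> 0)"

lemma join_nth [simp]: "join v w $ Inl a = v $ a" "join v w $ Inr b = w $ b"
  "left_part x $ a = x $ Inl a" "right_part x $ b = x $ Inr b"
  by (simp_all add: join_def left_part_def right_part_def)

lemma block_diag_nth [simp]:
  "block_diag G H $ Inl a $ Inl b = G $ a $ b" "block_diag G H $ Inr c $ Inr d = H $ c $ d"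
  "block_diag G H $ Inl a $ Inr d = 0" "block_diag G H $ Inr c $ Inl b = 0"
  by (simp_all add: block_diag_def)

lemma sum_vec_eq_iff:
  "v = w \<longleftrightarrow> (\<forall>a. v $ Inl a = w $ Inl a) \<and> (\<forall>b. v $ Inr b = w $ Inr b)"
  for v w :: "'c^('m::finite + 'n::finite)"
  by (simp add: vec_eq_iff split_sum_all)

lemma join_parts [simp]: "left_part (join v w) = v" "right_part (join v w) = w"
  "join (left_part x) (right_part x) = x"
  by (simp_all add: vec_eq_iff split_sum_all
      left_part_def right_part_def)

lemma sum_UNIV_Plus: "(\<Sum>k\<in>UNIV. f k) = (\<Sum>a\<in>UNIV. f (Inl a)) + (\<Sum>b\<in>UNIV. f (Inr b))"
  for f :: "'m::finite + 'n::finite \<Rightarrow> 'c::comm_monoid_add"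
  unfolding UNIV_Plus_UNIV[symmetric] by (subst sum.Plus) auto

lemma block_diag_mult:
  "block_diag G H *v x = join (G *v left_part x) (H *v right_part x)"
  "block_diag G H ** block_diag G' H' = block_diag (G ** G') (H ** H')"
  "transpose (block_diag G H) = block_diag (transpose G) (transpose H)"
  "block_diag (mat 1) (mat 1) = mat 1"
  by (simp_all add: sum_vec_eq_iff matrix_vector_mult_def matrix_matrix_mult_def sum_UNIV_Plus
      transpose_def mat_def)

lemma matrix_inv_block_diag:
  assumes "invertible G" "invertible H"
  shows "matrix_inv (block_diag G H) = block_diag (matrix_inv G) (matrix_inv H)"
  by (rule matrix_inv_unique) (simp add: block_diag_mult matrix_inv_inverse assms)

lemma join_inner: "v \<bullet> w = left_part v \<bullet> left_part w + right_part v \<bullet> right_part w"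
  by (simp add: inner_vec_def sum_UNIV_Plus)

lemma bounded_linear_parts:
  "bounded_linear (left_part :: real^('m::finite + 'n::finite) \<Rightarrow> _)"
  "bounded_linear (right_part :: real^('m::finite + 'n::finite) \<Rightarrow> _)"
  "bounded_linear (\<lambda>v. join v 0 :: real^('m::finite + 'n::finite))"
  "bounded_linear (\<lambda>w. join 0 w :: real^('m::finite + 'n::finite))"
  unfolding linear_conv_bounded_linear[symmetric]
  by (rule linearI; simp add: vec_eq_iff split_sum_all)+

lemma parts_axis:
  "left_part (axis (Inl a) 1) = axis a 1" "left_part (axis (Inr b) 1) = 0"
  "right_part (axis (Inl a) 1) = 0" "right_part (axis (Inr b) 1) = axis b 1"
  "join (axis a 1) 0 = axis (Inl a) 1" "join 0 (axis b 1) = axis (Inr b) 1"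
  by (auto simp: vec_eq_iff axis_def split_sum_all)

lemma product_chart_simps:
  "chart_dom (product_chart c d) = chart_dom c \<times> chart_dom d"
  "coords (product_chart c d) z = join (coords c (fst z)) (coords d (snd z))"
  by (auto simp: product_chart_def join_def split: prod.split)

lemma is_chart_product:
  assumes c: "is_chart c" and d: "is_chart d"
  shows "is_chart (product_chart c d)"
proof -
  let ?e = "product_chart c d"
  let ?C = "coords c ` chart_dom c" and ?D = "coords d ` chart_dom d"
  have img: "coords ?e ` chart_dom ?e = left_part -` ?C \<inter> right_part -` ?D"
  proof (intro equalityI subsetI)
    fix x :: "real^('b + 'd)" assume "x \<in> left_part -` ?C \<inter> right_part -` ?D"
    then obtain p q where "p \<in> chart_dom c" "left_part x = coords c p"
      "q \<in> chart_dom d" "right_part x = coords d q" by auto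
    then have "x = coords ?e (p, q)" "(p, q) \<in> chart_dom ?e"
      by (simp_all add: product_chart_simps) (metis join_parts(3))
    then show "x \<in> coords ?e ` chart_dom ?e" by blast
  qed (auto simp: product_chart_simps)
  have opens: "open ?C" "open ?D" "open (chart_dom c)" "open (chart_dom d)"
    using c d by (auto simp: is_chart_def)
  note cont = linear_continuous_on[OF bounded_linear_parts(1)]
    linear_continuous_on[OF bounded_linear_parts(2)]
  have open_img: "open (coords ?e ` chart_dom ?e)"
    unfolding img by (intro open_Int continuous_open_vimage opens
        linear_continuous_at[OF bounded_linear_parts(1)] linear_continuous_at[OF bounded_linear_parts(2)])
  have inj: "inj_on (coords ?e) (chart_dom ?e)"
  proof (rule inj_onI, clarsimp simp: product_chart_simps)
    fix p q p' q' assume *: "p \<in> chart_dom c" "p' \<in> chart_dom c" "q \<in> chart_dom d" "q' \<in> chart_dom d"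
      "join (coords c p) (coords d q) = join (coords c p') (coords d q')"
    then have "coords c p = coords c p'" "coords d q = coords d q'"
      by (metis join_parts(1), metis join_parts(2))
    then show "p = p' \<and> q = q'"
      using * is_chartD(2)[OF c] is_chartD(2)[OF d] by metis
  qed
  have inv: "chart_inv ?e x = (chart_inv c (left_part x), chart_inv d (right_part x))"
    if x: "x \<in> coords ?e ` chart_dom ?e" for x
  proof -
    obtain z where z: "z \<in> chart_dom ?e" "x = coords ?e z"
      using x by blast
    then have pq: "fst z \<in> chart_dom c" "snd z \<in> chart_dom d" "x = coords ?e z"
      by (auto simp: product_chart_simps(1))
    have "chart_inv ?e x = z"
      unfolding chart_inv_def pq(3)
      by (rule inv_into_f_f[OF inj z(1)])
    then show ?thesis
      using pq by (simp add: product_chart_simps is_chartD(2)[OF c] is_chartD(2)[OF d])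
  qed
  have "continuous_on (chart_dom ?e) (\<lambda>z. join (coords c (fst z)) 0 + join 0 (coords d (snd z)))"
    by (intro continuous_on_add bounded_linear.continuous_on[OF bounded_linear_parts(3)]
        bounded_linear.continuous_on[OF bounded_linear_parts(4)]
        continuous_on_compose2[OF is_chartD(4)[OF c]] continuous_on_compose2[OF is_chartD(4)[OF d]]
        continuous_on_fst continuous_on_snd continuous_on_id) (auto simp: product_chart_simps)
  moreover have "join v 0 + join 0 w = join v w" for v :: "real^'b" and w :: "real^'d"
    by (simp add: sum_vec_eq_iff)
  ultimately have "continuous_on (chart_dom ?e) (coords ?e)"
    by (simp add: product_chart_simps[abs_def] cong: continuous_on_cong)
  moreover have "continuous_on (coords ?e ` chart_dom ?e) (chart_inv ?e)"
  proof (rule continuous_on_eq)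
    show "continuous_on (coords ?e ` chart_dom ?e)
        (\<lambda>x. (chart_inv c (left_part x), chart_inv d (right_part x)))"
      by (intro continuous_on_Pair continuous_on_compose2[OF is_chartD(5)[OF c]]
          continuous_on_compose2[OF is_chartD(5)[OF d]] cont) (auto simp: product_chart_simps)
  qed (simp add: inv)
  ultimately show ?thesis
    unfolding is_chart_def homeomorphism_def
    using open_img opens inj
    by (auto simp: chart_inv_def product_chart_simps(1) open_Times inv_into_f_f f_inv_into_f
        intro!: image_eqI inv_into_into)
qed

lemma product_chart_inv:
  assumes "is_chart c" "is_chart d" "x \<in> coords (product_chart c d) ` chart_dom (product_chart c d)"
  shows "chart_inv (product_chart c d) x = (chart_inv c (left_part x), chart_inv d (right_part x))"
    "left_part x \<in> coords c ` chart_dom c" "right_part x \<in> coords d ` chart_dom d"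
  using assms(3) is_chartD(2)[OF is_chart_product[OF assms(1,2)]]
    is_chartD(2)[OF assms(1)] is_chartD(2)[OF assms(2)]
  by (auto simp: product_chart_simps)

lemma fst_affine_in_charts:
  assumes "is_chart c" "is_chart d" "open U" "open W" "fst ` W \<subseteq> U"
  shows "affine_in_charts (product_chart c d) W c U fst left_part 0"
  unfolding affine_in_charts_def affine_in_charts_axioms_def chart_region_def
  by (use assms bounded_linear_parts(1) in \<open>auto simp: is_chart_product product_chart_simps\<close>)

lemma snd_affine_in_charts:
  assumes "is_chart c" "is_chart d" "open U" "open W" "snd ` W \<subseteq> U"
  shows "affine_in_charts (product_chart c d) W d U snd right_part 0"
  unfolding affine_in_charts_def affine_in_charts_axioms_def chart_region_def
  by (use assms bounded_linear_parts(2) in \<open>auto simp: is_chart_product product_chart_simps\<close>)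

lemma open_slices:
  assumes "open W"
  shows "open {p. (p, q) \<in> W}" "open {q. (p, q) \<in> W}"
  using open_vimage[OF assms, of "\<lambda>p. (p, q)"] open_vimage[OF assms, of "\<lambda>q. (p, q)"]
  by (simp_all add: vimage_def continuous_on_Pair)

lemma left_slice_affine_in_charts:
  assumes "is_chart c" "is_chart d" "open W" "q \<in> chart_dom d"
  shows "affine_in_charts c {p. (p, q) \<in> W} (product_chart c d) W (\<lambda>p. (p, q)) (\<lambda>v. join v 0)
    (join 0 (coords d q))"
  unfolding affine_in_charts_def affine_in_charts_axioms_def chart_region_def
  by (use assms bounded_linear_parts(3) in
      \<open>auto simp: is_chart_product product_chart_simps sum_vec_eq_iff open_slices\<close>)

lemma right_slice_affine_in_charts:
  assumes "is_chart c" "is_chart d" "open W" "p \<in> chart_dom c"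
  shows "affine_in_charts d {q. (p, q) \<in> W} (product_chart c d) W (\<lambda>q. (p, q)) (\<lambda>v. join 0 v)
    (join (coords c p) 0)"
  unfolding affine_in_charts_def affine_in_charts_axioms_def chart_region_def
  by (use assms bounded_linear_parts(4) in
      \<open>auto simp: is_chart_product product_chart_simps sum_vec_eq_iff open_slices\<close>)

locale product_manifold = M1: riemannian_manifold A1 g1 + M2: riemannian_manifold A2 g2
  for A1 :: "('i, 'a::{second_countable_topology, t2_space}, 'm::finite) atlas" and g1
    and A2 :: "('j, 'b::{second_countable_topology, t2_space}, 'n::finite) atlas" and g2
begin

abbreviation "A \<equiv> product_atlas A1 A2"
abbreviation "g \<equiv> product_metric g1 g2"

lemma product_atlas_simp: "A (i, j) = product_chart (A1 i) (A2 j)"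
  by (simp add: product_atlas_def)

lemma product_dom: "(p, q) \<in> chart_dom (A (i, j)) \<longleftrightarrow> p \<in> chart_dom (A1 i) \<and> q \<in> chart_dom (A2 j)"
  by (simp add: product_atlas_simp product_chart_simps)

lemma product_metric_simp: "g (i, j) z = block_diag (g1 i (fst z)) (g2 j (snd z))"
  by (cases z) (simp add: product_metric_def block_diag_def)

lemma transition_block:
  assumes "x \<in> coords (A (i, j)) ` (chart_dom (A (i, j)) \<inter> chart_dom (A (i', j')))"
  shows "coords (A (i', j')) (chart_inv (A (i, j)) x) =
      join (coords (A1 i') (chart_inv (A1 i) (left_part x))) 0
      + join 0 (coords (A2 j') (chart_inv (A2 j) (right_part x)))"
    "left_part x \<in> coords (A1 i) ` (chart_dom (A1 i) \<inter> chart_dom (A1 i'))"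
    "right_part x \<in> coords (A2 j) ` (chart_dom (A2 j) \<inter> chart_dom (A2 j'))"
proof -
  have "x \<in> coords (A (i, j)) ` chart_dom (A (i, j))"
    using assms by auto
  note inv = product_chart_inv(1)[OF M1.charts(1) M2.charts(1) this[unfolded product_atlas_simp]]
  show "coords (A (i', j')) (chart_inv (A (i, j)) x) =
      join (coords (A1 i') (chart_inv (A1 i) (left_part x))) 0
      + join 0 (coords (A2 j') (chart_inv (A2 j) (right_part x)))"
    by (simp add: product_atlas_simp inv product_chart_simps sum_vec_eq_iff)
qed (use assms in \<open>auto simp: product_atlas_simp product_chart_simps\<close>)

lemma open_overlap: "open (coords (A k) ` (chart_dom (A k) \<inter> chart_dom (A l)))"
proof -
  have ch: "is_chart (A k)" for k
    by (cases k) (simp add: product_atlas_simp is_chart_product M1.charts M2.charts)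
  show ?thesis
    using is_chartD(3)[OF ch, OF is_chartD(1)[OF ch], of k l] by (simp add: Int_commute)
qed

lemma smooth_manifold_product: "smooth_manifold A"
  unfolding smooth_manifold_def
proof (intro conjI allI)
  show "connected (UNIV :: ('a \<times> 'b) set)"
    using connected_Times[OF M1.charts(3) M2.charts(3)] by simp
  show "is_chart (A k)" for k
    by (cases k) (simp add: product_atlas_simp is_chart_product M1.charts M2.charts)
  show "(\<Union>k. chart_dom (A k)) = UNIV"
  proof (intro equalityI subsetI UNIV_I)
    fix z :: "'a \<times> 'b"
    obtain i j where "fst z \<in> chart_dom (A1 i)" "snd z \<in> chart_dom (A2 j)"
      using M1.charts(2) M2.charts(2) by blast
    then have "z \<in> chart_dom (A (i, j))"
      by (cases z) (simp add: product_dom)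
    then show "z \<in> (\<Union>k. chart_dom (A k))" by blast
  qed
  fix k l :: "'i \<times> 'j"
  obtain i j i' j' where kl: "k = (i, j)" "l = (i', j')" by (cases k, cases l)
  let ?S = "coords (A k) ` (chart_dom (A k) \<inter> chart_dom (A l))"
  note S = open_overlap[of k l]
  have 1: "smooth_on (coords (A1 i) ` (chart_dom (A1 i) \<inter> chart_dom (A1 i')))
      (\<lambda>x. coords (A1 i') (chart_inv (A1 i) x))"
    and 2: "smooth_on (coords (A2 j) ` (chart_dom (A2 j) \<inter> chart_dom (A2 j')))
      (\<lambda>x. coords (A2 j') (chart_inv (A2 j) x))"
    using M1.manifold M2.manifold by (auto simp: smooth_manifold_def)
  have "smooth_on ?S (\<lambda>x. join (coords (A1 i') (chart_inv (A1 i) (left_part x + 0))) 0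
      + join 0 (coords (A2 j') (chart_inv (A2 j) (right_part x + 0))))"
    unfolding smooth_on_def
  proof (intro allI Ck_on_add S Ck_on_linear[OF bounded_linear_parts(3)]
      Ck_on_linear[OF bounded_linear_parts(4)])
    fix n
    show "Ck_on n ?S (\<lambda>x. coords (A1 i') (chart_inv (A1 i) (left_part x + 0)))"
      by (rule Ck_on_compose_affine[OF bounded_linear_parts(1) S _ 1[unfolded smooth_on_def, rule_format]])
        (simp add: kl transition_block)
    show "Ck_on n ?S (\<lambda>x. coords (A2 j') (chart_inv (A2 j) (right_part x + 0)))"
      by (rule Ck_on_compose_affine[OF bounded_linear_parts(2) S _ 2[unfolded smooth_on_def, rule_format]])
        (simp add: kl transition_block)
  qed
  then show "smooth_on ?S (\<lambda>x. coords (A l) (chart_inv (A k) x))"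
    by (rule smooth_on_cong[OF S, rotated]) (simp add: kl transition_block)
qed

lemma product_jacobian:
  assumes "(p, q) \<in> chart_dom (A (i, j))" "(p, q) \<in> chart_dom (A (i', j'))"
  shows "chart_jacobian (A (i, j)) (A (i', j')) (p, q) =
    block_diag (chart_jacobian (A1 i) (A1 i') p) (chart_jacobian (A2 j) (A2 j') q)"
proof -
  let ?z = "coords (A (i, j)) (p, q)"
  have z: "left_part ?z = coords (A1 i) p" "right_part ?z = coords (A2 j) q"
    by (simp_all add: product_atlas_simp product_chart_simps)
  let ?J1 = "chart_jacobian (A1 i) (A1 i') p" and ?J2 = "chart_jacobian (A2 j) (A2 j') q"
  have dom: "p \<in> chart_dom (A1 i)" "p \<in> chart_dom (A1 i')" "q \<in> chart_dom (A2 j)" "q \<in> chart_dom (A2 j')"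
    using assms by (simp_all add: product_dom)
  have d1: "((\<lambda>x. coords (A1 i') (chart_inv (A1 i) (left_part x))) has_derivative
      (\<lambda>v. ?J1 *v left_part v)) (at ?z)"
    by (rule has_derivative_compose[OF bounded_linear_imp_has_derivative[OF bounded_linear_parts(1)]])
      (use M1.transition_derivative[OF dom(1,2)] z in simp)
  have d2: "((\<lambda>x. coords (A2 j') (chart_inv (A2 j) (right_part x))) has_derivative
      (\<lambda>v. ?J2 *v right_part v)) (at ?z)"
    by (rule has_derivative_compose[OF bounded_linear_imp_has_derivative[OF bounded_linear_parts(2)]])
      (use M2.transition_derivative[OF dom(3,4)] z in simp)
  have "((\<lambda>x. coords (A (i', j')) (chart_inv (A (i, j)) x)) has_derivative
      (\<lambda>v. join (?J1 *v left_part v) 0 + join 0 (?J2 *v right_part v))) (at ?z)"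
    by (rule has_derivative_transform_within_open[OF has_derivative_add[OF
            bounded_linear.has_derivative[OF bounded_linear_parts(3) d1]
            bounded_linear.has_derivative[OF bounded_linear_parts(4) d2]] open_overlap])
      (use assms in blast, erule transition_block(1)[symmetric])
  moreover have "join v 0 + join 0 w = join v w" for v :: "real^'m" and w :: "real^'n"
    by (simp add: sum_vec_eq_iff)
  ultimately have "((\<lambda>x. coords (A (i', j')) (chart_inv (A (i, j)) x)) has_derivative
      (\<lambda>v. block_diag ?J1 ?J2 *v v)) (at ?z)"
    by (simp add: block_diag_mult)
  then have "matrix (frechet_derivative (\<lambda>x. coords (A (i', j')) (chart_inv (A (i, j)) x)) (at ?z)) =
      block_diag ?J1 ?J2"
    by (simp only: frechet_derivative_at[symmetric] matrix_of_matrix_vector_mul)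
  then show ?thesis
    by (simp only: chart_jacobian_def[of "A (i, j)"] jacobian_def)
qed

lemma smooth_pullback_fst:
  "open U \<Longrightarrow> open W \<Longrightarrow> fst ` W \<subseteq> U \<Longrightarrow> smooth_in_chart (A1 i) U f \<Longrightarrow>
    smooth_in_chart (A (i, j)) W (\<lambda>z. f (fst z))"
  unfolding product_atlas_simp
  by (rule affine_in_charts.smooth_pullback[OF fst_affine_in_charts]) (auto simp: M1.charts M2.charts)

lemma smooth_pullback_snd:
  "open U \<Longrightarrow> open W \<Longrightarrow> snd ` W \<subseteq> U \<Longrightarrow> smooth_in_chart (A2 j) U f \<Longrightarrow>
    smooth_in_chart (A (i, j)) W (\<lambda>z. f (snd z))"
  unfolding product_atlas_simp
  by (rule affine_in_charts.smooth_pullback[OF snd_affine_in_charts]) (auto simp: M1.charts M2.charts)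

lemma product_chart_region: "open W \<Longrightarrow> chart_region (A k) W"
  using smooth_manifold_product unfolding chart_region_def smooth_manifold_def by blast

lemma riemannian_metric_product: "riemannian_metric A g"
  unfolding riemannian_metric_def
proof (intro conjI allI ballI impI)
  fix k :: "'i \<times> 'j"
  obtain i j where k: "k = (i, j)" by (cases k)
  interpret chart_region "A k" UNIV
    by (rule product_chart_region) simp
  have 1: "smooth_in_chart (A1 i) UNIV (g1 i)" and 2: "smooth_in_chart (A2 j) UNIV (g2 j)"
    using M1.metric M2.metric by (auto simp: riemannian_metric_def)
  have "smooth (\<lambda>z. g1 i (fst z))" "smooth (\<lambda>z. g2 j (snd z))"
    unfolding k by (rule smooth_pullback_fst[OF _ _ _ 1] smooth_pullback_snd[OF _ _ _ 2]; simp)+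
  then have B: "smooth (\<lambda>z. block_diag (g1 i (fst z)) (g2 j (snd z)) $ l $ m)" for l m
    by (cases l; cases m) (simp_all add: smooth_nth smooth_const)
  have "smooth (\<lambda>z. \<chi> l m. block_diag (g1 i (fst z)) (g2 j (snd z)) $ l $ m)"
    by (intro smooth_vec B)
  then show "smooth (g k)"
    by (simp add: k product_metric_simp[abs_def])
  fix z assume "z \<in> chart_dom (A k)"
  then have z: "fst z \<in> chart_dom (A1 i)" "snd z \<in> chart_dom (A2 j)"
    by (cases z, simp add: k product_dom)+
  note R1 = M1.region[OF open_UNIV, of i] and R2 = M2.region[OF open_UNIV, of j]
  show "transpose (g k z) = g k z"
    by (simp add: k product_metric_simp block_diag_mult
        metric_region.metric_transpose[OF R1 UNIV_I z(1)] metric_region.metric_transpose[OF R2 UNIV_I z(2)])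
  show "0 < v \<bullet> (g k z *v v)" if "v \<noteq> 0" for v
  proof -
    have v: "left_part v \<noteq> 0 \<or> right_part v \<noteq> 0"
      using that by (auto simp: vec_eq_iff split_sum_all)
    have nn: "0 \<le> w \<bullet> (g1 i (fst z) *v w)" "0 \<le> w' \<bullet> (g2 j (snd z) *v w')" for w w'
      using metric_region.metric_positive[OF R1 UNIV_I z(1), where v = w]
        metric_region.metric_positive[OF R2 UNIV_I z(2), where v = w']
      by (cases "w = 0"; cases "w' = 0"; simp)+
    show ?thesis
      using v nn(1)[of "left_part v"] nn(2)[of "right_part v"]
        metric_region.metric_positive[OF R1 UNIV_I z(1), where v = "left_part v"]
        metric_region.metric_positive[OF R2 UNIV_I z(2), where v = "right_part v"]
      by (auto simp: k product_metric_simp block_diag_mult join_inner)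
  qed
next
  fix k l :: "'i \<times> 'j" and z assume z: "z \<in> chart_dom (A k) \<inter> chart_dom (A l)"
  obtain i j i' j' p q where kl: "k = (i, j)" "l = (i', j')" "z = (p, q)"
    by (cases k, cases l, cases z)
  have dom: "p \<in> chart_dom (A1 i)" "p \<in> chart_dom (A1 i')" "q \<in> chart_dom (A2 j)" "q \<in> chart_dom (A2 j')"
    and d: "(p, q) \<in> chart_dom (A (i, j))" "(p, q) \<in> chart_dom (A (i', j'))"
    using z by (simp_all add: kl product_dom)
  show "g k z = transpose (chart_jacobian (A k) (A l) z) ** g l z ** chart_jacobian (A k) (A l) z"
    by (simp add: kl product_metric_simp product_jacobian[OF d] block_diag_mult
        M1.metric_transform[OF dom(1,2)] M2.metric_transform[OF dom(3,4)])
qed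

sublocale riemannian_manifold A g
  by standard (rule smooth_manifold_product riemannian_metric_product)+

end

section \<open>Curvature of a product\<close>

context product_manifold
begin

lemma pderiv_pullback_fst:
  assumes "open U" "smooth_in_chart (A1 i) U f" "p \<in> U" "(p, q) \<in> chart_dom (A (i, j))"
  shows "pderiv_chart (A (i, j)) (Inl a) (\<lambda>z. f (fst z)) (p, q) = pderiv_chart (A1 i) a f p"
    "pderiv_chart (A (i, j)) (Inr b) (\<lambda>z. f (fst z)) (p, q) = 0"
proof -
  interpret affine_in_charts "A (i, j)" "U \<times> UNIV" "A1 i" U fst left_part 0
    unfolding product_atlas_simp by (rule fst_affine_in_charts)
      (auto simp: assms M1.charts M2.charts intro: open_Times)
  show "pderiv_chart (A (i, j)) (Inl a) (\<lambda>z. f (fst z)) (p, q) = pderiv_chart (A1 i) a f p"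
    using pderiv_pullback(1)[OF assms(2), of "(p, q)" "Inl a" a] assms by (simp add: parts_axis)
  show "pderiv_chart (A (i, j)) (Inr b) (\<lambda>z. f (fst z)) (p, q) = 0"
    using pderiv_pullback(2)[OF assms(2), of "(p, q)" "Inr b"] assms by (simp add: parts_axis)
qed

lemma pderiv_pullback_snd:
  assumes "open U" "smooth_in_chart (A2 j) U f" "q \<in> U" "(p, q) \<in> chart_dom (A (i, j))"
  shows "pderiv_chart (A (i, j)) (Inr b) (\<lambda>z. f (snd z)) (p, q) = pderiv_chart (A2 j) b f q"
    "pderiv_chart (A (i, j)) (Inl a) (\<lambda>z. f (snd z)) (p, q) = 0"
proof -
  interpret affine_in_charts "A (i, j)" "UNIV \<times> U" "A2 j" U snd right_part 0
    unfolding product_atlas_simp by (rule snd_affine_in_charts)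
      (auto simp: assms M1.charts M2.charts intro: open_Times)
  show "pderiv_chart (A (i, j)) (Inr b) (\<lambda>z. f (snd z)) (p, q) = pderiv_chart (A2 j) b f q"
    using pderiv_pullback(1)[OF assms(2), of "(p, q)" "Inr b" b] assms by (simp add: parts_axis)
  show "pderiv_chart (A (i, j)) (Inl a) (\<lambda>z. f (snd z)) (p, q) = 0"
    using pderiv_pullback(2)[OF assms(2), of "(p, q)" "Inl a"] assms by (simp add: parts_axis)
qed

lemma smooth_metric_parts:
  "smooth_in_chart (A1 i) UNIV (\<lambda>p. g1 i p $ a $ b)" "smooth_in_chart (A2 j) UNIV (\<lambda>q. g2 j q $ c $ d)"
  using metric_region.smooth_metric_comp[OF M1.region[OF open_UNIV]]
    metric_region.smooth_metric_comp[OF M2.region[OF open_UNIV]] by auto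

lemma inverse_product_metric:
  assumes "p \<in> chart_dom (A1 i)" "q \<in> chart_dom (A2 j)"
  shows "matrix_inv (g (i, j) (p, q)) = block_diag (matrix_inv (g1 i p)) (matrix_inv (g2 j q))"
  by (simp add: product_metric_simp matrix_inv_block_diag M1.invertible_metric M2.invertible_metric assms)

text \<open>Each block of the metric depends on one factor only; hence all symbols with mixed indices vanish.\<close>

lemma product_christoffel:
  assumes z: "(p, q) \<in> chart_dom (A (i, j))"
  shows "christoffel A g (i, j) (p, q) (Inl c) (Inl a) (Inl b) = christoffel A1 g1 i p c a b"
    "christoffel A g (i, j) (p, q) (Inr c') (Inr a') (Inr b') = christoffel A2 g2 j q c' a' b'"
    "christoffel A g (i, j) (p, q) (Inl c) (Inl a) (Inr b') = 0"
    "christoffel A g (i, j) (p, q) (Inl c) (Inr a') (Inl b) = 0"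
    "christoffel A g (i, j) (p, q) (Inl c) (Inr a') (Inr b') = 0"
    "christoffel A g (i, j) (p, q) (Inr c') (Inl a) (Inl b) = 0"
    "christoffel A g (i, j) (p, q) (Inr c') (Inl a) (Inr b') = 0"
    "christoffel A g (i, j) (p, q) (Inr c') (Inr a') (Inl b) = 0"
proof -
  interpret R: metric_region A "(i, j)" UNIV g
    by (rule region) simp
  have dom: "p \<in> chart_dom (A1 i)" "q \<in> chart_dom (A2 j)"
    using z by (simp_all add: product_dom)
  note simps = christoffel_def sum_UNIV_Plus product_metric_simp
    matrix_inv_block_diag[OF M1.invertible_metric[OF dom(1)] M2.invertible_metric[OF dom(2)]]
    R.pderiv_const pderiv_pullback_fst[OF open_UNIV smooth_metric_parts(1) UNIV_I z]
    pderiv_pullback_snd[OF open_UNIV smooth_metric_parts(2) UNIV_I z]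
  show "christoffel A g (i, j) (p, q) (Inl c) (Inl a) (Inl b) = christoffel A1 g1 i p c a b"
    "christoffel A g (i, j) (p, q) (Inr c') (Inr a') (Inr b') = christoffel A2 g2 j q c' a' b'"
    "christoffel A g (i, j) (p, q) (Inl c) (Inl a) (Inr b') = 0"
    "christoffel A g (i, j) (p, q) (Inl c) (Inr a') (Inl b) = 0"
    "christoffel A g (i, j) (p, q) (Inl c) (Inr a') (Inr b') = 0"
    "christoffel A g (i, j) (p, q) (Inr c') (Inl a) (Inl b) = 0"
    "christoffel A g (i, j) (p, q) (Inr c') (Inl a) (Inr b') = 0"
    "christoffel A g (i, j) (p, q) (Inr c') (Inr a') (Inl b) = 0"
    by (simp_all add: simps)
qed

lemma product_ricci:
  assumes z: "(p, q) \<in> chart_dom (A (i, j))"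
  shows "ricci A g (i, j) (p, q) = block_diag (ricci A1 g1 i p) (ricci A2 g2 j q)"
proof -
  interpret R: metric_region A "(i, j)" UNIV g
    by (rule region) simp
  have sm: "smooth_in_chart (A1 i) UNIV (\<lambda>p. christoffel A1 g1 i p c a b)"
    "smooth_in_chart (A2 j) UNIV (\<lambda>q. christoffel A2 g2 j q c' a' b')" for c a b c' a' b'
    using metric_region.christoffel_smooth[OF M1.region[OF open_UNIV]]
      metric_region.christoffel_smooth[OF M2.region[OF open_UNIV]] by auto
  have D_eq: "pderiv_chart (A (i, j)) k (\<lambda>z. christoffel A g (i, j) z c a b) (p, q) =
      pderiv_chart (A (i, j)) k F (p, q)"
    if "\<And>p q. (p, q) \<in> chart_dom (A (i, j)) \<Longrightarrow> christoffel A g (i, j) (p, q) c a b = F (p, q)"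
    for k c a b F
    by (rule R.pderiv_cong[OF _ R.christoffel_smooth _ z]) (use that in \<open>auto simp: split_paired_all\<close>)
  have mixed: "pderiv_chart (A (i, j)) k (\<lambda>z. christoffel A g (i, j) z (Inl c) (Inl a) (Inr b')) (p, q) = 0"
    "pderiv_chart (A (i, j)) k (\<lambda>z. christoffel A g (i, j) z (Inl c) (Inr a') (Inl b)) (p, q) = 0"
    "pderiv_chart (A (i, j)) k (\<lambda>z. christoffel A g (i, j) z (Inl c) (Inr a') (Inr b')) (p, q) = 0"
    "pderiv_chart (A (i, j)) k (\<lambda>z. christoffel A g (i, j) z (Inr c') (Inl a) (Inl b)) (p, q) = 0"
    "pderiv_chart (A (i, j)) k (\<lambda>z. christoffel A g (i, j) z (Inr c') (Inl a) (Inr b')) (p, q) = 0"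
    "pderiv_chart (A (i, j)) k (\<lambda>z. christoffel A g (i, j) z (Inr c') (Inr a') (Inl b)) (p, q) = 0"
    for k c a b c' a' b'
    by (rule trans[OF D_eq R.pderiv_const], simp only: product_christoffel)+
  have pure: "pderiv_chart (A (i, j)) k (\<lambda>z. christoffel A g (i, j) z (Inl c) (Inl a) (Inl b)) (p, q) =
      pderiv_chart (A (i, j)) k (\<lambda>z. christoffel A1 g1 i (fst z) c a b) (p, q)"
    "pderiv_chart (A (i, j)) k (\<lambda>z. christoffel A g (i, j) z (Inr c') (Inr a') (Inr b')) (p, q) =
      pderiv_chart (A (i, j)) k (\<lambda>z. christoffel A2 g2 j (snd z) c' a' b') (p, q)"
    for k c a b c' a' b'
    by (rule D_eq, simp add: product_christoffel)+
  note simps = mixed pure product_christoffel[OF z] sum_UNIV_Plus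
    pderiv_pullback_fst[OF open_UNIV sm(1) UNIV_I z] pderiv_pullback_snd[OF open_UNIV sm(2) UNIV_I z]
  show ?thesis
    by (simp add: vec_eq_iff split_sum_all ricci_def riemann_def simps)
qed

end

text \<open>The hypothesis on the tractor metrics says that the two Einstein constants are opposite and
  different from zero, since \<open>|I|\<^sup>2 = - 2 \<mu>\<close>.\<close>

locale special_product = product_manifold A1 g1 A2 g2
  for A1 :: "('i, 'a::{second_countable_topology, t2_space}, 'm::finite) atlas" and g1
    and A2 :: "('j, 'b::{second_countable_topology, t2_space}, 'n::finite) atlas" and g2 +
  fixes \<mu>1 \<mu>2 :: real
  assumes einstein: "einstein_manifold A1 g1 \<mu>1" "einstein_manifold A2 g2 \<mu>2"
    and dim: "CARD('m) + CARD('n) \<ge> 3"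
    and opposite: "\<mu>2 = - \<mu>1" and nonzero: "\<mu>1 \<noteq> 0"
begin

lemma dim_product: "CARD('m + 'n) \<ge> 3"
  using dim by simp

text \<open>With \<open>\<mu>2 = - \<mu>1\<close> the trace of \<open>P = \<mu>1 g1 + \<mu>2 g2\<close> is \<open>\<mu>1 (m - n)\<close>, and then
  \<open>(m + n - 2) P + (tr P) g\<close> is equal to \<open>2 (m - 1) \<mu>1 g1 + 2 (n - 1) \<mu>2 g2\<close>, the Ricci tensor.\<close>

lemma product_schouten:
  assumes z: "(p, q) \<in> chart_dom (A (i, j))"
  shows "schouten A g (i, j) (p, q) = block_diag (\<mu>1 *\<^sub>R g1 i p) (\<mu>2 *\<^sub>R g2 j q)"
proof -
  let ?P = "block_diag (\<mu>1 *\<^sub>R g1 i p) (\<mu>2 *\<^sub>R g2 j q)"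
  let ?m = "real CARD('m)" and ?n = "real CARD('n)"
  interpret R: metric_region A "(i, j)" UNIV g
    by (rule region) simp
  note z' = UNIV_I z
  have dom: "p \<in> chart_dom (A1 i)" "q \<in> chart_dom (A2 j)"
    using z by (simp_all add: product_dom)
  have tr1: "metric_trace (g1 i p) (g1 i p) = ?m"
    using metric_region.metric_transpose[OF M1.region[OF open_UNIV] UNIV_I dom(1)]
    by (intro metric_trace_self M1.invertible_metric dom)
  have tr2: "metric_trace (g2 j q) (g2 j q) = ?n"
    using metric_region.metric_transpose[OF M2.region[OF open_UNIV] UNIV_I dom(2)]
    by (intro metric_trace_self M2.invertible_metric dom)
  have "metric_trace (g (i, j) (p, q)) ?P = metric_trace (g1 i p) (\<mu>1 *\<^sub>R g1 i p)
      + metric_trace (g2 j q) (\<mu>2 *\<^sub>R g2 j q)"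
    by (simp add: metric_trace_def inverse_product_metric[OF dom] sum_UNIV_Plus)
  then have tr: "metric_trace (g (i, j) (p, q)) ?P = \<mu>1 * (?m - ?n)"
    by (simp only: metric_trace_scaleR tr1 tr2) (simp add: opposite right_diff_distrib)
  have "ricci A g (i, j) (p, q) = (real CARD('m + 'n) - 2) *\<^sub>R ?P
      + metric_trace (g (i, j) (p, q)) ?P *\<^sub>R g (i, j) (p, q)"
    unfolding tr product_ricci[OF z] einstein_ricci[OF einstein(1) dom(1)]
      einstein_ricci[OF einstein(2) dom(2)]
    by (simp add: vec_eq_iff split_sum_all product_metric_simp opposite algebra_simps)
  then show ?thesis
    using schouten_iff[of g "(i, j)" "(p, q)" A ?P, OF R.metric_invertible[OF z']
        R.metric_transpose[OF z'] dim_product] by simp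
qed

text \<open>The Christoffel symbols of the product do not mix the factors, and the Schouten tensor acts as
  \<open>\<mu>1\<close> on the first and as \<open>\<mu>2\<close> on the second factor. The vectors \<open>t1\<close> and \<open>t2\<close> are the components
  of the middle slot, with the index raised, tangent to the factors.\<close>

lemma product_tractor_deriv:
  fixes X :: "'a \<times> 'b \<Rightarrow> ('m + 'n) triple"
  assumes W: "open W" and z: "(p, q) \<in> W" "(p, q) \<in> chart_dom (A (i, j))"
    and sm: "smooth_in_chart (A (i, j)) W (\<lambda>z. matrix_inv (g1 i (fst z)) *v left_part (fst (snd (X z))))"
      "smooth_in_chart (A (i, j)) W (\<lambda>z. matrix_inv (g2 j (snd z)) *v right_part (fst (snd (X z))))"
  defines "t1 \<equiv> \<lambda>z. matrix_inv (g1 i (fst z)) *v left_part (fst (snd (X z)))"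
    and "t2 \<equiv> \<lambda>z. matrix_inv (g2 j (snd z)) *v right_part (fst (snd (X z)))"
    and "D \<equiv> pderiv_chart (A (i, j))"
  shows "normal_tractor_deriv A g (i, j) (Inl a) X (p, q) = 0 \<longleftrightarrow>
      D (Inl a) (\<lambda>z. fst (X z)) (p, q) = fst (snd (X (p, q))) $ Inl a \<and>
      (\<forall>b. D (Inl a) (\<lambda>z. t1 z $ b) (p, q) + (\<Sum>c\<in>UNIV. christoffel A1 g1 i p b a c * t1 (p, q) $ c)
        + (if b = a then snd (snd (X (p, q))) + \<mu>1 * fst (X (p, q)) else 0) = 0) \<and>
      (\<forall>b. D (Inl a) (\<lambda>z. t2 z $ b) (p, q) = 0) \<and>
      D (Inl a) (\<lambda>z. snd (snd (X z))) (p, q) = \<mu>1 * fst (snd (X (p, q))) $ Inl a" (is ?L)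
    and "normal_tractor_deriv A g (i, j) (Inr e) X (p, q) = 0 \<longleftrightarrow>
      D (Inr e) (\<lambda>z. fst (X z)) (p, q) = fst (snd (X (p, q))) $ Inr e \<and>
      (\<forall>b. D (Inr e) (\<lambda>z. t1 z $ b) (p, q) = 0) \<and>
      (\<forall>b. D (Inr e) (\<lambda>z. t2 z $ b) (p, q) + (\<Sum>c\<in>UNIV. christoffel A2 g2 j q b e c * t2 (p, q) $ c)
        + (if b = e then snd (snd (X (p, q))) + \<mu>2 * fst (X (p, q)) else 0) = 0) \<and>
      D (Inr e) (\<lambda>z. snd (snd (X z))) (p, q) = \<mu>2 * fst (snd (X (p, q))) $ Inr e" (is ?R)
proof -
  interpret R: metric_region A "(i, j)" W g
    by (rule region) (rule W)
  have dom: "p \<in> chart_dom (A1 i)" "q \<in> chart_dom (A2 j)"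
    using z by (simp_all add: product_dom)
  let ?m = "fst (snd (X (p, q)))"
  have raise: "matrix_inv (g (i, j) (p', q')) *v fst (snd (X (p', q'))) = join (t1 (p', q')) (t2 (p', q'))"
    if "(p', q') \<in> chart_dom (A (i, j))" for p' q'
    using that by (simp add: product_dom inverse_product_metric block_diag_mult t1_def t2_def)
  have d: "D k (\<lambda>z. (matrix_inv (g (i, j) z) *v fst (snd (X z))) $ Inl b) (p, q) =
      D k (\<lambda>z. t1 z $ b) (p, q)"
    "D k (\<lambda>z. (matrix_inv (g (i, j) z) *v fst (snd (X z))) $ Inr b') (p, q) =
      D k (\<lambda>z. t2 z $ b') (p, q)" for k b b'
    unfolding D_def t1_def t2_def
    by (rule R.pderiv_cong[OF _ _ z, symmetric];
        use R.smooth_nth[OF sm(1)] R.smooth_nth[OF sm(2)] raise in \<open>auto simp: t1_def t2_def\<close>)+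
  have lower: "(\<Sum>c\<in>UNIV. g1 i p $ a $ c * t1 (p, q) $ c) = ?m $ Inl a"
    "(\<Sum>c\<in>UNIV. g2 j q $ e $ c * t2 (p, q) $ c) = ?m $ Inr e" for a e
  proof -
    have "g1 i p *v t1 (p, q) = left_part ?m" "g2 j q *v t2 (p, q) = right_part ?m"
      by (simp_all add: t1_def t2_def matrix_vector_mul_assoc
          matrix_inv_inverse[OF M1.invertible_metric[OF dom(1)]]
          matrix_inv_inverse[OF M2.invertible_metric[OF dom(2)]])
    from arg_cong[OF this(1), of "\<lambda>v. v $ a"] arg_cong[OF this(2), of "\<lambda>v. v $ e"]
    show "(\<Sum>c\<in>UNIV. g1 i p $ a $ c * t1 (p, q) $ c) = ?m $ Inl a"
      "(\<Sum>c\<in>UNIV. g2 j q $ e $ c * t2 (p, q) $ c) = ?m $ Inr e"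
      by (simp_all add: matrix_vector_mult_def)
  qed
  have HG: "(\<Sum>c\<in>UNIV. matrix_inv (g1 i p) $ b $ c * g1 i p $ a $ c) = (if b = a then 1 else 0)"
    "(\<Sum>c\<in>UNIV. matrix_inv (g2 j q) $ b' $ c * g2 j q $ e $ c) = (if b' = e then 1 else 0)" for a b b' e
    using metric_region.metric_inverse_metric(2)[OF M1.region[OF open_UNIV] UNIV_I dom(1), of b a]
      metric_region.metric_inverse_metric(2)[OF M2.region[OF open_UNIV] UNIV_I dom(2), of b' e]
    by (simp_all add: metric_region.metric_sym[OF M1.region[OF open_UNIV] UNIV_I dom(1), of a]
        metric_region.metric_sym[OF M2.region[OF open_UNIV] UNIV_I dom(2), of e])
  note simps = R.normal_tractor_deriv_eq_0_iff split_sum_all sum_UNIV_Plus product_schouten[OF z(2)]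
    product_christoffel[OF z(2)] inverse_product_metric[OF dom] raise[OF z(2)]
  have 1: "(\<Sum>c\<in>UNIV. matrix_inv (g1 i p) $ b $ c * (\<mu>1 * g1 i p $ a $ c)) = (if b = a then \<mu>1 else 0)"
    "(\<Sum>c\<in>UNIV. matrix_inv (g2 j q) $ b' $ c * (\<mu>2 * g2 j q $ e $ c)) = (if b' = e then \<mu>2 else 0)"
    "(\<Sum>c\<in>UNIV. \<mu>1 * g1 i p $ a $ c * t1 (p, q) $ c) = \<mu>1 * ?m $ Inl a"
    "(\<Sum>c\<in>UNIV. \<mu>2 * g2 j q $ e $ c * t2 (p, q) $ c) = \<mu>2 * ?m $ Inr e" for a b b' e
    using HG(1)[of b a] HG(2)[of b' e] lower(1)[of a] lower(2)[of e]
    by (simp_all add: mult.left_commute[of _ \<mu>1] mult.left_commute[of _ \<mu>2] mult.assoc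
        flip: sum_distrib_left)
  note raise' = raise[OF z(2), unfolded inverse_product_metric[OF dom]]
  show ?L ?R
    unfolding simps D_def[symmetric] d
    by (simp_all add: 1 raise' mult.commute[of "fst (X (p, q))"] add.assoc cong: if_cong)
qed

end

section \<open>Unique continuation\<close>

text \<open>On a ball of radius less than \<open>1 / B\<close> the mean value inequality bounds the maximum of \<open>|F|\<close>
  by a proper fraction of itself.\<close>

lemma linear_growth_zero:
  fixes F :: "'a::euclidean_space \<Rightarrow> 'b::real_normed_vector"
  assumes "0 < r" and der: "\<And>x. x \<in> cball x0 r \<Longrightarrow> (F has_derivative F' x) (at x)"
    and bound: "\<And>x v. x \<in> cball x0 r \<Longrightarrow> norm (F' x v) \<le> B * norm (F x) * norm v"
    and zero: "F x0 = 0"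
  shows "\<exists>\<delta>>0. \<forall>x\<in>ball x0 \<delta>. F x = 0"
proof -
  define \<delta> where "\<delta> = min r (1 / (2 * (\<bar>B\<bar> + 1)))"
  have \<delta>: "0 < \<delta>" "\<delta> \<le> r" "\<bar>B\<bar> * \<delta> \<le> 1 / 2"
  proof -
    show "0 < \<delta>" "\<delta> \<le> r" using \<open>0 < r\<close> by (auto simp: \<delta>_def)
    have "\<bar>B\<bar> * \<delta> \<le> \<bar>B\<bar> * (1 / (2 * (\<bar>B\<bar> + 1)))"
      by (intro mult_left_mono) (auto simp: \<delta>_def)
    also have "\<dots> \<le> 1 / 2"
      by (simp add: field_simps)
    finally show "\<bar>B\<bar> * \<delta> \<le> 1 / 2" .
  qed
  let ?S = "cball x0 \<delta>"
  have S: "x \<in> cball x0 r" if "x \<in> ?S" for x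
    using that \<delta>(2) by auto
  have "continuous_on ?S (\<lambda>x. norm (F x))"
    by (intro continuous_on_norm continuous_at_imp_continuous_on ballI)
      (use der S has_derivative_continuous in blast)
  then obtain x1 where x1: "x1 \<in> ?S" "\<And>x. x \<in> ?S \<Longrightarrow> norm (F x) \<le> norm (F x1)"
    using continuous_attains_sup[of ?S "\<lambda>x. norm (F x)"] \<delta>(1) by auto
  have "norm (F x1 - F x0) \<le> (\<bar>B\<bar> * norm (F x1)) * norm (x1 - x0)"
  proof (rule differentiable_bound[of ?S F F'])
    show "(F has_derivative F' x) (at x within ?S)" if "x \<in> ?S" for x
      using der[OF S[OF that]] by (rule has_derivative_at_withinI)
    show "onorm (F' x) \<le> \<bar>B\<bar> * norm (F x1)" if "x \<in> ?S" for x
    proof (rule onorm_bound)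
      fix v
      have "norm (F' x v) \<le> B * norm (F x) * norm v"
        by (rule bound[OF S[OF that]])
      also have "\<dots> \<le> \<bar>B\<bar> * norm (F x1) * norm v"
        by (intro mult_right_mono mult_mono x1(2) that) auto
      finally show "norm (F' x v) \<le> \<bar>B\<bar> * norm (F x1) * norm v" .
    qed simp
  qed (use x1 \<delta> in auto)
  also have "\<dots> \<le> (\<bar>B\<bar> * norm (F x1)) * \<delta>"
    using x1(1) by (intro mult_left_mono) (auto simp: dist_norm norm_minus_commute)
  also have "\<dots> = (\<bar>B\<bar> * \<delta>) * norm (F x1)" by simp
  also have "\<dots> \<le> 1 / 2 * norm (F x1)"
    by (intro mult_right_mono \<delta>(3)) simp
  finally have "norm (F x1) \<le> 0"
    by (simp add: zero)
  then have "F x = 0" if "x \<in> ball x0 \<delta>" for x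
    using x1(2)[of x] that by (auto simp: less_imp_le)
  then show ?thesis using \<delta>(1) by blast
qed

context chart_region
begin

lemma open_nonzero_set:
  assumes "smooth f"
  shows "open {p \<in> U \<inter> chart_dom c. f p \<noteq> 0}"
proof -
  have "open (U \<inter> chart_dom c)"
    by (intro open_Int open_U is_chartD(1) chart)
  then have "open ((U \<inter> chart_dom c) \<inter> f -` (- {0}))"
    by (intro continuous_open_preimage smooth_imp_continuous_on assms) auto
  then show ?thesis
    by (simp add: vimage_def Int_def)
qed

text \<open>Zeros of a solution of a linear differential system propagate: \<open>K\<close> is bounded on a compact ball
  in coordinates, where \<open>linear_growth_zero\<close> applies.\<close>

lemma open_zero_set:
  fixes f :: "'a \<Rightarrow> 'b::real_normed_vector"
  assumes sm: "smooth f" and K: "continuous_on (U \<inter> chart_dom c) K"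
    and bound: "\<And>p a. p \<in> U \<Longrightarrow> p \<in> chart_dom c \<Longrightarrow>
      norm (pderiv_chart c a f p) \<le> K p * norm (f p)"
  shows "open {p \<in> U \<inter> chart_dom c. f p = 0}"
proof (subst open_subopen, intro ballI)
  fix p assume p: "p \<in> {p \<in> U \<inter> chart_dom c. f p = 0}"
  let ?S = "coords c ` (U \<inter> chart_dom c)" and ?F = "\<lambda>x. f (chart_inv c x)"
  have "coords c p \<in> ?S" using p by auto
  then obtain r where r: "0 < r" "cball (coords c p) r \<subseteq> ?S"
    using open_contains_cball open_image by blast
  have "continuous_on ?S (\<lambda>x. K (chart_inv c x))"
    by (rule continuous_on_compose2[OF K continuous_on_subset[OF is_chartD(5)[OF chart]]])
      (auto simp: image_chart_inv)
  then have "bounded ((\<lambda>x. K (chart_inv c x)) ` cball (coords c p) r)"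
    by (intro compact_imp_bounded compact_continuous_image compact_cball)
      (use r continuous_on_subset in blast)
  then obtain B where "\<forall>k\<in>(\<lambda>x. K (chart_inv c x)) ` cball (coords c p) r. norm k \<le> B"
    unfolding bounded_iff by blast
  then have B: "\<bar>K (chart_inv c x)\<bar> \<le> B" if "x \<in> cball (coords c p) r" for x
    using that by simp
  let ?F' = "\<lambda>x. frechet_derivative ?F (at x)"
  have "\<exists>\<delta>>0. \<forall>x\<in>ball (coords c p) \<delta>. ?F x = 0"
  proof (rule linear_growth_zero[OF r(1), where F' = ?F' and B = "real CARD('n) * B"])
    fix x assume x: "x \<in> cball (coords c p) r"
    define q where "q = chart_inv c x"
    have "x \<in> ?S" using r(2) x by blast
    note q = image_chart_inv[OF this, folded q_def]
    show "(?F has_derivative ?F' x) (at x)"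
      using has_derivative_in_chart[OF sm q(1,2)] by (simp add: q)
    fix v :: "real^'n"
    have "norm (?F' x v) = norm (\<Sum>a\<in>UNIV. v $ a *\<^sub>R pderiv_chart c a f q)"
      using frechet_derivative_in_chart[OF q(1,2) sm] by (simp add: q(3))
    also have "\<dots> \<le> (\<Sum>a\<in>UNIV. norm (v $ a *\<^sub>R pderiv_chart c a f q))"
      by (rule norm_sum)
    also have "\<dots> \<le> (\<Sum>a\<in>(UNIV :: 'n set). norm v * (B * norm (f q)))"
    proof (rule sum_mono)
      fix a
      have "norm (pderiv_chart c a f q) \<le> K q * norm (f q)"
        by (rule bound[OF q(1,2)])
      also have "\<dots> \<le> B * norm (f q)"
        using B[OF x] by (intro mult_right_mono) (auto simp: q_def)
      finally show "norm (v $ a *\<^sub>R pderiv_chart c a f q) \<le> norm v * (B * norm (f q))"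
        using component_le_norm_cart[of v a] by (simp add: mult_mono)
    qed
    also have "\<dots> = real CARD('n) * B * norm (?F x) * norm v"
      by (simp add: q_def)
    finally show "norm (?F' x v) \<le> real CARD('n) * B * norm (?F x) * norm v" .
  qed (use p is_chartD(2)[OF chart] in auto)
  then obtain \<delta> where \<delta>: "0 < \<delta>" "\<And>x. x \<in> ball (coords c p) \<delta> \<Longrightarrow> ?F x = 0" by blast
  have "open (chart_dom c)" by (rule is_chartD(1)[OF chart])
  then have "open (chart_dom c \<inter> coords c -` ball (coords c p) \<delta>)"
    by (intro continuous_open_preimage is_chartD(4) chart) auto
  then have "open (U \<inter> (chart_dom c \<inter> coords c -` ball (coords c p) \<delta>))"
    by (rule open_Int[OF open_U])
  moreover have "f q = 0" if "q \<in> chart_dom c" "coords c q \<in> ball (coords c p) \<delta>" for q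
    using \<delta>(2)[OF that(2)] that(1) by (simp add: is_chartD(2)[OF chart])
  ultimately show "\<exists>T. open T \<and> p \<in> T \<and> T \<subseteq> {p \<in> U \<inter> chart_dom c. f p = 0}"
    using p \<delta>(1) by (intro exI[of _ "U \<inter> (chart_dom c \<inter> coords c -` ball (coords c p) \<delta>)"]) auto
qed

end

text \<open>The derivative that a parallel Einstein triple must have in the direction \<open>a\<close>.\<close>

definition einstein_rhs ::
  "('n \<Rightarrow> 'n \<Rightarrow> real) \<Rightarrow> ('n \<Rightarrow> 'n \<Rightarrow> 'n \<Rightarrow> real) \<Rightarrow> real \<Rightarrow> 'n \<Rightarrow> 'n::finite triple \<Rightarrow> 'n triple" where
  "einstein_rhs G V \<mu> a x =
    (\<Sum>b\<in>UNIV. G a b * fst (snd x) $ b,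
     \<chi> b. - (\<Sum>c\<in>UNIV. V b a c * fst (snd x) $ c) - (if b = a then snd (snd x) + \<mu> * fst x else 0),
     \<mu> * (\<Sum>b\<in>UNIV. G a b * fst (snd x) $ b))"

lemma einstein_rhs_bound:
  "norm (einstein_rhs G V \<mu> a x) \<le> ((1 + \<bar>\<mu>\<bar>) * (\<Sum>a\<in>UNIV. \<Sum>b\<in>UNIV. \<bar>G a b\<bar>)
    + (\<Sum>a\<in>UNIV. \<Sum>b\<in>UNIV. (\<Sum>c\<in>UNIV. \<bar>V b a c\<bar>) + (1 + \<bar>\<mu>\<bar>))) * norm x"
proof -
  obtain s t r where x: "x = (s, t, r)" by (cases x)
  have "norm t \<le> norm (t, r)" "norm (t, r) \<le> norm x" "\<bar>s\<bar> \<le> norm x" "\<bar>r\<bar> \<le> norm (t, r)"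
    using norm_fst_le[of t r] norm_snd_le[of "(t, r)" s] norm_fst_le[of s "(t, r)"] norm_snd_le[of r t]
    by (auto simp: x)
  then have nx: "norm t \<le> norm x" "\<bar>s\<bar> \<le> norm x" "\<bar>r\<bar> \<le> norm x"
    by linarith+
  have comp: "\<bar>t $ b\<bar> \<le> norm x" for b
    using component_le_norm_cart[of t b] nx(1) by linarith
  have lin: "\<bar>\<Sum>b\<in>UNIV. w b * t $ b\<bar> \<le> (\<Sum>b\<in>UNIV. \<bar>w b\<bar>) * norm x" for w
    unfolding sum_distrib_right
    by (rule order.trans[OF sum_abs sum_mono]) (simp add: abs_mult comp mult_left_mono)
  let ?G = "\<Sum>b\<in>UNIV. G a b * t $ b"
  have "(\<Sum>b\<in>UNIV. \<bar>G a b\<bar>) \<le> (\<Sum>a\<in>UNIV. \<Sum>b\<in>UNIV. \<bar>G a b\<bar>)"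
    by (rule member_le_sum[where f = "\<lambda>a. \<Sum>b\<in>UNIV. \<bar>G a b\<bar>"]) (auto intro: sum_nonneg)
  then have G: "\<bar>?G\<bar> \<le> (\<Sum>a\<in>UNIV. \<Sum>b\<in>UNIV. \<bar>G a b\<bar>) * norm x"
    using order.trans[OF lin[of "G a"] mult_right_mono[OF _ norm_ge_zero]] by blast
  let ?V = "\<chi> b. - (\<Sum>c\<in>UNIV. V b a c * t $ c) - (if b = a then r + \<mu> * s else 0)"
  have "norm ?V \<le> (\<Sum>b\<in>UNIV. \<bar>?V $ b\<bar>)"
    by (rule norm_le_l1_cart)
  also have "\<dots> \<le> (\<Sum>b\<in>UNIV. ((\<Sum>c\<in>UNIV. \<bar>V b a c\<bar>) + (1 + \<bar>\<mu>\<bar>)) * norm x)"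
  proof (rule sum_mono)
    fix b
    have "\<bar>r + \<mu> * s\<bar> \<le> \<bar>r\<bar> + \<bar>\<mu>\<bar> * \<bar>s\<bar>"
      using abs_triangle_ineq[of r "\<mu> * s"] by (simp add: abs_mult)
    also have "\<dots> \<le> norm x + \<bar>\<mu>\<bar> * norm x"
      using nx by (intro add_mono mult_left_mono) auto
    finally have e: "\<bar>if b = a then r + \<mu> * s else 0\<bar> \<le> norm x + \<bar>\<mu>\<bar> * norm x"
      by (simp split: if_splits)
    have "\<bar>?V $ b\<bar> \<le> \<bar>\<Sum>c\<in>UNIV. V b a c * t $ c\<bar> + \<bar>if b = a then r + \<mu> * s else 0\<bar>"
      by simp
    also have "\<dots> \<le> (\<Sum>c\<in>UNIV. \<bar>V b a c\<bar>) * norm x + (norm x + \<bar>\<mu>\<bar> * norm x)"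
      using lin[of "V b a"] e by linarith
    finally show "\<bar>?V $ b\<bar> \<le> ((\<Sum>c\<in>UNIV. \<bar>V b a c\<bar>) + (1 + \<bar>\<mu>\<bar>)) * norm x"
      by (simp add: algebra_simps)
  qed
  also have "\<dots> = (\<Sum>b\<in>UNIV. (\<Sum>c\<in>UNIV. \<bar>V b a c\<bar>) + (1 + \<bar>\<mu>\<bar>)) * norm x"
    by (simp add: sum_distrib_right)
  also have "\<dots> \<le> (\<Sum>a\<in>UNIV. \<Sum>b\<in>UNIV. (\<Sum>c\<in>UNIV. \<bar>V b a c\<bar>) + (1 + \<bar>\<mu>\<bar>)) * norm x"
    by (intro mult_right_mono member_le_sum[where f = "\<lambda>a. \<Sum>b\<in>UNIV. (\<Sum>c\<in>UNIV. \<bar>V b a c\<bar>) + (1 + \<bar>\<mu>\<bar>)"])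
      (auto intro!: sum_nonneg add_nonneg_nonneg)
  finally have V: "norm ?V \<le> (\<Sum>a\<in>UNIV. \<Sum>b\<in>UNIV. (\<Sum>c\<in>UNIV. \<bar>V b a c\<bar>) + (1 + \<bar>\<mu>\<bar>)) * norm x" .
  have "norm (einstein_rhs G V \<mu> a x) \<le> \<bar>?G\<bar> + (norm ?V + \<bar>\<mu>\<bar> * \<bar>?G\<bar>)"
    unfolding einstein_rhs_def x fst_conv snd_conv
    using norm_Pair_le[of ?G "(?V, \<mu> * ?G)"] norm_Pair_le[of ?V "\<mu> * ?G"] by (simp add: abs_mult)
  also have "\<dots> = (1 + \<bar>\<mu>\<bar>) * \<bar>?G\<bar> + norm ?V"
    by (simp add: algebra_simps)
  also have "\<dots> \<le> (1 + \<bar>\<mu>\<bar>) * ((\<Sum>a\<in>UNIV. \<Sum>b\<in>UNIV. \<bar>G a b\<bar>) * norm x)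
      + (\<Sum>a\<in>UNIV. \<Sum>b\<in>UNIV. (\<Sum>c\<in>UNIV. \<bar>V b a c\<bar>) + (1 + \<bar>\<mu>\<bar>)) * norm x"
    using G V by (intro add_mono mult_left_mono) auto
  finally show ?thesis
    by (simp add: distrib_right mult.assoc)
qed

text \<open>The alternative in the hypothesis on the derivatives covers fields on a product that are constant
  along one factor and satisfy the Einstein system along the other.\<close>

lemma (in chart_region) open_zero_set_einstein:
  fixes f :: "'a \<Rightarrow> 'm::finite triple"
  assumes sm: "smooth f" "\<And>a b. smooth (\<lambda>p. G p a b)" "\<And>b a c. smooth (\<lambda>p. V p b a c)"
    and sys: "\<And>p k. p \<in> U \<Longrightarrow> p \<in> chart_dom c \<Longrightarrow>
      pderiv_chart c k f p = 0 \<or> (\<exists>a. pderiv_chart c k f p = einstein_rhs (G p) (V p) \<mu> a (f p))"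
  shows "open {p \<in> U \<inter> chart_dom c. f p = 0}"
proof (rule open_zero_set[OF sm(1)])
  let ?K = "\<lambda>p. (1 + \<bar>\<mu>\<bar>) * (\<Sum>a\<in>UNIV. \<Sum>b\<in>UNIV. \<bar>G p a b\<bar>)
    + (\<Sum>a\<in>UNIV. \<Sum>b\<in>UNIV. (\<Sum>c\<in>UNIV. \<bar>V p b a c\<bar>) + (1 + \<bar>\<mu>\<bar>))"
  show "continuous_on (U \<inter> chart_dom c) ?K"
    by (intro continuous_intros smooth_imp_continuous_on sm)
  show "norm (pderiv_chart c k f p) \<le> ?K p * norm (f p)" if "p \<in> U" "p \<in> chart_dom c" for k p
  proof -
    have "0 \<le> ?K p * norm (f p)"
      by (intro mult_nonneg_nonneg add_nonneg_nonneg sum_nonneg) auto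
    then show ?thesis
      using sys[OF that, of k] einstein_rhs_bound[of "G p" "V p" \<mu> _ "f p"] by auto
  qed
qed

lemma (in chart_region) pderiv_triple_eq_iff:
  fixes f :: "'a \<Rightarrow> 'm::finite triple"
  assumes "smooth f" "p \<in> U" "p \<in> chart_dom c"
  shows "pderiv_chart c k f p = x \<longleftrightarrow> pderiv_chart c k (\<lambda>q. fst (f q)) p = fst x \<and>
    (\<forall>b. pderiv_chart c k (\<lambda>q. fst (snd (f q)) $ b) p = fst (snd x) $ b) \<and>
    pderiv_chart c k (\<lambda>q. snd (snd (f q))) p = snd (snd x)"
proof -
  note p = assms(2,3) and sm = assms(1)
  note lin = bounded_linear_fst bounded_linear_snd
    bounded_linear_compose[OF bounded_linear_fst bounded_linear_snd]
    bounded_linear_compose[OF bounded_linear_snd bounded_linear_snd]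
  have "pderiv_chart c k (\<lambda>q. fst (f q)) p = fst (pderiv_chart c k f p)"
    "pderiv_chart c k (\<lambda>q. snd (snd (f q))) p = snd (snd (pderiv_chart c k f p))"
    "pderiv_chart c k (\<lambda>q. fst (snd (f q)) $ b) p = fst (snd (pderiv_chart c k f p)) $ b" for b
    using pderiv_linear[OF p lin(1) sm] pderiv_linear[OF p lin(4) sm]
      pderiv_linear[OF p bounded_linear_compose[OF bounded_linear_vec_nth lin(3)] sm, of k b]
    by simp_all
  then show ?thesis
    by (simp add: prod_eq_iff vec_eq_iff)
qed

lemma (in metric_region) parallel_einstein_iff:
  assumes "smooth X" "p \<in> U" "p \<in> chart_dom (A i)"
  shows "einstein_tractor_deriv A g \<mu> i a X p = 0 \<longleftrightarrow>
    D a X p = einstein_rhs (\<lambda>a b. g i p $ a $ b) (\<Gamma> p) \<mu> a (X p)"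
proof -
  have "einstein_tractor_deriv A g \<mu> i a X p = 0 \<longleftrightarrow>
      D a (\<lambda>q. fst (X q)) p - (g i p *v fst (snd (X p))) $ a = 0 \<and>
      (\<forall>b. D a (\<lambda>q. fst (snd (X q)) $ b) p + (\<Sum>c\<in>UNIV. \<Gamma> p b a c * fst (snd (X p)) $ c)
        + (snd (snd (X p)) + \<mu> * fst (X p)) * axis a 1 $ b = 0) \<and>
      D a (\<lambda>q. snd (snd (X q))) p - \<mu> * (g i p *v fst (snd (X p))) $ a = 0"
    by (simp add: einstein_tractor_deriv_def Let_def cov_deriv_def zero_prod_def vec_eq_iff)
  also have "\<dots> \<longleftrightarrow> D a X p = einstein_rhs (\<lambda>a b. g i p $ a $ b) (\<Gamma> p) \<mu> a (X p)"
    unfolding pderiv_triple_eq_iff[OF assms] einstein_rhs_def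
    by (auto simp: matrix_vector_mult_def axis_def algebra_simps eq_neg_iff_add_eq_0 split: if_splits)
  finally show ?thesis .
qed

section \<open>Zero sets on connected manifolds\<close>

text \<open>The set \<open>Z\<close> of zeros is allowed to refer to the member \<open>U\<close> of the cover, because an almost Einstein
  structure provides a section on \<open>U\<close> only, but its zeros do not depend on \<open>U\<close>.\<close>

lemma zero_dichotomy:
  assumes "connected (UNIV :: 'a::topological_space set)" and cover: "\<Union>\<U> = (UNIV :: 'a set)"
    and opens: "\<And>U. U \<in> \<U> \<Longrightarrow> open {p \<in> U. Z U p}" "\<And>U. U \<in> \<U> \<Longrightarrow> open {p \<in> U. \<not> Z U p}"
    and consistent: "\<And>U V p. U \<in> \<U> \<Longrightarrow> V \<in> \<U> \<Longrightarrow> p \<in> U \<Longrightarrow> p \<in> V \<Longrightarrow> Z U p \<Longrightarrow> Z V p"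
  shows "(\<forall>U\<in>\<U>. \<forall>p\<in>U. Z U p) \<or> (\<forall>U\<in>\<U>. \<forall>p\<in>U. \<not> Z U p)"
proof -
  let ?P = "\<Union>U\<in>\<U>. {p \<in> U. Z U p}" and ?N = "\<Union>U\<in>\<U>. {p \<in> U. \<not> Z U p}"
  have "open ?P" "open ?N"
    using opens by blast+
  moreover have "?P \<inter> ?N = {}"
    using consistent by blast
  moreover have "?P \<union> ?N = UNIV"
    using cover by blast
  ultimately have "?P = {} \<or> ?N = {}"
    using connectedD[OF assms(1), of ?P ?N] by blast
  then show ?thesis by blast
qed

lemma open_vanishing_set:
  fixes S :: "'k \<Rightarrow> 'a::topological_space \<Rightarrow> 'n::finite triple"
  assumes cover: "\<And>p. \<exists>k. p \<in> D k"
    and indep: "\<And>k l p. p \<in> U \<Longrightarrow> p \<in> D k \<Longrightarrow> p \<in> D l \<Longrightarrow> S k p = 0 \<Longrightarrow> S l p = 0"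
    and opens: "\<And>k. open {p \<in> U \<inter> D k. S k p = 0}" "\<And>k. open {p \<in> U \<inter> D k. S k p \<noteq> 0}"
  shows "open {p \<in> U. vanishes_on D {p} S}" "open {p \<in> U. \<not> vanishes_on D {p} S}"
proof -
  have "{p \<in> U. vanishes_on D {p} S} = (\<Union>k. {p \<in> U \<inter> D k. S k p = 0})"
  proof (intro set_eqI iffI)
    fix p assume p: "p \<in> {p \<in> U. vanishes_on D {p} S}"
    obtain k where "p \<in> D k" using cover by blast
    then show "p \<in> (\<Union>k. {p \<in> U \<inter> D k. S k p = 0})"
      using p by (auto simp: vanishes_on_def)
  next
    fix p assume "p \<in> (\<Union>k. {p \<in> U \<inter> D k. S k p = 0})"
    then obtain k where "p \<in> U" "p \<in> D k" "S k p = 0" by blast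
    then show "p \<in> {p \<in> U. vanishes_on D {p} S}"
      using indep[of p k] by (auto simp: vanishes_on_def)
  qed
  moreover have "{p \<in> U. \<not> vanishes_on D {p} S} = (\<Union>k. {p \<in> U \<inter> D k. S k p \<noteq> 0})"
    by (auto simp: vanishes_on_def)
  ultimately show "open {p \<in> U. vanishes_on D {p} S}" "open {p \<in> U. \<not> vanishes_on D {p} S}"
    using opens by auto
qed

lemma vanishes_on_sign:
  assumes "vanishes_on D {p} (\<lambda>k q. S k q - T k q) \<or> vanishes_on D {p} (\<lambda>k q. S k q + T k q)"
    and "vanishes_on D {p} S"
  shows "vanishes_on D {p} T"
  using assms by (force simp: vanishes_on_def)

text \<open>Directed structures are almost structures for the cover by the whole manifold. This permits to
  treat both parts of the theorem at once, as long as the covers are kept track of.\<close>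

lemma directed_structure_iff:
  "directed_structure D par S \<longleftrightarrow> almost_structure D par {UNIV} (\<lambda>_. S)"
  by (simp add: directed_structure_def almost_structure_def) (auto simp: vanishes_on_def)

lemma almost_structure_singleton:
  "almost_structure D par {UNIV} I \<longleftrightarrow> directed_structure D par (I UNIV)"
  by (simp add: directed_structure_def almost_structure_def) (auto simp: vanishes_on_def)

section \<open>Einstein tractors of a factor\<close>

text \<open>The tractor metric pairs \<open>(s, t, r)\<close> with the Einstein tractor \<open>(1, 0, - \<mu>)\<close> to \<open>r - \<mu> s\<close>.\<close>

definition orthogonal_parallel ::
  "('i, 'a, 'n::finite) atlas \<Rightarrow> ('i, 'a, 'n) metric_comps \<Rightarrow> real \<Rightarrow> 'a set
     \<Rightarrow> ('i, 'a, 'n) triple_field \<Rightarrow> bool" where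
  "orthogonal_parallel A g \<mu> U S \<longleftrightarrow> parallel_einstein_on A g \<mu> U S \<and>
    (\<forall>i. \<forall>p\<in>U \<inter> chart_dom (A i). snd (snd (S i p)) = \<mu> * fst (S i p))"

locale einstein_factor = riemannian_manifold A g
  for A :: "('i, 'a::{second_countable_topology, t2_space}, 'n::finite) atlas"
    and g :: "('i, 'a, 'n) metric_comps" +
  fixes \<mu> :: real
  assumes \<mu>: "\<mu> \<noteq> 0"
begin

abbreviation "doms \<equiv> \<lambda>i. chart_dom (A i)"
abbreviation "par \<equiv> parallel_einstein_on A g \<mu>"
abbreviation "orth \<equiv> orthogonal_parallel A g \<mu>"

lemma par_iff:
  assumes "open U"
  shows "par U S \<longleftrightarrow> (\<forall>i. smooth_in_chart (A i) U (S i)) \<and>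
    (\<forall>i j. \<forall>p\<in>U \<inter> doms i \<inter> doms j. S j p =
      (fst (S i p), chart_jacobian (A i) (A j) p *v fst (snd (S i p)), snd (snd (S i p)))) \<and>
    (\<forall>i a. \<forall>p\<in>U \<inter> doms i. pderiv_chart (A i) a (S i) p =
      einstein_rhs (\<lambda>a b. g i p $ a $ b) (christoffel A g i p) \<mu> a (S i p))"
  unfolding parallel_einstein_on_def einstein_triple_on_def case_prod_beta
  using metric_region.parallel_einstein_iff[OF region[OF assms]] by (metis IntE)

lemma par_zero_iff:
  assumes "open U" "par U S" "p \<in> U" "p \<in> doms i" "p \<in> doms j" "S i p = 0"
  shows "S j p = 0"
proof -
  have "S j p = (fst (S i p), chart_jacobian (A i) (A j) p *v fst (snd (S i p)), snd (snd (S i p)))"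
    using assms unfolding par_iff[OF assms(1)] by blast
  then show ?thesis
    by (simp add: assms(6) zero_prod_def)
qed

lemma par_open_zero_set:
  assumes U: "open U" and S: "par U S"
  shows "open {p \<in> U. vanishes_on doms {p} S}" "open {p \<in> U. \<not> vanishes_on doms {p} S}"
proof -
  have opens: "open {p \<in> U \<inter> doms i. S i p = 0}" "open {p \<in> U \<inter> doms i. S i p \<noteq> 0}" for i
  proof -
    interpret metric_region A i U g by (rule region[OF U])
    have sm: "smooth (S i)" using S par_iff[OF U] by blast
    show "open {p \<in> U \<inter> doms i. S i p \<noteq> 0}"
      by (rule open_nonzero_set[OF sm])
    show "open {p \<in> U \<inter> doms i. S i p = 0}"
      by (rule open_zero_set_einstein[where G = "\<lambda>p a b. g i p $ a $ b" and V = \<Gamma> and \<mu> = \<mu>])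
        (use sm smooth_metric_comp christoffel_smooth S par_iff[OF U] in blast)+
  qed
  show "open {p \<in> U. vanishes_on doms {p} S}" "open {p \<in> U. \<not> vanishes_on doms {p} S}"
    by (rule open_vanishing_set[OF charts(2) par_zero_iff[OF U S] opens]; assumption)+
qed

lemma par_linear:
  assumes "open U" "par U S" "par U T"
  shows "par U (\<lambda>i p. \<alpha> *\<^sub>R S i p + \<beta> *\<^sub>R T i p)"
  unfolding par_iff[OF assms(1)]
proof (intro conjI allI ballI)
  note ST = assms(2,3)[unfolded par_iff[OF assms(1)]]
  fix i
  interpret metric_region A i U g by (rule region[OF assms(1)])
  have sm: "smooth (S i)" "smooth (T i)" using ST by blast+
  then show "smooth (\<lambda>p. \<alpha> *\<^sub>R S i p + \<beta> *\<^sub>R T i p)"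
    by (intro smooth_add smooth_linear[OF bounded_linear_scaleR_right])
  show "\<alpha> *\<^sub>R S j p + \<beta> *\<^sub>R T j p = (fst (\<alpha> *\<^sub>R S i p + \<beta> *\<^sub>R T i p),
      chart_jacobian (A i) (A j) p *v fst (snd (\<alpha> *\<^sub>R S i p + \<beta> *\<^sub>R T i p)),
      snd (snd (\<alpha> *\<^sub>R S i p + \<beta> *\<^sub>R T i p)))" if "p \<in> U \<inter> doms i \<inter> doms j" for j p
  proof -
    have "S j p = (fst (S i p), chart_jacobian (A i) (A j) p *v fst (snd (S i p)), snd (snd (S i p)))"
      "T j p = (fst (T i p), chart_jacobian (A i) (A j) p *v fst (snd (T i p)), snd (snd (T i p)))"
      using ST that by blast+
    then show ?thesis
      by (simp add: matrix_vector_right_distrib matrix_vector_mult_scaleR)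
  qed
  fix a p assume p: "p \<in> U \<inter> doms i"
  have "D a (\<lambda>p. \<alpha> *\<^sub>R S i p + \<beta> *\<^sub>R T i p) p = \<alpha> *\<^sub>R D a (S i) p + \<beta> *\<^sub>R D a (T i) p"
    using p sm by (simp add: pderiv_add smooth_linear[OF bounded_linear_scaleR_right]
        pderiv_linear[OF _ _ bounded_linear_scaleR_right])
  also have "\<dots> = \<alpha> *\<^sub>R einstein_rhs (\<lambda>a b. g i p $ a $ b) (\<Gamma> p) \<mu> a (S i p)
      + \<beta> *\<^sub>R einstein_rhs (\<lambda>a b. g i p $ a $ b) (\<Gamma> p) \<mu> a (T i p)"
    using ST p by auto
  also have "\<dots> = einstein_rhs (\<lambda>a b. g i p $ a $ b) (\<Gamma> p) \<mu> a (\<alpha> *\<^sub>R S i p + \<beta> *\<^sub>R T i p)"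
    by (simp add: einstein_rhs_def vec_eq_iff sum_distrib_left sum.distrib[symmetric]
        sum_subtractf[symmetric] algebra_simps)
  finally show "D a (\<lambda>p. \<alpha> *\<^sub>R S i p + \<beta> *\<^sub>R T i p) p =
      einstein_rhs (\<lambda>a b. g i p $ a $ b) (\<Gamma> p) \<mu> a (\<alpha> *\<^sub>R S i p + \<beta> *\<^sub>R T i p)" .
qed

text \<open>The projection onto the orthogonal complement of the Einstein tractor, along the latter.\<close>

definition proj :: "'n triple \<Rightarrow> 'n triple" where
  "proj x = ((fst x + snd (snd x) / \<mu>) / 2, fst (snd x), (\<mu> * fst x + snd (snd x)) / 2)"

lemma bounded_linear_proj: "bounded_linear proj"
  unfolding proj_def
  by (intro bounded_linear_Pair bounded_linear_add bounded_linear_compose[OF bounded_linear_divide]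
      bounded_linear_compose[OF bounded_linear_mult_right]
      bounded_linear_fst bounded_linear_compose[OF bounded_linear_fst bounded_linear_snd]
      bounded_linear_compose[OF bounded_linear_snd bounded_linear_snd])

lemma proj_linear: "proj (x - y) = proj x - proj y" "proj (x + y) = proj x + proj y"
  using bounded_linear_proj by (simp_all add: linear_simps)

lemma proj_orth:
  assumes U: "open U" and S: "par U S"
  shows "orth U (\<lambda>i p. proj (S i p))"
  unfolding orthogonal_parallel_def par_iff[OF U]
proof (intro conjI allI ballI)
  note S = S[unfolded par_iff[OF U]]
  fix i
  interpret metric_region A i U g by (rule region[OF U])
  have sm: "smooth (S i)" using S by blast
  show "smooth (\<lambda>p. proj (S i p))"
    by (rule smooth_linear[OF bounded_linear_proj sm])
  show "proj (S j p) = (fst (proj (S i p)), chart_jacobian (A i) (A j) p *v fst (snd (proj (S i p))),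
      snd (snd (proj (S i p))))" if "p \<in> U \<inter> doms i \<inter> doms j" for j p
  proof -
    have "S j p = (fst (S i p), chart_jacobian (A i) (A j) p *v fst (snd (S i p)), snd (snd (S i p)))"
      using S that by blast
    then show ?thesis by (simp add: proj_def)
  qed
  show "snd (snd (proj (S i p))) = \<mu> * fst (proj (S i p))" for p
    using \<mu> by (simp add: proj_def field_simps)
  fix a p assume p: "p \<in> U \<inter> doms i"
  have "D a (\<lambda>p. proj (S i p)) p = proj (D a (S i) p)"
    using p by (intro pderiv_linear bounded_linear_proj sm) auto
  also have "\<dots> = proj (einstein_rhs (\<lambda>a b. g i p $ a $ b) (\<Gamma> p) \<mu> a (S i p))"
    using S p by auto
  also have "\<dots> = einstein_rhs (\<lambda>a b. g i p $ a $ b) (\<Gamma> p) \<mu> a (proj (S i p))"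
    using \<mu> by (simp add: einstein_rhs_def proj_def vec_eq_iff field_simps)
  finally show "D a (\<lambda>p. proj (S i p)) p =
      einstein_rhs (\<lambda>a b. g i p $ a $ b) (\<Gamma> p) \<mu> a (proj (S i p))" .
qed

lemma par_dichotomy:
  assumes cover: "\<Union>\<U> = UNIV" and opens: "\<And>U. U \<in> \<U> \<Longrightarrow> open U" and par: "\<And>U. U \<in> \<U> \<Longrightarrow> par U (I U)"
    and sign: "\<And>U V p. U \<in> \<U> \<Longrightarrow> V \<in> \<U> \<Longrightarrow> p \<in> U \<Longrightarrow> p \<in> V \<Longrightarrow>
      vanishes_on doms {p} (\<lambda>k q. I U k q - I V k q) \<or> vanishes_on doms {p} (\<lambda>k q. I U k q + I V k q)"
  shows "(\<forall>U\<in>\<U>. \<forall>p\<in>U. vanishes_on doms {p} (I U)) \<or> (\<forall>U\<in>\<U>. \<forall>p\<in>U. \<not> vanishes_on doms {p} (I U))"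
proof (rule zero_dichotomy[OF charts(3) cover])
  show "open {p \<in> U. vanishes_on doms {p} (I U)}" "open {p \<in> U. \<not> vanishes_on doms {p} (I U)}"
    if "U \<in> \<U>" for U
    by (rule par_open_zero_set[OF opens[OF that] par[OF that]])+
  show "vanishes_on doms {p} (I V)"
    if "U \<in> \<U>" "V \<in> \<U>" "p \<in> U" "p \<in> V" "vanishes_on doms {p} (I U)" for U V p
    by (rule vanishes_on_sign[OF sign[OF that(1-4)] that(5)])
qed

lemma almost_structure_nonzero:
  assumes I: "almost_structure doms par \<U> I" and p: "U \<in> \<U>" "p \<in> U"
  shows "\<not> vanishes_on doms {p} (I U)"
proof -
  have "(\<forall>U\<in>\<U>. \<forall>p\<in>U. vanishes_on doms {p} (I U)) \<or> (\<forall>U\<in>\<U>. \<forall>p\<in>U. \<not> vanishes_on doms {p} (I U))"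
    by (rule par_dichotomy) (use I in \<open>auto simp: almost_structure_def\<close>)
  moreover have "\<not> vanishes_on doms U (I U)"
    using I p by (auto simp: almost_structure_def)
  ultimately show ?thesis
    using p by (auto simp: vanishes_on_def)
qed

lemma par_einstein_tractor: "par UNIV (einstein_tractor \<mu>)"
  unfolding par_iff[OF open_UNIV]
  by (auto simp: einstein_tractor_def einstein_rhs_def pderiv_chart_def vec_eq_iff zero_prod_def
      intro!: chart_region.smooth_const chart_region.intro charts)

text \<open>A non-zero multiple of the Einstein tractor is not orthogonal to it, because \<open>|I|\<^sup>2 = - 2 \<mu> \<noteq> 0\<close>, and
  a parallel tractor that is not zero has no zeros at all.\<close>

lemma lin_indep_einstein_tractor:
  assumes F: "almost_structure doms orth \<U> F"
  shows "almost_structure doms par \<U> F"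
    "almost_structure doms par {UNIV} (\<lambda>_. einstein_tractor \<mu>)"
    "almost_lin_indep doms \<U> F {UNIV} (\<lambda>_. einstein_tractor \<mu>)"
proof -
  show par: "almost_structure doms par \<U> F"
    using F by (simp add: almost_structure_def orthogonal_parallel_def)
  obtain p :: 'a where True by blast
  obtain i where "p \<in> doms i" using charts(2) by blast
  then have "\<not> vanishes_on doms UNIV (einstein_tractor \<mu>)"
    by (auto simp: vanishes_on_def einstein_tractor_def zero_prod_def)
  then show "almost_structure doms par {UNIV} (\<lambda>_. einstein_tractor \<mu>)"
    by (simp add: almost_structure_singleton directed_structure_def par_einstein_tractor)
  show "almost_lin_indep doms \<U> F {UNIV} (\<lambda>_. einstein_tractor \<mu>)"
    unfolding almost_lin_indep_def lin_indep_on_def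
  proof (intro ballI allI impI)
    fix U V W \<alpha> \<beta>
    assume U: "U \<in> \<U>" and W: "open W \<and> W \<noteq> {} \<and> W \<subseteq> U \<inter> V"
      and van: "vanishes_on doms W (\<lambda>k p. \<alpha> *\<^sub>R F U k p + \<beta> *\<^sub>R einstein_tractor \<mu> k p)"
    then obtain p where p: "p \<in> W" "p \<in> U" by blast
    obtain i where i: "p \<in> doms i" "F U i p \<noteq> 0"
      using almost_structure_nonzero[OF par U p(2)] by (auto simp: vanishes_on_def)
    obtain s t r where x: "F U i p = (s, t, r)" by (cases "F U i p")
    have "snd (snd (F U i p)) = \<mu> * fst (F U i p)"
      using F U p(2) i(1) unfolding almost_structure_def orthogonal_parallel_def by blast
    then have "r = \<mu> * s"
      by (simp add: x)
    moreover have "\<alpha> *\<^sub>R F U i p + \<beta> *\<^sub>R einstein_tractor \<mu> i p = 0"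
      using van p i by (auto simp: vanishes_on_def)
    ultimately have "\<alpha> * s + \<beta> = 0" "\<mu> * (\<alpha> * s - \<beta>) = 0" and 0: "\<alpha> *\<^sub>R F U i p + \<beta> *\<^sub>R einstein_tractor \<mu> i p = 0"
      by (simp_all add: x einstein_tractor_def zero_prod_def algebra_simps)
    then have "\<beta> = 0" using \<mu> by simp
    then show "\<alpha> = 0 \<and> \<beta> = 0"
      using 0 i by simp
  qed
qed

text \<open>The projections of two structures are parallel, and each of them is either free of zeros, in which
  case it is the structure that is sought, or identically zero. If both projections were zero,
  then both structures would consist of multiples of the Einstein tractor. The combination of
  them that vanishes at a point would vanish nearby, by unique continuation, contradicting
  linear independence.\<close>

lemma orthogonal_structure:
  assumes I: "almost_structure doms par \<U> I" and J: "almost_structure doms par \<V> J"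
    and indep: "almost_lin_indep doms \<U> I \<V> J"
  shows "(\<exists>F. almost_structure doms orth \<U> F) \<or> (\<exists>F. almost_structure doms orth \<V> F)"
proof -
  have proj_case: "almost_structure doms orth \<U> (\<lambda>U i p. proj (I U i p)) \<or>
      (\<forall>U\<in>\<U>. \<forall>p\<in>U. vanishes_on doms {p} (\<lambda>i p. proj (I U i p)))"
    if I: "almost_structure doms par \<U> I" for \<U> I
  proof -
    have orth: "orth U (\<lambda>i p. proj (I U i p))" if "U \<in> \<U>" for U
      using proj_orth I that by (simp add: almost_structure_def)
    have sign: "vanishes_on doms {p} (\<lambda>k q. proj (I U k q) - proj (I V k q)) \<or>
        vanishes_on doms {p} (\<lambda>k q. proj (I U k q) + proj (I V k q))"
      if "U \<in> \<U>" "V \<in> \<U>" "p \<in> U" "p \<in> V" for U V p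
    proof -
      have "proj 0 = 0" by (simp add: proj_def zero_prod_def)
      moreover have "vanishes_on doms {p} (\<lambda>k q. I U k q - I V k q) \<or>
          vanishes_on doms {p} (\<lambda>k q. I U k q + I V k q)"
        using I that by (auto simp: almost_structure_def)
      ultimately show ?thesis
        by (auto simp: vanishes_on_def proj_linear[symmetric])
    qed
    have "(\<forall>U\<in>\<U>. \<forall>p\<in>U. vanishes_on doms {p} (\<lambda>i p. proj (I U i p))) \<or>
        (\<forall>U\<in>\<U>. \<forall>p\<in>U. \<not> vanishes_on doms {p} (\<lambda>i p. proj (I U i p)))"
      by (rule par_dichotomy) (use I orth sign in \<open>auto simp: almost_structure_def orthogonal_parallel_def\<close>)
    moreover have "almost_structure doms orth \<U> (\<lambda>U i p. proj (I U i p))"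
      if nz: "\<forall>U\<in>\<U>. \<forall>p\<in>U. \<not> vanishes_on doms {p} (\<lambda>i p. proj (I U i p))"
      unfolding almost_structure_def
    proof (intro conjI ballI)
      fix U assume U: "U \<in> \<U>"
      have "U \<noteq> {}"
        using I U by (auto simp: almost_structure_def vanishes_on_def)
      then show "\<not> vanishes_on doms U (\<lambda>i p. proj (I U i p))"
        using nz U by (force simp: vanishes_on_def)
    qed (use I orth sign in \<open>auto simp: almost_structure_def\<close>)
    ultimately show ?thesis by blast
  qed
  show ?thesis
  proof (rule ccontr)
    assume "\<not> ?thesis"
    with proj_case[OF I] proj_case[OF J]
    have vI: "\<And>U p. U \<in> \<U> \<Longrightarrow> p \<in> U \<Longrightarrow> vanishes_on doms {p} (\<lambda>i p. proj (I U i p))"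
      and vJ: "\<And>V p. V \<in> \<V> \<Longrightarrow> p \<in> V \<Longrightarrow> vanishes_on doms {p} (\<lambda>i p. proj (J V i p))"
      by blast+
    obtain p :: 'a where True by blast
    obtain i where i: "p \<in> doms i" using charts(2) by blast
    obtain U V where U: "U \<in> \<U>" "p \<in> U" and V: "V \<in> \<V>" "p \<in> V"
      using I J by (auto simp: almost_structure_def) (metis UNIV_I UnionE)
    have multiple: "x = fst x *\<^sub>R (1, 0, - \<mu>)" if "proj x = 0" for x
      using that \<mu> by (auto simp: proj_def zero_prod_def prod_eq_iff field_simps)
    have pI: "I U i p = fst (I U i p) *\<^sub>R (1, 0, - \<mu>)"
      by (rule multiple) (use vI[OF U] i in \<open>auto simp: vanishes_on_def\<close>)
    have pJ: "J V i p = fst (J V i p) *\<^sub>R (1, 0, - \<mu>)"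
      by (rule multiple) (use vJ[OF V] i in \<open>auto simp: vanishes_on_def\<close>)
      \<comment> \<open>At \<open>p\<close> the two tractors are multiples of one vector; this combination of them vanishes there.\<close>
  define \<alpha> \<beta> where "\<alpha> = fst (J V i p)" "\<beta> = - fst (I U i p)"
    let ?T = "\<lambda>i p. \<alpha> *\<^sub>R I U i p + \<beta> *\<^sub>R J V i p"
    have UV: "open (U \<inter> V)" "par (U \<inter> V) (I U)" "par (U \<inter> V) (J V)"
    proof -
      have o: "open U" "open V" "par U (I U)" "par V (J V)"
        using I J U V by (auto simp: almost_structure_def)
      then show "open (U \<inter> V)" by blast
      have "par W S'" if "open W" "open W'" "W \<subseteq> W'" "par W' S'" for W W' S'
        using that(4) smooth_in_chart_subset[OF _ that(3)] that(3)
        unfolding par_iff[OF that(1)] par_iff[OF that(2)] by blast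
      then show "par (U \<inter> V) (I U)" "par (U \<inter> V) (J V)"
        using o \<open>open (U \<inter> V)\<close> by blast+
    qed
    note T = par_linear[OF UV, of \<alpha> \<beta>]
    let ?W = "{q \<in> U \<inter> V. vanishes_on doms {q} ?T}"
    have "?T i p = 0"
      by (subst pI, subst pJ) (simp add: \<alpha>_\<beta>_def zero_prod_def)
    then have "p \<in> ?W"
      using par_zero_iff[OF UV(1) T _ i] U V by (auto simp: vanishes_on_def)
    then have W: "open ?W \<and> ?W \<noteq> {} \<and> ?W \<subseteq> U \<inter> V"
      using par_open_zero_set(1)[OF UV(1) T] by blast
    have "vanishes_on doms ?W ?T"
      by (auto simp: vanishes_on_def)
    then have "\<beta> = 0"
      using indep U(1) V(1) W unfolding almost_lin_indep_def lin_indep_on_def by blast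
    then have "I U i p = 0"
      using pI by (simp add: \<alpha>_\<beta>_def zero_prod_def)
    then have "vanishes_on doms {p} (I U)"
      using par_zero_iff[OF _ _ U(2) i] I U by (auto simp: vanishes_on_def almost_structure_def)
    then show False
      using almost_structure_nonzero[OF I U] by blast
  qed
qed

lemma two_lin_indep_almost_iff:
  "two_lin_indep_almost A g \<mu> \<longleftrightarrow> (\<exists>\<U> F. almost_structure doms orth \<U> F)"
  unfolding two_lin_indep_almost_def Let_def
  using orthogonal_structure lin_indep_einstein_tractor by blast

text \<open>For globally defined parallel tractors linear independence on the whole manifold implies linear
  independence on every non-empty open subset, by unique continuation.\<close>

lemma two_lin_indep_directed_iff:
  "two_lin_indep_directed A g \<mu> \<longleftrightarrow> (\<exists>F. almost_structure doms orth {UNIV} F)"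
proof
  assume "two_lin_indep_directed A g \<mu>"
  then obtain S T where S: "directed_structure doms par S" and T: "directed_structure doms par T"
    and ind: "lin_indep_on doms UNIV S T"
    by (auto simp: two_lin_indep_directed_def Let_def)
  have "lin_indep_on doms W S T" if W: "open W" "W \<noteq> {}" for W
    unfolding lin_indep_on_def
  proof (intro allI impI)
    fix \<alpha> \<beta> assume van: "vanishes_on doms W (\<lambda>k p. \<alpha> *\<^sub>R S k p + \<beta> *\<^sub>R T k p)"
    let ?T = "\<lambda>k p. \<alpha> *\<^sub>R S k p + \<beta> *\<^sub>R T k p"
    have "par UNIV ?T"
      using S T by (intro par_linear) (auto simp: directed_structure_def)
    then have "(\<forall>p. vanishes_on doms {p} ?T) \<or> (\<forall>p. \<not> vanishes_on doms {p} ?T)"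
      using par_dichotomy[of "{UNIV}" "\<lambda>_. ?T"] by (simp add: vanishes_on_def)
    moreover obtain p where "p \<in> W" using W by blast
    then have "vanishes_on doms {p} ?T"
      using van by (auto simp: vanishes_on_def)
    ultimately have "\<forall>p. vanishes_on doms {p} ?T" by blast
    then have "vanishes_on doms UNIV ?T"
      by (auto simp: vanishes_on_def)
    then show "\<alpha> = 0 \<and> \<beta> = 0"
      using ind by (auto simp: lin_indep_on_def)
  qed
  then have "almost_lin_indep doms {UNIV} (\<lambda>_. S) {UNIV} (\<lambda>_. T)"
    by (simp add: almost_lin_indep_def)
  with S T show "\<exists>F. almost_structure doms orth {UNIV} F"
    using orthogonal_structure directed_structure_iff by blast
next
  assume "\<exists>F. almost_structure doms orth {UNIV} F"
  then obtain F where F: "almost_structure doms orth {UNIV} F" by blast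
  note indep = lin_indep_einstein_tractor[OF F]
  have "lin_indep_on doms UNIV (F UNIV) (einstein_tractor \<mu>)"
    using indep(3) by (simp add: almost_lin_indep_def)
  then show "two_lin_indep_directed A g \<mu>"
    using indep(1,2) unfolding two_lin_indep_directed_def Let_def almost_structure_singleton by blast
qed

end

section \<open>Transfer of almost Einstein structures\<close>

text \<open>The formula for a change of scale is linear on each fibre, so that signs and zeros can be tested
  in one scale.\<close>

lemma (in riemannian_manifold) almost_structure_in_scale:
  assumes dim: "CARD('n) \<ge> 3"
  shows "(\<exists>T. almost_structure (scale_dom A (conformal_class A g))
      (parallel_standard_tractor_on A (conformal_class A g)) \<W> T) \<longleftrightarrow>
    (\<exists>X. almost_structure (\<lambda>i. chart_dom (A i)) parallel_in_scale \<W> X)"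
    (is "(\<exists>T. almost_structure ?D ?par _ T) \<longleftrightarrow> (\<exists>X. almost_structure ?d _ _ X)")
proof
  have D: "?D (g, i) = chart_dom (A i)" for i
    using conformal_class_self(2) by (simp add: scale_dom_def)
  assume "\<exists>T. almost_structure ?D ?par \<W> T"
  then obtain T where T: "almost_structure ?D ?par \<W> T" by blast
  have "almost_structure ?d parallel_in_scale \<W> (\<lambda>W i. T W (g, i))"
    unfolding almost_structure_def
  proof (intro conjI ballI)
    show "open W" if "W \<in> \<W>" for W using T that by (simp add: almost_structure_def)
    show "\<Union>\<W> = UNIV" using T by (simp add: almost_structure_def)
    fix W assume W: "W \<in> \<W>"
    then have par: "?par W (T W)" and nz: "\<not> vanishes_on ?D W (T W)"
      using T by (auto simp: almost_structure_def)
    show "parallel_in_scale W (\<lambda>i. T W (g, i))"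
      by (rule parallel_standard_tractor_in_scale[OF par])
    show "\<not> vanishes_on ?d W (\<lambda>i. T W (g, i))"
    proof
      assume van: "vanishes_on ?d W (\<lambda>i. T W (g, i))"
      have "vanishes_on ?D W (T W)"
        unfolding vanishes_on_def
      proof (intro allI ballI)
        fix k p assume p: "p \<in> W \<inter> ?D k"
        obtain h i where k: "k = (h, i)" by (cases k)
        with p have h: "h \<in> conformal_class A g" "p \<in> W" "p \<in> chart_dom (A i)"
          by (auto simp: scale_dom_def split: if_splits)
        then obtain \<omega> where "conformal_rescaling A g \<omega> h" by (auto simp: conformal_class_def)
        from standard_tractor_scale_change[OF par this h(2,3)] show "T W k p = 0"
          using van h by (simp add: vanishes_on_def k scale_change_linear(3))
      qed
      with nz show False ..
    qed
    fix V p assume "V \<in> \<W>" "p \<in> W \<inter> V"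
    then have "vanishes_on ?D {p} (\<lambda>k q. T W k q - T V k q) \<or> vanishes_on ?D {p} (\<lambda>k q. T W k q + T V k q)"
      using T W by (auto simp: almost_structure_def)
    then show "vanishes_on ?d {p} (\<lambda>i q. T W (g, i) q - T V (g, i) q) \<or>
        vanishes_on ?d {p} (\<lambda>i q. T W (g, i) q + T V (g, i) q)"
      unfolding vanishes_on_def using D by blast
  qed
  then show "\<exists>X. almost_structure ?d parallel_in_scale \<W> X" by blast
next
  have D: "?D (g, i) = chart_dom (A i)" for i
    using conformal_class_self(2) by (simp add: scale_dom_def)
  assume "\<exists>X. almost_structure ?d parallel_in_scale \<W> X"
  then obtain X where X: "almost_structure ?d parallel_in_scale \<W> X" by blast
  have ext: "extend_scale Y (h, i) p = 0" if Y: "Y i p = 0" for Y h i p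
    by (simp add: extend_scale_def Y scale_change_linear(3))
  have lin: "extend_scale Y k p - extend_scale Y' k p = extend_scale (\<lambda>i q. Y i q - Y' i q) k p"
    "extend_scale Y k p + extend_scale Y' k p = extend_scale (\<lambda>i q. Y i q + Y' i q) k p" for Y Y' k p
    by (cases k, simp add: extend_scale_def scale_change_linear)+
  have van: "vanishes_on ?D S (extend_scale Y)" if "vanishes_on ?d S Y" for S Y
    using that unfolding vanishes_on_def
    by (auto simp: scale_dom_def intro!: ext split: if_splits)
  have "almost_structure ?D ?par \<W> (\<lambda>W. extend_scale (X W))"
    unfolding almost_structure_def lin
  proof (intro conjI ballI)
    show "open W" if "W \<in> \<W>" for W using X that by (simp add: almost_structure_def)
    show "\<Union>\<W> = UNIV" using X by (simp add: almost_structure_def)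
    fix W assume W: "W \<in> \<W>"
    then have "open W" "parallel_in_scale W (X W)" and nz: "\<not> vanishes_on ?d W (X W)"
      using X by (auto simp: almost_structure_def)
    then show "?par W (extend_scale (X W))"
      by (intro parallel_extend_scale dim)
    show "\<not> vanishes_on ?D W (extend_scale (X W))"
    proof
      assume v: "vanishes_on ?D W (extend_scale (X W))"
      have "vanishes_on ?d W (X W)"
        unfolding vanishes_on_def
      proof (intro allI ballI)
        fix i p assume "p \<in> W \<inter> chart_dom (A i)"
        then have "extend_scale (X W) (g, i) p = 0"
          using v unfolding vanishes_on_def D[symmetric] by blast
        then show "X W i p = 0" by (simp add: extend_scale_self)
      qed
      with nz show False ..
    qed
    fix V p assume V: "V \<in> \<W>" "p \<in> W \<inter> V"
    then have "vanishes_on ?d {p} (\<lambda>i q. X W i q - X V i q) \<or> vanishes_on ?d {p} (\<lambda>i q. X W i q + X V i q)"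
      using X W by (auto simp: almost_structure_def)
    then show "vanishes_on ?D {p} (extend_scale (\<lambda>i q. X W i q - X V i q)) \<or>
        vanishes_on ?D {p} (extend_scale (\<lambda>i q. X W i q + X V i q))"
      using van by blast
  qed
  then show "\<exists>T. almost_structure ?D ?par \<W> T" by blast
qed

lemma pullback_structure:
  assumes F: "almost_structure D P \<U> F" and \<phi>: "surj \<phi>"
    and opens: "\<And>U. U \<in> \<U> \<Longrightarrow> open (\<phi> -` U)"
    and par: "\<And>U. U \<in> \<U> \<Longrightarrow> open U \<Longrightarrow> P U (F U) \<Longrightarrow> Q (\<phi> -` U) (C (F U))"
    and zero: "\<And>S z. vanishes_on D' {z} (C S) \<longleftrightarrow> vanishes_on D {\<phi> z} S"
    and linear: "\<And>S T. (\<lambda>k q. C S k q - C T k q) = C (\<lambda>k q. S k q - T k q)"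
      "\<And>S T. (\<lambda>k q. C S k q + C T k q) = C (\<lambda>k q. S k q + T k q)"
  shows "\<exists>X. almost_structure D' Q ((\<lambda>U. \<phi> -` U) ` \<U>) X"
proof -
  have img: "\<phi> ` (\<phi> -` U) = U" for U
    using \<phi> by (simp add: surj_image_vimage_eq)
  have "almost_structure D' Q ((\<lambda>U. \<phi> -` U) ` \<U>) (\<lambda>W. C (F (\<phi> ` W)))"
    unfolding almost_structure_def ball_simps img linear
  proof (intro conjI ballI)
    show "\<Union>((\<lambda>U. \<phi> -` U) ` \<U>) = UNIV"
      using F by (simp add: almost_structure_def vimage_Union[symmetric])
    fix U assume U: "U \<in> \<U>"
    show "open (\<phi> -` U)" by (rule opens[OF U])
    show "Q (\<phi> -` U) (C (F U))"
      by (rule par[OF U]) (use F U in \<open>auto simp: almost_structure_def\<close>)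
    obtain x k where x: "x \<in> U" "x \<in> D k" "F U k x \<noteq> 0"
      using F U by (auto simp: almost_structure_def vanishes_on_def)
    obtain z where z: "\<phi> z = x" using \<phi> by (metis surjD)
    have "\<not> vanishes_on D' {z} (C (F U))"
      unfolding zero z using x by (auto simp: vanishes_on_def)
    then show "\<not> vanishes_on D' (\<phi> -` U) (C (F U))"
      using x z by (auto simp: vanishes_on_def)
    fix V z assume "V \<in> \<U>" "z \<in> \<phi> -` U \<inter> \<phi> -` V"
    then show "vanishes_on D' {z} (C (\<lambda>k q. F U k q - F V k q)) \<or>
        vanishes_on D' {z} (C (\<lambda>k q. F U k q + F V k q))"
      using F U unfolding zero almost_structure_def by auto
  qed
  then show ?thesis by blast
qed

text \<open>The restriction of a structure to a slice, embedded by \<open>\<phi>\<close>. Slices of different members of the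
  cover may coincide, and then one of the members is chosen; empty slices are discarded, because
  a structure is non-zero on each set of its cover. In the applications \<open>\<iota> i\<close> is the chart of the
  product with first (or second) component \<open>i\<close> and a fixed other component.\<close>

lemma slice_structure:
  assumes cover: "\<Union>\<W> = UNIV" and opens: "\<And>W. W \<in> \<W> \<Longrightarrow> open (\<phi> -` W)"
    and sign: "\<And>W V z. W \<in> \<W> \<Longrightarrow> V \<in> \<W> \<Longrightarrow> z \<in> W \<Longrightarrow> z \<in> V \<Longrightarrow>
      vanishes_on D {z} (\<lambda>k q. Y W k q - Y V k q) \<or> vanishes_on D {z} (\<lambda>k q. Y W k q + Y V k q)"
    and nonzero: "\<And>W z. W \<in> \<W> \<Longrightarrow> z \<in> W \<Longrightarrow> \<not> vanishes_on D {z} (Y W)"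
    and par: "\<And>W. W \<in> \<W> \<Longrightarrow> P (\<phi> -` W) (\<lambda>i x. Y W (\<iota> i) (\<phi> x))"
    and charts: "\<And>i x. x \<in> d i \<Longrightarrow> \<phi> x \<in> D (\<iota> i)"
    and indep: "\<And>W x. W \<in> \<W> \<Longrightarrow> \<phi> x \<in> W \<Longrightarrow> (\<And>i. x \<in> d i \<Longrightarrow> Y W (\<iota> i) (\<phi> x) = 0) \<Longrightarrow>
      vanishes_on D {\<phi> x} (Y W)"
  shows "\<exists>F. almost_structure d P ((\<lambda>W. \<phi> -` W) ` \<W> - {{}}) F"
proof -
  let ?\<U> = "(\<lambda>W. \<phi> -` W) ` \<W> - {{}}"
  define w where "w U = (SOME W. W \<in> \<W> \<and> \<phi> -` W = U)" for U
  have w: "w U \<in> \<W>" "\<phi> -` w U = U" if "U \<in> ?\<U>" for U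
    using someI_ex[of "\<lambda>W. W \<in> \<W> \<and> \<phi> -` W = U"] that unfolding w_def by blast+
  have in_w: "\<phi> x \<in> w U" if "U \<in> ?\<U>" "x \<in> U" for U x
  proof -
    have "x \<in> \<phi> -` w U" by (simp only: w[OF that(1)] that(2))
    then show ?thesis by simp
  qed
  let ?F = "\<lambda>U i x. Y (w U) (\<iota> i) (\<phi> x)"
  have "almost_structure d P ?\<U> ?F"
    unfolding almost_structure_def
  proof (intro conjI ballI)
    show "\<Union>?\<U> = UNIV"
    proof (intro equalityI subsetI UNIV_I)
      fix x
      have "\<phi> x \<in> \<Union>\<W>" by (simp add: cover)
      then obtain W where W: "W \<in> \<W>" "\<phi> x \<in> W" by (rule UnionE)
      then have "\<phi> -` W \<in> ?\<U>" by auto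
      then show "x \<in> \<Union>?\<U>"
        by (rule UnionI) (simp add: W)
    qed
    fix U assume U: "U \<in> ?\<U>"
    show "open U"
      using opens[OF w(1)[OF U]] by (simp only: w(2)[OF U])
    show "P U (?F U)"
      using par[OF w(1)[OF U]] by (simp only: w(2)[OF U])
    obtain x where x: "x \<in> U" using U by blast
    have "\<not> vanishes_on D {\<phi> x} (Y (w U))"
      by (rule nonzero[OF w(1)[OF U] in_w[OF U x]])
    then obtain i where "x \<in> d i" "?F U i x \<noteq> 0"
      using indep[OF w(1)[OF U] in_w[OF U x]] by blast
    then show "\<not> vanishes_on d U (?F U)"
      using x by (auto simp: vanishes_on_def)
    fix V x assume V: "V \<in> ?\<U>" and x: "x \<in> U \<inter> V"
    have "vanishes_on D {\<phi> x} (\<lambda>k q. Y (w U) k q - Y (w V) k q) \<or>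
        vanishes_on D {\<phi> x} (\<lambda>k q. Y (w U) k q + Y (w V) k q)"
      using x by (intro sign w(1) in_w U V) auto
    then show "vanishes_on d {x} (\<lambda>i q. ?F U i q - ?F V i q) \<or> vanishes_on d {x} (\<lambda>i q. ?F U i q + ?F V i q)"
      using charts unfolding vanishes_on_def by blast
  qed
  then show ?thesis by blast
qed

section \<open>Tractors of a special Einstein product\<close>

context special_product
begin

sublocale E1: einstein_factor A1 g1 \<mu>1
  by unfold_locales (rule nonzero)

sublocale E2: einstein_factor A2 g2 \<mu>2
  by unfold_locales (simp add: nonzero opposite)

abbreviation "domsP \<equiv> \<lambda>k. chart_dom (A k)"

text \<open>The middle component of a standard tractor is a covector, that of an Einstein tractor a vector;
  hence the products with the metrics.\<close>

definition combine ::
  "('i, 'a, 'm) triple_field \<Rightarrow> ('j, 'b, 'n) triple_field \<Rightarrow> ('i \<times> 'j, 'a \<times> 'b, 'm + 'n) triple_field" where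
  "combine F1 F2 = (\<lambda>(i, j) z.
     (fst (F1 i (fst z)) + fst (F2 j (snd z)),
      join (g1 i (fst z) *v fst (snd (F1 i (fst z)))) (g2 j (snd z) *v fst (snd (F2 j (snd z)))),
      snd (snd (F1 i (fst z))) + snd (snd (F2 j (snd z)))))"

text \<open>The inverse of \<open>combine\<close> on triples orthogonal to the Einstein tractors: solving \<open>\<sigma> = s1 + s2\<close>
  and \<open>\<rho> = \<mu>1 s1 + \<mu>2 s2\<close> with \<open>\<mu>2 = - \<mu>1\<close> gives \<open>s1 = (\<sigma> + \<rho> / \<mu>1) / 2\<close> and \<open>r1 = \<mu>1 s1\<close>.\<close>

definition part1 :: "('i \<times> 'j, 'a \<times> 'b, 'm + 'n) triple_field \<Rightarrow> ('i \<times> 'j, 'a \<times> 'b, 'm) triple_field" where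
  "part1 X = (\<lambda>(i, j) z.
     ((fst (X (i, j) z) + snd (snd (X (i, j) z)) / \<mu>1) / 2,
      matrix_inv (g1 i (fst z)) *v left_part (fst (snd (X (i, j) z))),
      (\<mu>1 * fst (X (i, j) z) + snd (snd (X (i, j) z))) / 2))"

definition part2 :: "('i \<times> 'j, 'a \<times> 'b, 'm + 'n) triple_field \<Rightarrow> ('i \<times> 'j, 'a \<times> 'b, 'n) triple_field" where
  "part2 X = (\<lambda>(i, j) z.
     ((fst (X (i, j) z) + snd (snd (X (i, j) z)) / \<mu>2) / 2,
      matrix_inv (g2 j (snd z)) *v right_part (fst (snd (X (i, j) z))),
      (\<mu>2 * fst (X (i, j) z) + snd (snd (X (i, j) z))) / 2))"

lemma inverse_metric_cancel:
  "p \<in> chart_dom (A1 i) \<Longrightarrow> matrix_inv (g1 i p) *v (g1 i p *v v) = v"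
  "p \<in> chart_dom (A1 i) \<Longrightarrow> g1 i p *v (matrix_inv (g1 i p) *v v) = v"
  "q \<in> chart_dom (A2 j) \<Longrightarrow> matrix_inv (g2 j q) *v (g2 j q *v w) = w"
  "q \<in> chart_dom (A2 j) \<Longrightarrow> g2 j q *v (matrix_inv (g2 j q) *v w) = w"
  by (simp_all add: matrix_vector_mul_assoc matrix_inv_inverse M1.invertible_metric M2.invertible_metric)

lemma smooth_join:
  assumes "open W" "smooth_in_chart (A k) W v" "smooth_in_chart (A k) W w"
  shows "smooth_in_chart (A k) W (\<lambda>z. join (v z) (w z) :: real^('m + 'n))"
proof -
  interpret chart_region "A k" W by (rule product_chart_region[OF assms(1)])
  have "smooth (\<lambda>z. join (v z) 0 + join 0 (w z) :: real^('m + 'n))"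
    by (intro smooth_add smooth_linear[OF bounded_linear_parts(3)] smooth_linear[OF bounded_linear_parts(4)]
        assms)
  moreover have "join v 0 + join 0 w = join v w" for v :: "real^'m" and w :: "real^'n"
    by (simp add: sum_vec_eq_iff)
  ultimately show ?thesis by simp
qed

text \<open>Orthogonality to the Einstein tractors enters in the middle slot: \<open>\<rho> + \<mu>1 \<sigma>\<close> has to be equal
  to \<open>r1 + \<mu>1 s1\<close>, and the contribution \<open>r2 + \<mu>1 s2 = r2 - \<mu>2 s2\<close> of the other factor vanishes.\<close>

lemma combine_parallel:
  assumes U1: "open U1" and U2: "open U2" and F1: "E1.orth U1 F1" and F2: "E2.orth U2 F2"
  shows "parallel_in_scale (U1 \<times> U2) (combine F1 F2)"
proof -
  note 1 = F1[unfolded orthogonal_parallel_def E1.par_iff[OF U1]]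
  note 2 = F2[unfolded orthogonal_parallel_def E2.par_iff[OF U2]]
  have W: "open (U1 \<times> U2)" by (rule open_Times[OF U1 U2])
  show ?thesis
    unfolding parallel_in_scale_def
  proof (intro conjI allI ballI)
    fix k :: "'i \<times> 'j"
    obtain i j where k: "k = (i, j)" by (cases k)
    interpret R: metric_region A "(i, j)" "U1 \<times> U2" g by (rule region[OF W])
    interpret R1: metric_region A1 i U1 g1 by (rule M1.region[OF U1])
    interpret R2: metric_region A2 j U2 g2 by (rule M2.region[OF U2])
    have s1: "R1.smooth (F1 i)" and s2: "R2.smooth (F2 j)"
      using 1 2 by blast+
    have pull1: "R.smooth (\<lambda>z. f (fst z))" if "R1.smooth f" for f :: "'a \<Rightarrow> 'c::real_normed_vector"
      by (rule smooth_pullback_fst[OF U1 W _ that]) auto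
    have pull2: "R.smooth (\<lambda>z. f (snd z))" if "R2.smooth f" for f :: "'b \<Rightarrow> 'c::real_normed_vector"
      by (rule smooth_pullback_snd[OF U2 W _ that]) auto
    note t1 = pull1[OF R1.smooth_fst[OF R1.smooth_snd[OF s1]]]
    note t2 = pull2[OF R2.smooth_fst[OF R2.smooth_snd[OF s2]]]
    have "R.smooth (combine F1 F2 (i, j))"
      unfolding combine_def split_conv
      by (intro R.smooth_Pair R.smooth_add smooth_join W R.smooth_matrix_vector_mult t1 t2
          pull1[OF R1.smooth_fst[OF s1]] pull2[OF R2.smooth_fst[OF s2]]
          pull1[OF R1.smooth_snd[OF R1.smooth_snd[OF s1]]] pull2[OF R2.smooth_snd[OF R2.smooth_snd[OF s2]]]
          pull1[OF R1.smooth_metric] pull2[OF R2.smooth_metric])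
    then show "smooth_in_chart (A k) (U1 \<times> U2) (combine F1 F2 k)"
      by (simp add: k)
    fix z assume z: "z \<in> (U1 \<times> U2) \<inter> chart_dom (A k)"
    obtain p q where pq: "z = (p, q)" by (cases z)
    have p: "p \<in> U1" "p \<in> chart_dom (A1 i)" and q: "q \<in> U2" "q \<in> chart_dom (A2 j)"
      and zz: "(p, q) \<in> U1 \<times> U2" "(p, q) \<in> chart_dom (A (i, j))"
      using z by (auto simp: k pq product_dom)
    have tt1: "matrix_inv (g1 i (fst z)) *v left_part (fst (snd (combine F1 F2 (i, j) z))) = fst (snd (F1 i (fst z)))"
      if "z \<in> chart_dom (A (i, j))" for z
      using that by (cases z) (simp add: combine_def product_dom inverse_metric_cancel)
    have tt2: "matrix_inv (g2 j (snd z)) *v right_part (fst (snd (combine F1 F2 (i, j) z))) = fst (snd (F2 j (snd z)))"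
      if "z \<in> chart_dom (A (i, j))" for z
      using that by (cases z) (simp add: combine_def product_dom inverse_metric_cancel)
    have st1: "R.smooth (\<lambda>z. matrix_inv (g1 i (fst z)) *v left_part (fst (snd (combine F1 F2 (i, j) z))))"
      by (rule R.smooth_cong[OF _ t1]) (simp add: tt1)
    have st2: "R.smooth (\<lambda>z. matrix_inv (g2 j (snd z)) *v right_part (fst (snd (combine F1 F2 (i, j) z))))"
      by (rule R.smooth_cong[OF _ t2]) (simp add: tt2)
    have d1: "R1.D a (F1 i) p = einstein_rhs (\<lambda>a b. g1 i p $ a $ b) (christoffel A1 g1 i p) \<mu>1 a (F1 i p)" for a
      using 1 p by blast
    have d2: "R2.D e (F2 j) q = einstein_rhs (\<lambda>a b. g2 j q $ a $ b) (christoffel A2 g2 j q) \<mu>2 e (F2 j q)" for e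
      using 2 q by blast
    have d1': "R1.D a (\<lambda>p. fst (F1 i p)) p = (g1 i p *v fst (snd (F1 i p))) $ a"
      "R1.D a (\<lambda>p. fst (snd (F1 i p)) $ b) p = - (\<Sum>c\<in>UNIV. christoffel A1 g1 i p b a c * fst (snd (F1 i p)) $ c)
        - (if b = a then snd (snd (F1 i p)) + \<mu>1 * fst (F1 i p) else 0)"
      "R1.D a (\<lambda>p. snd (snd (F1 i p))) p = \<mu>1 * (g1 i p *v fst (snd (F1 i p))) $ a" for a b
      using d1[of a] unfolding R1.pderiv_triple_eq_iff[OF s1 p]
      by (simp_all add: einstein_rhs_def matrix_vector_mult_def)
    have d2': "R2.D a (\<lambda>p. fst (F2 j p)) q = (g2 j q *v fst (snd (F2 j q))) $ a"
      "R2.D a (\<lambda>p. fst (snd (F2 j p)) $ b) q = - (\<Sum>c\<in>UNIV. christoffel A2 g2 j q b a c * fst (snd (F2 j q)) $ c)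
        - (if b = a then snd (snd (F2 j q)) + \<mu>2 * fst (F2 j q) else 0)"
      "R2.D a (\<lambda>p. snd (snd (F2 j p))) q = \<mu>2 * (g2 j q *v fst (snd (F2 j q))) $ a" for a b
      using d2[of a] unfolding R2.pderiv_triple_eq_iff[OF s2 q]
      by (simp_all add: einstein_rhs_def matrix_vector_mult_def)
    have o: "snd (snd (F1 i p)) = \<mu>1 * fst (F1 i p)" "snd (snd (F2 j q)) = \<mu>2 * fst (F2 j q)"
      using 1 2 p q by blast+
    note D1 = pderiv_pullback_fst[OF U1 _ p(1) zz(2)] and D2 = pderiv_pullback_snd[OF U2 _ q(1) zz(2)]
    note f1 = R1.smooth_fst[OF s1] R1.smooth_nth[OF R1.smooth_fst[OF R1.smooth_snd[OF s1]]]
      R1.smooth_snd[OF R1.smooth_snd[OF s1]]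
    note f2 = R2.smooth_fst[OF s2] R2.smooth_nth[OF R2.smooth_fst[OF R2.smooth_snd[OF s2]]]
      R2.smooth_snd[OF R2.smooth_snd[OF s2]]
    have c1: "R.D l (\<lambda>z. (matrix_inv (g1 i (fst z)) *v left_part (fst (snd (combine F1 F2 (i, j) z)))) $ b) (p, q)
        = R.D l (\<lambda>z. fst (snd (F1 i (fst z))) $ b) (p, q)" for l b
      by (rule R.pderiv_cong[OF _ R.smooth_nth[OF st1] zz]) (simp add: tt1)
    have c2: "R.D l (\<lambda>z. (matrix_inv (g2 j (snd z)) *v right_part (fst (snd (combine F1 F2 (i, j) z)))) $ b) (p, q)
        = R.D l (\<lambda>z. fst (snd (F2 j (snd z))) $ b) (p, q)" for l b
      by (rule R.pderiv_cong[OF _ R.smooth_nth[OF st2] zz]) (simp add: tt2)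
    have sums: "R.D l (\<lambda>z. fst (combine F1 F2 (i, j) z)) (p, q) =
        R.D l (\<lambda>z. fst (F1 i (fst z))) (p, q) + R.D l (\<lambda>z. fst (F2 j (snd z))) (p, q)"
      "R.D l (\<lambda>z. snd (snd (combine F1 F2 (i, j) z))) (p, q) =
        R.D l (\<lambda>z. snd (snd (F1 i (fst z)))) (p, q) + R.D l (\<lambda>z. snd (snd (F2 j (snd z)))) (p, q)" for l
      unfolding combine_def split_conv fst_conv snd_conv
      by (rule R.pderiv_add[OF zz pull1[OF f1(1)] pull2[OF f2(1)]]
          R.pderiv_add[OF zz pull1[OF f1(3)] pull2[OF f2(3)]])+
    note all = c1 c2 sums D1[OF f1(1)] D1[OF f1(2)] D1[OF f1(3)] D2[OF f2(1)] D2[OF f2(2)] D2[OF f2(3)]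
      tt1[OF zz(2), unfolded fst_conv] tt2[OF zz(2), unfolded snd_conv]
    have v: "fst (combine F1 F2 (i, j) (p, q)) = fst (F1 i p) + fst (F2 j q)"
      "fst (snd (combine F1 F2 (i, j) (p, q))) = join (g1 i p *v fst (snd (F1 i p))) (g2 j q *v fst (snd (F2 j q)))"
      "snd (snd (combine F1 F2 (i, j) (p, q))) = snd (snd (F1 i p)) + snd (snd (F2 j q))"
      by (simp_all add: combine_def)
    have eqs: "normal_tractor_deriv A g (i, j) (Inl a) (combine F1 F2 (i, j)) (p, q) = 0"
      "normal_tractor_deriv A g (i, j) (Inr e) (combine F1 F2 (i, j)) (p, q) = 0" for a e
      unfolding product_tractor_deriv[OF W zz st1 st2] all v d1' d2' join_nth o
      by (simp_all add: opposite inverse_metric_cancel(1)[OF p(2)] inverse_metric_cancel(3)[OF q(2)]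
          algebra_simps)
    show "normal_tractor_deriv A g k l (combine F1 F2 k) z = 0" for l
      by (cases l) (simp_all add: k pq eqs)
  next
    fix k l :: "'i \<times> 'j" and z assume z: "z \<in> (U1 \<times> U2) \<inter> chart_dom (A k) \<inter> chart_dom (A l)"
    obtain i j i' j' p q where kl: "k = (i, j)" "l = (i', j')" "z = (p, q)"
      by (cases k, cases l, cases z)
    have d: "(p, q) \<in> chart_dom (A (i, j))" "(p, q) \<in> chart_dom (A (i', j'))"
      and p: "p \<in> U1" "p \<in> chart_dom (A1 i)" "p \<in> chart_dom (A1 i')"
      and q: "q \<in> U2" "q \<in> chart_dom (A2 j)" "q \<in> chart_dom (A2 j')"
      using z by (auto simp: kl product_dom)
    have e1: "F1 i' p = (fst (F1 i p), chart_jacobian (A1 i) (A1 i') p *v fst (snd (F1 i p)), snd (snd (F1 i p)))"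
      using 1 p by blast
    have e2: "F2 j' q = (fst (F2 j q), chart_jacobian (A2 j) (A2 j') q *v fst (snd (F2 j q)), snd (snd (F2 j q)))"
      using 2 q by blast
    show "combine F1 F2 k z = (case combine F1 F2 l z of (\<sigma>, \<mu>, \<rho>) \<Rightarrow>
        (\<sigma>, transpose (chart_jacobian (A k) (A l) z) *v \<mu>, \<rho>))"
      by (simp add: kl combine_def product_jacobian[OF d] block_diag_mult e1 e2
          M1.metric_transform[OF p(2,3)] M2.metric_transform[OF q(2,3)]
          matrix_vector_mul_assoc[symmetric] del: transpose_matrix_vector)
  qed
qed

lemma combine_zero_iff:
  assumes "p \<in> chart_dom (A1 i)" "q \<in> chart_dom (A2 j)"
  shows "combine F1 (\<lambda>_ _. 0) (i, j) (p, q) = 0 \<longleftrightarrow> F1 i p = 0"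
    "combine (\<lambda>_ _. 0) F2 (i, j) (p, q) = 0 \<longleftrightarrow> F2 j q = 0"
proof -
  have "g1 i p *v v = 0 \<longleftrightarrow> v = 0" for v
    using inverse_metric_cancel(1)[OF assms(1), of v] by auto
  moreover have "g2 j q *v w = 0 \<longleftrightarrow> w = 0" for w
    using inverse_metric_cancel(3)[OF assms(2), of w] by auto
  moreover have "join v w = 0 \<longleftrightarrow> v = 0 \<and> w = 0" for v :: "real^'m" and w :: "real^'n"
    by (simp add: vec_eq_iff split_sum_all)
  ultimately show "combine F1 (\<lambda>_ _. 0) (i, j) (p, q) = 0 \<longleftrightarrow> F1 i p = 0"
    "combine (\<lambda>_ _. 0) F2 (i, j) (p, q) = 0 \<longleftrightarrow> F2 j q = 0"
    by (auto simp: combine_def prod_eq_iff)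
qed

lemma zero_orth: "E1.orth UNIV (\<lambda>_ _. 0)" "E2.orth UNIV (\<lambda>_ _. 0)"
  by (auto simp: orthogonal_parallel_def E1.par_iff E2.par_iff einstein_rhs_def pderiv_chart_def
      vec_eq_iff zero_prod_def intro!: chart_region.smooth_const chart_region.intro M1.charts M2.charts)

lemma vanishes_on_product:
  "vanishes_on domsP {(p, q)} X \<longleftrightarrow>
    (\<forall>i j. p \<in> chart_dom (A1 i) \<longrightarrow> q \<in> chart_dom (A2 j) \<longrightarrow> X (i, j) (p, q) = 0)"
proof -
  have "vanishes_on domsP {(p, q)} X \<longleftrightarrow> (\<forall>k. (p, q) \<in> domsP k \<longrightarrow> X k (p, q) = 0)"
    unfolding vanishes_on_def by blast
  then show ?thesis
    by (auto simp: split_paired_All product_dom)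
qed

lemma factor1_to_product:
  assumes F: "almost_structure E1.doms E1.orth \<U> F"
  shows "\<exists>X. almost_structure domsP parallel_in_scale ((\<lambda>U. fst -` U) ` \<U>) X"
proof (rule pullback_structure[where \<phi> = fst and C = "\<lambda>S. combine S (\<lambda>_ _. 0)", OF F])
  show "open (fst -` U :: ('a \<times> 'b) set)" if "U \<in> \<U>" for U
    using F that by (intro open_vimage_fst) (simp add: almost_structure_def)
  show "parallel_in_scale (fst -` U) (combine (F U) (\<lambda>_ _. 0))" if "open U" "E1.orth U (F U)" for U
    using combine_parallel[OF that(1) open_UNIV that(2) zero_orth(2)] by (simp add: vimage_fst)
  show "vanishes_on domsP {z} (combine S (\<lambda>_ _. 0)) \<longleftrightarrow> vanishes_on E1.doms {fst z} S" for S z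
  proof -
    obtain p q where z: "z = (p, q)" by (cases z)
    obtain j where "q \<in> chart_dom (A2 j)" using M2.charts(2) by blast
    then show ?thesis
      unfolding z vanishes_on_product by (auto simp: vanishes_on_def combine_zero_iff)
  qed
qed (auto simp: combine_def fun_eq_iff sum_vec_eq_iff matrix_vector_right_distrib
    matrix_vector_mult_diff_distrib)

lemma factor2_to_product:
  assumes F: "almost_structure E2.doms E2.orth \<U> F"
  shows "\<exists>X. almost_structure domsP parallel_in_scale ((\<lambda>U. snd -` U) ` \<U>) X"
proof (rule pullback_structure[where \<phi> = snd and C = "combine (\<lambda>_ _. 0)", OF F])
  show "open (snd -` U :: ('a \<times> 'b) set)" if "U \<in> \<U>" for U
    using F that by (intro open_vimage_snd) (simp add: almost_structure_def)
  show "parallel_in_scale (snd -` U) (combine (\<lambda>_ _. 0) (F U))" if "open U" "E2.orth U (F U)" for U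
    using combine_parallel[OF open_UNIV that(1) zero_orth(1) that(2)] by (simp add: vimage_snd)
  show "vanishes_on domsP {z} (combine (\<lambda>_ _. 0) S) \<longleftrightarrow> vanishes_on E2.doms {snd z} S" for S z
  proof -
    obtain p q where z: "z = (p, q)" by (cases z)
    obtain i where "p \<in> chart_dom (A1 i)" using M1.charts(2) by blast
    then show ?thesis
      unfolding z vanishes_on_product by (auto simp: vanishes_on_def combine_zero_iff)
  qed
qed (auto simp: combine_def fun_eq_iff sum_vec_eq_iff matrix_vector_right_distrib
    matrix_vector_mult_diff_distrib)

end

context special_product
begin

lemma part_linear:
  "part1 (\<lambda>k q. X k q - Y k q) = (\<lambda>k q. part1 X k q - part1 Y k q)"
  "part1 (\<lambda>k q. X k q + Y k q) = (\<lambda>k q. part1 X k q + part1 Y k q)"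
  "part2 (\<lambda>k q. X k q - Y k q) = (\<lambda>k q. part2 X k q - part2 Y k q)"
  "part2 (\<lambda>k q. X k q + Y k q) = (\<lambda>k q. part2 X k q + part2 Y k q)"
  by (auto simp: part1_def part2_def fun_eq_iff left_part_def right_part_def vec_eq_iff
      matrix_vector_mult_def algebra_simps sum.distrib sum_subtractf add_divide_distrib diff_divide_distrib)

lemma part_zero: "X k z = 0 \<Longrightarrow> part1 X k z = 0" "X k z = 0 \<Longrightarrow> part2 X k z = 0"
proof -
  have "left_part (0 :: real^('m + 'n)) = 0" "right_part (0 :: real^('m + 'n)) = 0"
    by (simp_all add: vec_eq_iff)
  then show "X k z = 0 \<Longrightarrow> part1 X k z = 0" "X k z = 0 \<Longrightarrow> part2 X k z = 0"
    by (cases k; simp add: part1_def part2_def zero_prod_def)+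
qed

lemma vanishes_on_part:
  assumes "vanishes_on domsP S X"
  shows "vanishes_on domsP S (part1 X)" "vanishes_on domsP S (part2 X)"
  unfolding vanishes_on_def
proof (intro allI ballI)
  fix k z assume "z \<in> S \<inter> domsP k"
  then have "X k z = 0" using assms unfolding vanishes_on_def by blast
  then show "part1 X k z = 0" by (rule part_zero)
next
  show "\<forall>k. \<forall>z\<in>S \<inter> domsP k. part2 X k z = 0"
  proof (intro allI ballI)
    fix k z assume "z \<in> S \<inter> domsP k"
    then have "X k z = 0" using assms unfolding vanishes_on_def by blast
    then show "part2 X k z = 0" by (rule part_zero)
  qed
qed

text \<open>Since \<open>\<mu>1\<close> and \<open>\<mu>2\<close> are different, \<open>\<sigma>\<close> and \<open>\<rho>\<close> can be recovered from the two scalar parts.\<close>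

lemma parts_determine:
  assumes "z \<in> domsP k" "part1 X k z = 0" "part2 X k z = 0"
  shows "X k z = 0"
proof -
  obtain i j p q where kz: "k = (i, j)" "z = (p, q)" by (cases k, cases z)
  have p: "p \<in> chart_dom (A1 i)" and q: "q \<in> chart_dom (A2 j)"
    using assms(1) by (simp_all add: kz product_dom)
  obtain s m r where x: "X (i, j) (p, q) = (s, m, r)" by (cases "X (i, j) (p, q)")
  have "s + r / \<mu>1 = 0" "s + r / \<mu>2 = 0" and m: "matrix_inv (g1 i p) *v left_part m = 0"
    "matrix_inv (g2 j q) *v right_part m = 0"
    using assms(2,3) by (simp_all add: kz part1_def part2_def x zero_prod_def)
  then have "s = 0" "r = 0"
    using nonzero by (simp_all add: opposite)
  moreover have "left_part m = 0" "right_part m = 0"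
    using inverse_metric_cancel(2)[OF p, of "left_part m"] inverse_metric_cancel(4)[OF q, of "right_part m"]
    unfolding m by simp_all
  then have "m = 0"
    by (simp add: vec_eq_iff split_sum_all)
  ultimately show ?thesis
    by (simp add: kz x zero_prod_def)
qed

lemma part_transform:
  assumes X: "parallel_in_scale W X" and z: "z \<in> W" "z \<in> domsP (i, j)" "z \<in> domsP (i', j')"
  shows "part1 X (i', j') z = (fst (part1 X (i, j) z),
      chart_jacobian (A1 i) (A1 i') (fst z) *v fst (snd (part1 X (i, j) z)), snd (snd (part1 X (i, j) z)))"
    "part2 X (i', j') z = (fst (part2 X (i, j) z),
      chart_jacobian (A2 j) (A2 j') (snd z) *v fst (snd (part2 X (i, j) z)), snd (snd (part2 X (i, j) z)))"
proof -
  obtain p q where pq: "z = (p, q)" by (cases z)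
  have dom: "p \<in> chart_dom (A1 i)" "p \<in> chart_dom (A1 i')" "q \<in> chart_dom (A2 j)" "q \<in> chart_dom (A2 j')"
    and d: "(p, q) \<in> domsP (i, j)" "(p, q) \<in> domsP (i', j')"
    using z by (simp_all add: pq product_dom)
  obtain s m r where x: "X (i', j') (p, q) = (s, m, r)" by (cases "X (i', j') (p, q)")
  have "X (i, j) z = (case X (i', j') z of (\<sigma>, \<mu>, \<rho>) \<Rightarrow>
      (\<sigma>, transpose (chart_jacobian (A (i, j)) (A (i', j')) z) *v \<mu>, \<rho>))"
    using X z unfolding parallel_in_scale_def by blast
  then have "X (i, j) (p, q) = (s, join (transpose (chart_jacobian (A1 i) (A1 i') p) *v left_part m)
      (transpose (chart_jacobian (A2 j) (A2 j') q) *v right_part m), r)"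
    by (simp add: pq x product_jacobian[OF d] block_diag_mult del: transpose_matrix_vector)
  then show "part1 X (i', j') z = (fst (part1 X (i, j) z),
      chart_jacobian (A1 i) (A1 i') (fst z) *v fst (snd (part1 X (i, j) z)), snd (snd (part1 X (i, j) z)))"
    "part2 X (i', j') z = (fst (part2 X (i, j) z),
      chart_jacobian (A2 j) (A2 j') (snd z) *v fst (snd (part2 X (i, j) z)), snd (snd (part2 X (i, j) z)))"
    by (simp_all add: part1_def part2_def pq x M1.raise_transform[OF dom(1,2)]
        M2.raise_transform[OF dom(3,4)] del: transpose_matrix_vector)
qed

text \<open>Along the first factor \<open>d\<rho> = \<mu>1 d\<sigma>\<close>, and along the second \<open>d\<rho> = \<mu>2 d\<sigma> = - \<mu>1 d\<sigma>\<close>. Hence \<open>\<sigma> + \<rho> / \<mu>1\<close>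
  is constant along the second factor, \<open>\<sigma> + \<rho> / \<mu>2\<close> along the first, and the equations for the
  middle slot become those of Einstein tractors of the factors.\<close>

lemma part_system:
  assumes W: "open W" and X: "parallel_in_scale W X"
  shows "smooth_in_chart (A (i, j)) W (part1 X (i, j))" "smooth_in_chart (A (i, j)) W (part2 X (i, j))"
    and "(p, q) \<in> W \<Longrightarrow> (p, q) \<in> domsP (i, j) \<Longrightarrow> pderiv_chart (A (i, j)) (Inl a) (part1 X (i, j)) (p, q) =
      einstein_rhs (\<lambda>a b. g1 i p $ a $ b) (christoffel A1 g1 i p) \<mu>1 a (part1 X (i, j) (p, q))"
    and "(p, q) \<in> W \<Longrightarrow> (p, q) \<in> domsP (i, j) \<Longrightarrow>
      pderiv_chart (A (i, j)) (Inr e) (part1 X (i, j)) (p, q) = 0"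
    and "(p, q) \<in> W \<Longrightarrow> (p, q) \<in> domsP (i, j) \<Longrightarrow>
      pderiv_chart (A (i, j)) (Inl a) (part2 X (i, j)) (p, q) = 0"
    and "(p, q) \<in> W \<Longrightarrow> (p, q) \<in> domsP (i, j) \<Longrightarrow> pderiv_chart (A (i, j)) (Inr e) (part2 X (i, j)) (p, q) =
      einstein_rhs (\<lambda>a b. g2 j q $ a $ b) (christoffel A2 g2 j q) \<mu>2 e (part2 X (i, j) (p, q))"
proof -
  interpret R: metric_region A "(i, j)" W g by (rule region[OF W])
  have sX: "R.smooth (X (i, j))"
    using X unfolding parallel_in_scale_def by blast
  have inv1: "smooth_in_chart (A1 i) UNIV (\<lambda>p. matrix_inv (g1 i p))"
    and inv2: "smooth_in_chart (A2 j) UNIV (\<lambda>q. matrix_inv (g2 j q))"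
    using chart_region.smooth_matrix_inv[of "A1 i" UNIV "g1 i"] chart_region.smooth_matrix_inv[of "A2 j" UNIV "g2 j"]
      M1.metric M2.metric
    by (simp_all add: chart_region_def M1.charts M2.charts M1.invertible_metric M2.invertible_metric
        riemannian_metric_def)
  have H: "R.smooth (\<lambda>z. matrix_inv (g1 i (fst z)))" "R.smooth (\<lambda>z. matrix_inv (g2 j (snd z)))"
    by (rule smooth_pullback_fst[OF open_UNIV W _ inv1] smooth_pullback_snd[OF open_UNIV W _ inv2]; simp)+
  note f = R.smooth_fst[OF sX] R.smooth_fst[OF R.smooth_snd[OF sX]] R.smooth_snd[OF R.smooth_snd[OF sX]]
  have st: "R.smooth (\<lambda>z. matrix_inv (g1 i (fst z)) *v left_part (fst (snd (X (i, j) z))))"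
    "R.smooth (\<lambda>z. matrix_inv (g2 j (snd z)) *v right_part (fst (snd (X (i, j) z))))"
    by (intro R.smooth_matrix_vector_mult H R.smooth_linear[OF bounded_linear_parts(1)]
        R.smooth_linear[OF bounded_linear_parts(2)] f)+
  have c: "R.smooth (\<lambda>z. (fst (X (i, j) z) + snd (snd (X (i, j) z)) / \<nu>) / 2)"
    "R.smooth (\<lambda>z. (\<nu> * fst (X (i, j) z) + snd (snd (X (i, j) z))) / 2)" if "\<nu> \<noteq> 0" for \<nu>
    using that by (intro R.smooth_divide R.smooth_add R.smooth_mult R.smooth_const f; simp)+
  have \<mu>2: "\<mu>2 \<noteq> 0" using nonzero opposite by simp
  show s1: "R.smooth (part1 X (i, j))" and s2: "R.smooth (part2 X (i, j))"
    unfolding part1_def part2_def split_conv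
    by (intro R.smooth_Pair c st nonzero \<mu>2)+
  have dc: "R.D l (\<lambda>z. (fst (X (i, j) z) + snd (snd (X (i, j) z)) / \<nu>) / 2) z =
      (R.D l (\<lambda>z. fst (X (i, j) z)) z + R.D l (\<lambda>z. snd (snd (X (i, j) z))) z / \<nu>) / 2"
    "R.D l (\<lambda>z. (\<nu> * fst (X (i, j) z) + snd (snd (X (i, j) z))) / 2) z =
      (\<nu> * R.D l (\<lambda>z. fst (X (i, j) z)) z + R.D l (\<lambda>z. snd (snd (X (i, j) z))) z) / 2"
    if z: "z \<in> W" "z \<in> domsP (i, j)" and "\<nu> \<noteq> 0" for l z \<nu>
  proof -
    have L: "bounded_linear (\<lambda>x :: ('m + 'n) triple. (fst x + snd (snd x) / \<nu>) / 2)"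
      "bounded_linear (\<lambda>x :: ('m + 'n) triple. (\<nu> * fst x + snd (snd x)) / 2)"
      "bounded_linear (\<lambda>x :: ('m + 'n) triple. fst x)" "bounded_linear (\<lambda>x :: ('m + 'n) triple. snd (snd x))"
      by (intro bounded_linear_add bounded_linear_compose[OF bounded_linear_divide]
          bounded_linear_compose[OF bounded_linear_mult_right] bounded_linear_fst
          bounded_linear_compose[OF bounded_linear_snd bounded_linear_snd])+
    show "R.D l (\<lambda>z. (fst (X (i, j) z) + snd (snd (X (i, j) z)) / \<nu>) / 2) z =
        (R.D l (\<lambda>z. fst (X (i, j) z)) z + R.D l (\<lambda>z. snd (snd (X (i, j) z))) z / \<nu>) / 2"
      "R.D l (\<lambda>z. (\<nu> * fst (X (i, j) z) + snd (snd (X (i, j) z))) / 2) z =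
        (\<nu> * R.D l (\<lambda>z. fst (X (i, j) z)) z + R.D l (\<lambda>z. snd (snd (X (i, j) z))) z) / 2"
      by (simp_all only: R.pderiv_linear[OF z L(1) sX] R.pderiv_linear[OF z L(2) sX]
          R.pderiv_linear[OF z L(3) sX] R.pderiv_linear[OF z L(4) sX])
  qed
  assume z: "(p, q) \<in> W" "(p, q) \<in> domsP (i, j)"
  have dom: "p \<in> chart_dom (A1 i)" "q \<in> chart_dom (A2 j)"
    using z by (simp_all add: product_dom)
  have par: "normal_tractor_deriv A g (i, j) l (X (i, j)) (p, q) = 0" for l
    using X z unfolding parallel_in_scale_def by blast
  note L = par[of "Inl _", unfolded product_tractor_deriv(1)[OF W z st]]
  note R = par[of "Inr _", unfolded product_tractor_deriv(2)[OF W z st]]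
  have gm: "(\<Sum>b\<in>UNIV. g1 i p $ a $ b * (matrix_inv (g1 i p) *v left_part m) $ b) = m $ Inl a"
    "(\<Sum>b\<in>UNIV. g2 j q $ e $ b * (matrix_inv (g2 j q) *v right_part m) $ b) = m $ Inr e" for a e m
    using arg_cong[OF inverse_metric_cancel(2)[OF dom(1), of "left_part m"], of "\<lambda>v. v $ a"]
      arg_cong[OF inverse_metric_cancel(4)[OF dom(2), of "right_part m"], of "\<lambda>v. v $ e"]
    by (simp_all add: matrix_vector_mult_def[of "g1 i p"] matrix_vector_mult_def[of "g2 j q"])
  let ?s = "fst (X (i, j) (p, q))" and ?m = "fst (snd (X (i, j) (p, q)))"
    and ?r = "snd (snd (X (i, j) (p, q)))"
  let ?t1 = "\<lambda>z. matrix_inv (g1 i (fst z)) *v left_part (fst (snd (X (i, j) z)))"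
    and ?t2 = "\<lambda>z. matrix_inv (g2 j (snd z)) *v right_part (fst (snd (X (i, j) z)))"
  have l: "R.D (Inl a) (\<lambda>z. fst (X (i, j) z)) (p, q) = ?m $ Inl a"
    "R.D (Inl a) (\<lambda>z. ?t1 z $ b) (p, q) = - (\<Sum>c\<in>UNIV. christoffel A1 g1 i p b a c * ?t1 (p, q) $ c)
      - (if b = a then ?r + \<mu>1 * ?s else 0)"
    "R.D (Inl a) (\<lambda>z. ?t2 z $ b') (p, q) = 0"
    "R.D (Inl a) (\<lambda>z. snd (snd (X (i, j) z))) (p, q) = \<mu>1 * ?m $ Inl a" for a b b'
  proof -
    have "R.D (Inl a) (\<lambda>z. ?t1 z $ b) (p, q) + (\<Sum>c\<in>UNIV. christoffel A1 g1 i p b a c * ?t1 (p, q) $ c)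
        + (if b = a then ?r + \<mu>1 * ?s else 0) = 0"
      using L[of a] by blast
    then show "R.D (Inl a) (\<lambda>z. ?t1 z $ b) (p, q) =
        - (\<Sum>c\<in>UNIV. christoffel A1 g1 i p b a c * ?t1 (p, q) $ c) - (if b = a then ?r + \<mu>1 * ?s else 0)"
      by linarith
  qed (use L[of a] in blast)+
  have r: "R.D (Inr e) (\<lambda>z. fst (X (i, j) z)) (p, q) = ?m $ Inr e"
    "R.D (Inr e) (\<lambda>z. ?t2 z $ b) (p, q) = - (\<Sum>c\<in>UNIV. christoffel A2 g2 j q b e c * ?t2 (p, q) $ c)
      - (if b = e then ?r + \<mu>2 * ?s else 0)"
    "R.D (Inr e) (\<lambda>z. ?t1 z $ b') (p, q) = 0"
    "R.D (Inr e) (\<lambda>z. snd (snd (X (i, j) z))) (p, q) = \<mu>2 * ?m $ Inr e" for e b b'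
  proof -
    have "R.D (Inr e) (\<lambda>z. ?t2 z $ b) (p, q) + (\<Sum>c\<in>UNIV. christoffel A2 g2 j q b e c * ?t2 (p, q) $ c)
        + (if b = e then ?r + \<mu>2 * ?s else 0) = 0"
      using R[of e] by blast
    then show "R.D (Inr e) (\<lambda>z. ?t2 z $ b) (p, q) =
        - (\<Sum>c\<in>UNIV. christoffel A2 g2 j q b e c * ?t2 (p, q) $ c) - (if b = e then ?r + \<mu>2 * ?s else 0)"
      by linarith
  qed (use R[of e] in blast)+
  show "R.D (Inl a) (part1 X (i, j)) (p, q) =
      einstein_rhs (\<lambda>a b. g1 i p $ a $ b) (christoffel A1 g1 i p) \<mu>1 a (part1 X (i, j) (p, q))"
    unfolding R.pderiv_triple_eq_iff[OF s1 z]
    unfolding part1_def split_conv fst_conv snd_conv einstein_rhs_def gm dc[OF z nonzero] l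
    using nonzero by (simp add: gm field_simps)
  show "R.D (Inr e) (part1 X (i, j)) (p, q) = 0"
    unfolding R.pderiv_triple_eq_iff[OF s1 z]
    unfolding part1_def split_conv fst_conv snd_conv dc[OF z nonzero] r
    using nonzero by (simp add: opposite)
  show "R.D (Inl a) (part2 X (i, j)) (p, q) = 0"
    unfolding R.pderiv_triple_eq_iff[OF s2 z]
    unfolding part2_def split_conv fst_conv snd_conv dc[OF z \<mu>2] l
    using nonzero by (simp add: opposite)
  show "R.D (Inr e) (part2 X (i, j)) (p, q) =
      einstein_rhs (\<lambda>a b. g2 j q $ a $ b) (christoffel A2 g2 j q) \<mu>2 e (part2 X (i, j) (p, q))"
    unfolding R.pderiv_triple_eq_iff[OF s2 z]
    unfolding part2_def split_conv fst_conv snd_conv einstein_rhs_def gm dc[OF z \<mu>2] r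
    using \<mu>2 by (simp add: gm field_simps)
qed

lemma part_chart_independent:
  assumes X: "parallel_in_scale W X" and z: "z \<in> W" "z \<in> domsP k" "z \<in> domsP l"
  shows "part1 X k z = 0 \<Longrightarrow> part1 X l z = 0" "part2 X k z = 0 \<Longrightarrow> part2 X l z = 0"
proof -
  obtain i j i' j' where kl: "k = (i, j)" "l = (i', j')" by (cases k, cases l)
  show "part1 X k z = 0 \<Longrightarrow> part1 X l z = 0" "part2 X k z = 0 \<Longrightarrow> part2 X l z = 0"
    using part_transform[OF X z(1), of i j i' j'] z by (simp_all add: kl zero_prod_def)
qed

text \<open>Each part satisfies a linear system on the product, so that unique continuation holds on the
  product itself and not only along the slices.\<close>

lemma part_open_zero_sets:
  assumes W: "open W" and X: "parallel_in_scale W X"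
  shows "open {z \<in> W. vanishes_on domsP {z} (part1 X)}" "open {z \<in> W. \<not> vanishes_on domsP {z} (part1 X)}"
    "open {z \<in> W. vanishes_on domsP {z} (part2 X)}" "open {z \<in> W. \<not> vanishes_on domsP {z} (part2 X)}"
proof -
  have opens: "open {z \<in> W \<inter> domsP k. part1 X k z = 0}" "open {z \<in> W \<inter> domsP k. part1 X k z \<noteq> 0}"
    "open {z \<in> W \<inter> domsP k. part2 X k z = 0}" "open {z \<in> W \<inter> domsP k. part2 X k z \<noteq> 0}" for k
  proof -
    obtain i j where k: "k = (i, j)" by (cases k)
    interpret R: metric_region A "(i, j)" W g by (rule region[OF W])
    note s = part_system(1,2)[OF W X, of i j]
    show "open {z \<in> W \<inter> domsP k. part1 X k z \<noteq> 0}" "open {z \<in> W \<inter> domsP k. part2 X k z \<noteq> 0}"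
      unfolding k by (rule R.open_nonzero_set[OF s(1)] R.open_nonzero_set[OF s(2)])+
    have V1: "smooth_in_chart (A1 i) UNIV (\<lambda>p. christoffel A1 g1 i p b a c)" for b a c
      using metric_region.christoffel_smooth[OF M1.region[OF open_UNIV]] .
    have V2: "smooth_in_chart (A2 j) UNIV (\<lambda>q. christoffel A2 g2 j q b a c)" for b a c
      using metric_region.christoffel_smooth[OF M2.region[OF open_UNIV]] .
    show "open {z \<in> W \<inter> domsP k. part1 X k z = 0}"
      unfolding k
    proof (rule R.open_zero_set_einstein[where G = "\<lambda>z a b. g1 i (fst z) $ a $ b"
          and V = "\<lambda>z. christoffel A1 g1 i (fst z)" and \<mu> = \<mu>1, OF s(1)])
      show "R.smooth (\<lambda>z. g1 i (fst z) $ a $ b)" for a b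
        by (rule smooth_pullback_fst[OF open_UNIV W _ smooth_metric_parts(1)]) simp
      show "R.smooth (\<lambda>z. christoffel A1 g1 i (fst z) b a c)" for b a c
        by (rule smooth_pullback_fst[OF open_UNIV W _ V1]) simp
      show "R.D l (part1 X (i, j)) z = 0 \<or> (\<exists>a. R.D l (part1 X (i, j)) z =
          einstein_rhs (\<lambda>a b. g1 i (fst z) $ a $ b) (christoffel A1 g1 i (fst z)) \<mu>1 a (part1 X (i, j) z))"
        if "z \<in> W" "z \<in> domsP (i, j)" for z l
        using part_system(3,4)[OF W X] that by (cases l; cases z) auto
    qed
    show "open {z \<in> W \<inter> domsP k. part2 X k z = 0}"
      unfolding k
    proof (rule R.open_zero_set_einstein[where G = "\<lambda>z a b. g2 j (snd z) $ a $ b"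
          and V = "\<lambda>z. christoffel A2 g2 j (snd z)" and \<mu> = \<mu>2, OF s(2)])
      show "R.smooth (\<lambda>z. g2 j (snd z) $ a $ b)" for a b
        by (rule smooth_pullback_snd[OF open_UNIV W _ smooth_metric_parts(2)]) simp
      show "R.smooth (\<lambda>z. christoffel A2 g2 j (snd z) b a c)" for b a c
        by (rule smooth_pullback_snd[OF open_UNIV W _ V2]) simp
      show "R.D l (part2 X (i, j)) z = 0 \<or> (\<exists>a. R.D l (part2 X (i, j)) z =
          einstein_rhs (\<lambda>a b. g2 j (snd z) $ a $ b) (christoffel A2 g2 j (snd z)) \<mu>2 a (part2 X (i, j) z))"
        if "z \<in> W" "z \<in> domsP (i, j)" for z l
        using part_system(5,6)[OF W X] that by (cases l; cases z) auto
    qed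
  qed
  show "open {z \<in> W. vanishes_on domsP {z} (part1 X)}" "open {z \<in> W. \<not> vanishes_on domsP {z} (part1 X)}"
    by (rule open_vanishing_set[OF charts(2) part_chart_independent(1)[OF X] opens(1,2)]; assumption)+
  show "open {z \<in> W. vanishes_on domsP {z} (part2 X)}" "open {z \<in> W. \<not> vanishes_on domsP {z} (part2 X)}"
    by (rule open_vanishing_set[OF charts(2) part_chart_independent(2)[OF X] opens(3,4)]; assumption)+
qed

lemma part1_slice:
  assumes W: "open W" and X: "parallel_in_scale W X" and y: "y \<in> chart_dom (A2 j)"
  shows "E1.orth ((\<lambda>x. (x, y)) -` W) (\<lambda>i x. part1 X (i, j) (x, y))"
proof -
  let ?U = "{x. (x, y) \<in> W}"
  have U: "open ?U" by (rule open_slices[OF W])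
  have "E1.orth ?U (\<lambda>i x. part1 X (i, j) (x, y))"
    unfolding orthogonal_parallel_def E1.par_iff[OF U]
  proof (intro conjI allI ballI)
    fix i
    interpret S: affine_in_charts "A1 i" ?U "A (i, j)" W "\<lambda>x. (x, y)" "\<lambda>v. join v 0" "join 0 (coords (A2 j) y)"
      unfolding product_atlas_simp
      by (rule left_slice_affine_in_charts[OF M1.charts(1) M2.charts(1) W y])
    note sm = part_system(1)[OF W X, of i j]
    show "smooth_in_chart (A1 i) ?U (\<lambda>x. part1 X (i, j) (x, y))"
      by (rule S.smooth_pullback[OF sm])
    show "snd (snd (part1 X (i, j) (x, y))) = \<mu>1 * fst (part1 X (i, j) (x, y))" for x
      using nonzero by (simp add: part1_def field_simps)
    show "pderiv_chart (A1 i) a (\<lambda>x. part1 X (i, j) (x, y)) x =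
        einstein_rhs (\<lambda>a b. g1 i x $ a $ b) (christoffel A1 g1 i x) \<mu>1 a (part1 X (i, j) (x, y))"
      if x: "x \<in> ?U \<inter> chart_dom (A1 i)" for a x
      using S.pderiv_pullback(1)[OF sm, of x a "Inl a"] part_system(3)[OF W X, of x y i j a] x y
      by (simp add: parts_axis product_dom)
    show "part1 X (i', j) (x, y) = (fst (part1 X (i, j) (x, y)),
        chart_jacobian (A1 i) (A1 i') x *v fst (snd (part1 X (i, j) (x, y))), snd (snd (part1 X (i, j) (x, y))))"
      if "x \<in> ?U \<inter> chart_dom (A1 i) \<inter> chart_dom (A1 i')" for i' x
      using part_transform(1)[OF X, of "(x, y)" i j i' j] that y by (simp add: product_dom)
  qed
  then show ?thesis by (simp add: vimage_def)
qed

lemma part2_slice: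
  assumes W: "open W" and X: "parallel_in_scale W X" and x: "x \<in> chart_dom (A1 i)"
  shows "E2.orth ((\<lambda>y. (x, y)) -` W) (\<lambda>j y. part2 X (i, j) (x, y))"
proof -
  let ?U = "{y. (x, y) \<in> W}"
  have U: "open ?U" by (rule open_slices[OF W])
  have "E2.orth ?U (\<lambda>j y. part2 X (i, j) (x, y))"
    unfolding orthogonal_parallel_def E2.par_iff[OF U]
  proof (intro conjI allI ballI)
    fix j
    interpret S: affine_in_charts "A2 j" ?U "A (i, j)" W "\<lambda>y. (x, y)" "\<lambda>v. join 0 v" "join (coords (A1 i) x) 0"
      unfolding product_atlas_simp
      by (rule right_slice_affine_in_charts[OF M1.charts(1) M2.charts(1) W x])
    note sm = part_system(2)[OF W X, of i j]
    show "smooth_in_chart (A2 j) ?U (\<lambda>y. part2 X (i, j) (x, y))"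
      by (rule S.smooth_pullback[OF sm])
    show "snd (snd (part2 X (i, j) (x, y))) = \<mu>2 * fst (part2 X (i, j) (x, y))" for y
      using E2.\<mu> by (simp add: part2_def field_simps)
    show "pderiv_chart (A2 j) e (\<lambda>y. part2 X (i, j) (x, y)) y =
        einstein_rhs (\<lambda>a b. g2 j y $ a $ b) (christoffel A2 g2 j y) \<mu>2 e (part2 X (i, j) (x, y))"
      if y: "y \<in> ?U \<inter> chart_dom (A2 j)" for e y
      using S.pderiv_pullback(1)[OF sm, of y e "Inr e"] part_system(6)[OF W X, of x y i j e] x y
      by (simp add: parts_axis product_dom)
    show "part2 X (i, j') (x, y) = (fst (part2 X (i, j) (x, y)),
        chart_jacobian (A2 j) (A2 j') y *v fst (snd (part2 X (i, j) (x, y))), snd (snd (part2 X (i, j) (x, y))))"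
      if "y \<in> ?U \<inter> chart_dom (A2 j) \<inter> chart_dom (A2 j')" for j' y
      using part_transform(2)[OF X, of "(x, y)" i j i j'] that x by (simp add: product_dom)
  qed
  then show ?thesis by (simp add: vimage_def)
qed

text \<open>By unique continuation on the connected product each of the two parts is either identically zero or
  free of zeros, and not both are identically zero. The restriction of a part without zeros to
  any slice of its factor is the structure that is sought.\<close>

lemma product_to_factor:
  assumes X: "almost_structure domsP parallel_in_scale \<W> X"
  shows "(\<exists>F. almost_structure E1.doms E1.orth ((\<lambda>W. (\<lambda>x. (x, y0)) -` W) ` \<W> - {{}}) F) \<or>
    (\<exists>F. almost_structure E2.doms E2.orth ((\<lambda>W. (\<lambda>y. (x0, y)) -` W) ` \<W> - {{}}) F)"
proof -
  have cover: "\<Union>\<W> = UNIV"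
    using X by (simp add: almost_structure_def)
  have W: "open W" "parallel_in_scale W (X W)" if "W \<in> \<W>" for W
    using X that by (auto simp: almost_structure_def)
  have sign: "vanishes_on domsP {z} (\<lambda>k q. X W k q - X V k q) \<or> vanishes_on domsP {z} (\<lambda>k q. X W k q + X V k q)"
    if "W \<in> \<W>" "V \<in> \<W>" "z \<in> W" "z \<in> V" for W V z
    using X that by (auto simp: almost_structure_def)
  have sign1: "vanishes_on domsP {z} (\<lambda>k q. part1 (X W) k q - part1 (X V) k q) \<or>
      vanishes_on domsP {z} (\<lambda>k q. part1 (X W) k q + part1 (X V) k q)"
    and sign2: "vanishes_on domsP {z} (\<lambda>k q. part2 (X W) k q - part2 (X V) k q) \<or>
      vanishes_on domsP {z} (\<lambda>k q. part2 (X W) k q + part2 (X V) k q)"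
    if "W \<in> \<W>" "V \<in> \<W>" "z \<in> W" "z \<in> V" for W V z
    using sign[OF that] unfolding part_linear[symmetric] by (auto intro: vanishes_on_part)
  have dich1: "(\<forall>W\<in>\<W>. \<forall>z\<in>W. vanishes_on domsP {z} (part1 (X W))) \<or>
      (\<forall>W\<in>\<W>. \<forall>z\<in>W. \<not> vanishes_on domsP {z} (part1 (X W)))"
  proof (rule zero_dichotomy[OF charts(3) cover])
    show "open {z \<in> W. vanishes_on domsP {z} (part1 (X W))}"
      "open {z \<in> W. \<not> vanishes_on domsP {z} (part1 (X W))}" if "W \<in> \<W>" for W
      by (rule part_open_zero_sets[OF W[OF that]])+
    show "vanishes_on domsP {z} (part1 (X V))" if "W \<in> \<W>" "V \<in> \<W>" "z \<in> W" "z \<in> V"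
      "vanishes_on domsP {z} (part1 (X W))" for W V z
      by (rule vanishes_on_sign[OF sign1[OF that(1-4)] that(5)])
  qed
  have dich2: "(\<forall>W\<in>\<W>. \<forall>z\<in>W. vanishes_on domsP {z} (part2 (X W))) \<or>
      (\<forall>W\<in>\<W>. \<forall>z\<in>W. \<not> vanishes_on domsP {z} (part2 (X W)))"
  proof (rule zero_dichotomy[OF charts(3) cover])
    show "open {z \<in> W. vanishes_on domsP {z} (part2 (X W))}"
      "open {z \<in> W. \<not> vanishes_on domsP {z} (part2 (X W))}" if "W \<in> \<W>" for W
      by (rule part_open_zero_sets[OF W[OF that]])+
    show "vanishes_on domsP {z} (part2 (X V))" if "W \<in> \<W>" "V \<in> \<W>" "z \<in> W" "z \<in> V"
      "vanishes_on domsP {z} (part2 (X W))" for W V z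
      by (rule vanishes_on_sign[OF sign2[OF that(1-4)] that(5)])
  qed
  have not_both: "\<not> ((\<forall>W\<in>\<W>. \<forall>z\<in>W. vanishes_on domsP {z} (part1 (X W))) \<and>
      (\<forall>W\<in>\<W>. \<forall>z\<in>W. vanishes_on domsP {z} (part2 (X W))))"
  proof
    assume both: "(\<forall>W\<in>\<W>. \<forall>z\<in>W. vanishes_on domsP {z} (part1 (X W))) \<and>
      (\<forall>W\<in>\<W>. \<forall>z\<in>W. vanishes_on domsP {z} (part2 (X W)))"
    have "(x0, y0) \<in> \<Union>\<W>" by (simp only: cover UNIV_I)
    then obtain V where V: "V \<in> \<W>" by (rule UnionE)
    then obtain k z where z: "z \<in> V" "z \<in> domsP k" "X V k z \<noteq> 0"
      using X by (auto simp: almost_structure_def vanishes_on_def)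
    have "vanishes_on domsP {z} (part1 (X V))" "vanishes_on domsP {z} (part2 (X V))"
      using both V z by blast+
    then have "part1 (X V) k z = 0" "part2 (X V) k z = 0"
      using z unfolding vanishes_on_def by blast+
    then show False
      using parts_determine z by blast
  qed
  obtain i0 where i0: "x0 \<in> chart_dom (A1 i0)" using M1.charts(2) by blast
  obtain j0 where j0: "y0 \<in> chart_dom (A2 j0)" using M2.charts(2) by blast
  consider "\<forall>W\<in>\<W>. \<forall>z\<in>W. \<not> vanishes_on domsP {z} (part1 (X W))"
    | "\<forall>W\<in>\<W>. \<forall>z\<in>W. \<not> vanishes_on domsP {z} (part2 (X W))"
    using dich1 dich2 not_both by blast
  then show ?thesis
  proof cases
    case 1
    have "\<exists>F. almost_structure E1.doms E1.orth ((\<lambda>W. (\<lambda>x. (x, y0)) -` W) ` \<W> - {{}}) F"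
    proof (rule slice_structure[where D = domsP and Y = "\<lambda>W. part1 (X W)" and \<iota> = "\<lambda>i. (i, j0)",
          OF cover _ sign1])
      show "open ((\<lambda>x. (x, y0)) -` W)" if "W \<in> \<W>" for W
        using open_slices(1)[OF W(1)[OF that]] by (simp add: vimage_def)
      show "E1.orth ((\<lambda>x. (x, y0)) -` W) (\<lambda>i x. part1 (X W) (i, j0) (x, y0))" if "W \<in> \<W>" for W
        by (rule part1_slice[OF W[OF that] j0])
      show "\<not> vanishes_on domsP {z} (part1 (X W))" if "W \<in> \<W>" "z \<in> W" for W z
        using 1 that by blast
      show "(x, y0) \<in> domsP (i, j0)" if "x \<in> E1.doms i" for i x
        using that j0 by (simp add: product_dom)
      show "vanishes_on domsP {(x, y0)} (part1 (X W))"
        if w: "W \<in> \<W>" "(x, y0) \<in> W" and z: "\<And>i. x \<in> E1.doms i \<Longrightarrow> part1 (X W) (i, j0) (x, y0) = 0" for W x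
        unfolding vanishes_on_product
      proof (intro allI impI)
        fix i j assume ij: "x \<in> chart_dom (A1 i)" "y0 \<in> chart_dom (A2 j)"
        show "part1 (X W) (i, j) (x, y0) = 0"
          by (rule part_chart_independent(1)[OF W(2)[OF w(1)] w(2) _ _ z[OF ij(1)]])
            (simp_all add: product_dom ij j0)
      qed
    qed
    then show ?thesis by blast
  next
    case 2
    have "\<exists>F. almost_structure E2.doms E2.orth ((\<lambda>W. (\<lambda>y. (x0, y)) -` W) ` \<W> - {{}}) F"
    proof (rule slice_structure[where D = domsP and Y = "\<lambda>W. part2 (X W)" and \<iota> = "\<lambda>j. (i0, j)",
          OF cover _ sign2])
      show "open ((\<lambda>y. (x0, y)) -` W)" if "W \<in> \<W>" for W
        using open_slices(2)[OF W(1)[OF that]] by (simp add: vimage_def)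
      show "E2.orth ((\<lambda>y. (x0, y)) -` W) (\<lambda>j y. part2 (X W) (i0, j) (x0, y))" if "W \<in> \<W>" for W
        by (rule part2_slice[OF W[OF that] i0])
      show "\<not> vanishes_on domsP {z} (part2 (X W))" if "W \<in> \<W>" "z \<in> W" for W z
        using 2 that by blast
      show "(x0, y) \<in> domsP (i0, j)" if "y \<in> E2.doms j" for j y
        using that i0 by (simp add: product_dom)
      show "vanishes_on domsP {(x0, y)} (part2 (X W))"
        if w: "W \<in> \<W>" "(x0, y) \<in> W" and z: "\<And>j. y \<in> E2.doms j \<Longrightarrow> part2 (X W) (i0, j) (x0, y) = 0" for W y
        unfolding vanishes_on_product
      proof (intro allI impI)
        fix i j assume ij: "x0 \<in> chart_dom (A1 i)" "y \<in> chart_dom (A2 j)"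
        show "part2 (X W) (i, j) (x0, y) = 0"
          by (rule part_chart_independent(2)[OF W(2)[OF w(1)] w(2) _ _ z[OF ij(2)]])
            (simp_all add: product_dom ij i0)
      qed
    qed
    then show ?thesis by blast
  qed
qed

lemma almost_einstein_product:
  "admits_almost_einstein A (conformal_class A g) \<longleftrightarrow>
    two_lin_indep_almost A1 g1 \<mu>1 \<or> two_lin_indep_almost A2 g2 \<mu>2"
proof -
  have "admits_almost_einstein A (conformal_class A g) \<longleftrightarrow>
      (\<exists>\<W> X. almost_structure domsP parallel_in_scale \<W> X)"
    unfolding admits_almost_einstein_def by (simp only: almost_structure_in_scale[OF dim_product])
  also have "\<dots> \<longleftrightarrow> (\<exists>\<U> F. almost_structure E1.doms E1.orth \<U> F) \<or> (\<exists>\<U> F. almost_structure E2.doms E2.orth \<U> F)"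
    using product_to_factor factor1_to_product factor2_to_product by blast
  finally show ?thesis
    by (simp only: E1.two_lin_indep_almost_iff E2.two_lin_indep_almost_iff)
qed

text \<open>All constructions above turn the trivial cover of one manifold into the trivial cover of the
  other.\<close>

lemma directed_almost_einstein_product:
  "admits_directed_almost_einstein A (conformal_class A g) \<longleftrightarrow>
    two_lin_indep_directed A1 g1 \<mu>1 \<or> two_lin_indep_directed A2 g2 \<mu>2"
proof -
  have "admits_directed_almost_einstein A (conformal_class A g) \<longleftrightarrow>
      (\<exists>T. almost_structure (scale_dom A (conformal_class A g))
        (parallel_standard_tractor_on A (conformal_class A g)) {UNIV} T)"
    unfolding admits_directed_almost_einstein_def
    using directed_structure_iff almost_structure_singleton by blast
  also have "\<dots> \<longleftrightarrow> (\<exists>X. almost_structure domsP parallel_in_scale {UNIV} X)"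
    by (rule almost_structure_in_scale[OF dim_product])
  also have "\<dots> \<longleftrightarrow> (\<exists>F. almost_structure E1.doms E1.orth {UNIV} F) \<or> (\<exists>F. almost_structure E2.doms E2.orth {UNIV} F)"
  proof
    assume "\<exists>X. almost_structure domsP parallel_in_scale {UNIV} X"
    then obtain X where "almost_structure domsP parallel_in_scale {UNIV} X" by blast
    from product_to_factor[OF this] show "(\<exists>F. almost_structure E1.doms E1.orth {UNIV} F) \<or>
        (\<exists>F. almost_structure E2.doms E2.orth {UNIV} F)"
      by simp
  next
    assume "(\<exists>F. almost_structure E1.doms E1.orth {UNIV} F) \<or> (\<exists>F. almost_structure E2.doms E2.orth {UNIV} F)"
    then show "\<exists>X. almost_structure domsP parallel_in_scale {UNIV} X"
      using factor1_to_product[of "{UNIV}"] factor2_to_product[of "{UNIV}"] by auto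
  qed
  finally show ?thesis
    by (simp only: E1.two_lin_indep_directed_iff E2.two_lin_indep_directed_iff)
qed

end

lemma special_product_intro:
  fixes A1 :: "('i, 'a::{second_countable_topology, t2_space}, 'm::finite) atlas"
    and A2 :: "('j, 'b::{second_countable_topology, t2_space}, 'n::finite) atlas"
  assumes "special_einstein_product A1 g1 \<mu>1 A2 g2 \<mu>2"
  shows "special_product A1 g1 A2 g2 \<mu>1 \<mu>2"
proof -
  have E: "einstein_manifold A1 g1 \<mu>1" "einstein_manifold A2 g2 \<mu>2" and dim: "CARD('m) + CARD('n) \<ge> 3"
    using assms unfolding special_einstein_product_def by blast+
  interpret M1: riemannian_manifold A1 g1
    using E(1) by unfold_locales (auto simp: einstein_manifold_def)
  interpret M2: riemannian_manifold A2 g2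
    using E(2) by unfold_locales (auto simp: einstein_manifold_def)
  obtain i j and p :: 'a and q :: 'b where "p \<in> chart_dom (A1 i)" "q \<in> chart_dom (A2 j)"
    using M1.charts(2) M2.charts(2) by blast
  then have "einstein_tractor_metric (g1 i p) (einstein_tractor \<mu>1 i p)
      = - einstein_tractor_metric (g2 j q) (einstein_tractor \<mu>2 j q)"
    "einstein_tractor_metric (g2 j q) (einstein_tractor \<mu>2 j q) \<noteq> 0"
    using assms unfolding special_einstein_product_def by blast+
  then have "\<mu>2 = - \<mu>1" "\<mu>1 \<noteq> 0"
    by (auto simp: einstein_tractor_metric_def einstein_tractor_def)
  then show ?thesis
    using E dim by unfold_locales auto
qed

theorem theorem3p1:
  fixes A1 :: "('i, 'a::{second_countable_topology, t2_space}, 'm::finite) atlas"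
    and g1 :: "('i, 'a, 'm) metric_comps" and \<mu>1 :: real
    and A2 :: "('j, 'b::{second_countable_topology, t2_space}, 'n::finite) atlas"
    and g2 :: "('j, 'b, 'n) metric_comps" and \<mu>2 :: real
  assumes "special_einstein_product A1 g1 \<mu>1 A2 g2 \<mu>2"
  shows "(admits_almost_einstein (product_atlas A1 A2)
              (conformal_class (product_atlas A1 A2) (product_metric g1 g2)) \<longleftrightarrow>
            two_lin_indep_almost A1 g1 \<mu>1 \<or> two_lin_indep_almost A2 g2 \<mu>2) \<and>
         (admits_directed_almost_einstein (product_atlas A1 A2)
              (conformal_class (product_atlas A1 A2) (product_metric g1 g2)) \<longleftrightarrow>
            two_lin_indep_directed A1 g1 \<mu>1 \<or> two_lin_indep_directed A2 g2 \<mu>2)"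
proof -
  interpret special_product A1 g1 A2 g2 \<mu>1 \<mu>2
    by (rule special_product_intro[OF assms])
  show ?thesis
    using almost_einstein_product directed_almost_einstein_product by blast
qed

end
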